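(* Let $E$ be a $\mathbb{P}^d$-object ($d>0$) of a triangulated category $\mathcal{D}$ of finite type admitting a split-generator, and let $T^{\mathbb{P}}_E$ be the $\mathbb{P}$-twist along $E$. Then, for all $t\in\mathbb{R}$, $$-2dt \leq h_t(T^{\mathbb{P}}_E) \leq \begin{cases} 0 & (\text{if } t \geq 0),\\ -2dt & (\text{if } t \leq 0).\end{cases}$$ If moreover $E^\perp \neq 0$, then $h_t(T^{\mathbb{P}}_E) = 0$ for all $t \geq 0$.
   Context: Standing assumptions: all triangulated categories are linear over a field $\mathbb{K}$, admit a dg enhancement (i.e. are equivalent, as triangulated categories, to $H^0(\mathcal{A})$ for a pretriangulated dg category $\mathcal{A}$), and all exact functors between them admit dg lifts; cones of natural transformations are formed functorially via these. $\mathrm{Hom}^*_\mathcal{D}(E,F)=\bigoplus_{i\in\mathbb{Z}}\mathrm{Hom}_\mathcal{D}(E,F[i])[-i]$. Finite type: $\dim\mathrm{Hom}^*_\mathcal{D}(E,F)<\infty$ for all objects $E,F$. $E^\perp=\{F\in\mathrm{Ob}(\mathcal{D}) : \mathrm{Hom}^*_\mathcal{D}(E,F)=0\}$. $\mathbb{P}^d$-object ($d>0$) of $\mathcal{D}$ of finite type: an object $E$ such that (1) $\mathrm{Hom}^*_\mathcal{D}(E,E)\cong\mathbb{K}[h]/(h^{d+1})$ with $\deg h=2$; (2) there is a functorial isomorphism $\mathrm{Hom}^*_\mathcal{D}(E,-)\cong\mathrm{Hom}^*_\mathcal{D}(-,E[2d])^\vee$. The $\mathbb{P}$-twist $T^{\mathbb{P}}_E$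 is the exact autoequivalence of $\mathcal{D}$ (made functorial via the dg enhancement) given on objects by $$T^{\mathbb{P}}_EF=\mathrm{Cone}\bigl(\mathrm{Cone}(\mathrm{Hom}^*_\mathcal{D}(E,F)\otimes E[-2]\xrightarrow{h^*\otimes\mathrm{id}-\mathrm{id}\otimes h}\mathrm{Hom}^*_\mathcal{D}(E,F)\otimes E)\xrightarrow{\mathrm{ev}}F\bigr),$$ where $h^*:\mathrm{Hom}^*_\mathcal{D}(E,F)\to\mathrm{Hom}^*_\mathcal{D}(E,F)[2]$ is precomposition with $h\in\mathrm{Hom}_\mathcal{D}(E,E[2])$. Split-generator: an object $G$ of a triangulated category $\mathcal{D}$ such that the smallest full triangulated subcategory containing $G$ and closed under taking direct summands is $\mathcal{D}$. Categorical complexity: for objects $E,F$ of $\mathcal{D}$ and $t \in \mathbb{R}$, $\delta_t(E,F)=0$ if $F\cong 0$; otherwise $\delta_t(E,F) \in [0,\infty]$ is the infimum of $\sum_{i=1}^k e^{n_i t}$ over all sequences of integers $(n_1,\dots,n_k)$ for which there exist an object $F'$ and objects $0=A_0,A_1,\dots,A_k = F\oplus F'$ with exact triangles $A_{i-1}\to A_i \to E[n_i] \to A_{i-1}[1]$ for $i=1,\dots,k$. Categorical entropy of an exact endofunctor $\Phi$ of $\mathcal{D}$: $h_t(\Phi) = \lim_{n\to\infty}\frac1n\log\delta_t(G,\Phi^nG) \in [-\infty,\infty)$ for a split-generator $G$ (the limit exists and is independent of $G$). *)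

theory Defs
  imports
    "HOL-Library.Extended_Real"
    "HOL-Library.FuncSet"
    "HOL-Library.Function_Algebras"
    "HOL-Library.Product_Plus"
    "HOL-Computational_Algebra.Polynomial"
begin

section \<open>Linear categories and functors\<close>

text \<open>
  All arrows of a \<open>K\<close>-linear category live in one \<open>K\<close>-vector space \<open>'m\<close>, of which the
  hom-spaces are subspaces meeting only in \<open>0\<close>.  No generality is lost: for
  \<open>'m\<close> one may take the direct sum of all hom-spaces, composition being extended bilinearly.
  The field \<open>K\<close> is the type \<open>'k\<close>.
\<close>

definition lin_on ::
  "('k \<Rightarrow> 'm \<Rightarrow> 'm) \<Rightarrow> ('k \<Rightarrow> 'n \<Rightarrow> 'n) \<Rightarrow> 'm set \<Rightarrow> ('m::ab_group_add \<Rightarrow> 'n::ab_group_add) \<Rightarrow> bool" where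
  "lin_on s s' V f \<longleftrightarrow>
     (\<forall>x\<in>V. \<forall>y\<in>V. f (x + y) = f x + f y) \<and> (\<forall>c. \<forall>x\<in>V. f (s c x) = s' c (f x))"

definition fin_dim :: "('k::field \<Rightarrow> 'm \<Rightarrow> 'm) \<Rightarrow> 'm::ab_group_add set \<Rightarrow> bool" where
  "fin_dim s V \<longleftrightarrow> (\<exists>B. finite B \<and> V = module.span s B)"

definition dual_space :: "('k::field \<Rightarrow> 'm \<Rightarrow> 'm) \<Rightarrow> 'm::ab_group_add set \<Rightarrow> ('m \<Rightarrow> 'k) set" where
  "dual_space s V = {l \<in> extensional V. lin_on s (*) V l}"

record ('k, 'o, 'm) cat_ops =
  obj :: "'o set"
  cmp :: "'m \<Rightarrow> 'm \<Rightarrow> 'm" (infixr "\<cdot>\<index>" 70)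
  idn :: "'o \<Rightarrow> 'm"
  scl :: "'k \<Rightarrow> 'm \<Rightarrow> 'm"

record ('k, 'o, 'm) tri_cat = "('k, 'o, 'm) cat_ops" +
  hom :: "'o \<Rightarrow> 'o \<Rightarrow> 'm set"
  shO :: "int \<Rightarrow> 'o \<Rightarrow> 'o"
  shM :: "int \<Rightarrow> 'm \<Rightarrow> 'm"
  tri :: "('o \<times> 'o \<times> 'o \<times> 'm \<times> 'm \<times> 'm) set"

locale linear_category =
  fixes D :: "('k::field, 'o, 'm::ab_group_add, 'z) tri_cat_scheme" (structure)
  assumes vs: "vector_space (scl D)"
    and hom_subspace: "\<lbrakk>X \<in> obj D; Y \<in> obj D\<rbrakk> \<Longrightarrow> module.subspace (scl D) (hom D X Y)"
    and hom_disjoint: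
      "\<lbrakk>X \<in> obj D; Y \<in> obj D; X' \<in> obj D; Y' \<in> obj D; f \<in> hom D X Y; f \<in> hom D X' Y'; f \<noteq> 0\<rbrakk>
        \<Longrightarrow> X = X' \<and> Y = Y'"
    and cmp_closed:
      "\<lbrakk>X \<in> obj D; Y \<in> obj D; Z \<in> obj D; f \<in> hom D X Y; g \<in> hom D Y Z\<rbrakk> \<Longrightarrow> g \<cdot> f \<in> hom D X Z"
    and cmp_lin_left:
      "\<lbrakk>X \<in> obj D; Y \<in> obj D; Z \<in> obj D; f \<in> hom D X Y\<rbrakk>
        \<Longrightarrow> lin_on (scl D) (scl D) (hom D Y Z) (\<lambda>g. g \<cdot> f)"
    and cmp_lin_right:
      "\<lbrakk>X \<in> obj D; Y \<in> obj D; Z \<in> obj D; g \<in> hom D Y Z\<rbrakk>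
        \<Longrightarrow> lin_on (scl D) (scl D) (hom D X Y) (\<lambda>f. g \<cdot> f)"
    and cmp_assoc:
      "\<lbrakk>W \<in> obj D; X \<in> obj D; Y \<in> obj D; Z \<in> obj D; f \<in> hom D W X; g \<in> hom D X Y; h \<in> hom D Y Z\<rbrakk>
        \<Longrightarrow> (h \<cdot> g) \<cdot> f = h \<cdot> (g \<cdot> f)"
    and idn_closed: "X \<in> obj D \<Longrightarrow> idn D X \<in> hom D X X"
    and idn_left: "\<lbrakk>X \<in> obj D; Y \<in> obj D; f \<in> hom D X Y\<rbrakk> \<Longrightarrow> idn D Y \<cdot> f = f"
    and idn_right: "\<lbrakk>X \<in> obj D; Y \<in> obj D; f \<in> hom D X Y\<rbrakk> \<Longrightarrow> f \<cdot> idn D X = f"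

definition zero_obj :: "('k, 'o, 'm::zero, 'z) tri_cat_scheme \<Rightarrow> 'o \<Rightarrow> bool" where
  "zero_obj D Z \<longleftrightarrow> Z \<in> obj D \<and> (\<forall>X\<in>obj D. hom D X Z = {0} \<and> hom D Z X = {0})"

definition iso_arrow :: "('k, 'o, 'm, 'z) tri_cat_scheme \<Rightarrow> 'o \<Rightarrow> 'o \<Rightarrow> 'm \<Rightarrow> bool" where
  "iso_arrow D X Y f \<longleftrightarrow>
     f \<in> hom D X Y \<and> (\<exists>g\<in>hom D Y X. g \<cdot>\<^bsub>D\<^esub> f = idn D X \<and> f \<cdot>\<^bsub>D\<^esub> g = idn D Y)"

definition biproduct :: "('k, 'o, 'm::ab_group_add, 'z) tri_cat_scheme \<Rightarrow> 'o \<Rightarrow> 'o \<Rightarrow> 'o \<Rightarrow> bool" where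
  "biproduct D X Y S \<longleftrightarrow>
     S \<in> obj D \<and>
     (\<exists>i\<in>hom D X S. \<exists>j\<in>hom D Y S. \<exists>p\<in>hom D S X. \<exists>q\<in>hom D S Y.
        p \<cdot>\<^bsub>D\<^esub> i = idn D X \<and> q \<cdot>\<^bsub>D\<^esub> j = idn D Y \<and> p \<cdot>\<^bsub>D\<^esub> j = 0 \<and> q \<cdot>\<^bsub>D\<^esub> i = 0 \<and>
        i \<cdot>\<^bsub>D\<^esub> p + j \<cdot>\<^bsub>D\<^esub> q = idn D S)"

record ('o, 'm, 'p, 'n) cat_functor =
  fob :: "'o \<Rightarrow> 'p"
  fmo :: "'m \<Rightarrow> 'n"

definition linear_functor ::
  "('k, 'o, 'm::ab_group_add, 'z) tri_cat_scheme \<Rightarrow> ('k, 'p, 'n::ab_group_add, 'y) tri_cat_scheme \<Rightarrow>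
   ('o, 'm, 'p, 'n, 'x) cat_functor_scheme \<Rightarrow> bool" where
  "linear_functor D D' F \<longleftrightarrow>
     (\<forall>X\<in>obj D. fob F X \<in> obj D' \<and> fmo F (idn D X) = idn D' (fob F X)) \<and>
     (\<forall>X\<in>obj D. \<forall>Y\<in>obj D. fmo F ` hom D X Y \<subseteq> hom D' (fob F X) (fob F Y) \<and>
        lin_on (scl D) (scl D') (hom D X Y) (fmo F)) \<and>
     (\<forall>X\<in>obj D. \<forall>Y\<in>obj D. \<forall>Z\<in>obj D. \<forall>f\<in>hom D X Y. \<forall>g\<in>hom D Y Z.
        fmo F (g \<cdot>\<^bsub>D\<^esub> f) = fmo F g \<cdot>\<^bsub>D'\<^esub> fmo F f)"

definition equivalence_functor ::
  "('k, 'o, 'm::ab_group_add, 'z) tri_cat_scheme \<Rightarrow> ('k, 'p, 'n::ab_group_add, 'y) tri_cat_scheme \<Rightarrow>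
   ('o, 'm, 'p, 'n, 'x) cat_functor_scheme \<Rightarrow> bool" where
  "equivalence_functor D D' F \<longleftrightarrow>
     linear_functor D D' F \<and>
     (\<forall>X\<in>obj D. \<forall>Y\<in>obj D. bij_betw (fmo F) (hom D X Y) (hom D' (fob F X) (fob F Y))) \<and>
     (\<forall>Y\<in>obj D'. \<exists>X\<in>obj D. \<exists>f. iso_arrow D' (fob F X) Y f)"


section \<open>Triangulated categories and exact functors\<close>

text \<open>
  Following Verdier, the translation functor is an automorphism; \<open>shO D n X\<close> is \<open>X[n]\<close> and
  \<open>shM D n f\<close> is \<open>f[n]\<close>.
\<close>

locale triangulated_category = linear_category +
  assumes zero_ex: "\<exists>Z. zero_obj D Z"
    and biproduct_ex: "\<lbrakk>X \<in> obj D; Y \<in> obj D\<rbrakk> \<Longrightarrow> \<exists>S. biproduct D X Y S"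
    and shO_closed: "X \<in> obj D \<Longrightarrow> shO D n X \<in> obj D"
    and shO_0: "X \<in> obj D \<Longrightarrow> shO D 0 X = X"
    and shO_add: "X \<in> obj D \<Longrightarrow> shO D (m + n) X = shO D m (shO D n X)"
    and shM_closed:
      "\<lbrakk>X \<in> obj D; Y \<in> obj D; f \<in> hom D X Y\<rbrakk> \<Longrightarrow> shM D n f \<in> hom D (shO D n X) (shO D n Y)"
    and shM_lin: "\<lbrakk>X \<in> obj D; Y \<in> obj D\<rbrakk> \<Longrightarrow> lin_on (scl D) (scl D) (hom D X Y) (shM D n)"
    and shM_0: "\<lbrakk>X \<in> obj D; Y \<in> obj D; f \<in> hom D X Y\<rbrakk> \<Longrightarrow> shM D 0 f = f"
    and shM_add:
      "\<lbrakk>X \<in> obj D; Y \<in> obj D; f \<in> hom D X Y\<rbrakk> \<Longrightarrow> shM D (m + n) f = shM D m (shM D n f)"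
    and shM_idn: "X \<in> obj D \<Longrightarrow> shM D n (idn D X) = idn D (shO D n X)"
    and shM_cmp:
      "\<lbrakk>X \<in> obj D; Y \<in> obj D; Z \<in> obj D; f \<in> hom D X Y; g \<in> hom D Y Z\<rbrakk>
        \<Longrightarrow> shM D n (g \<cdot> f) = shM D n g \<cdot> shM D n f"
    and tri_closed:
      "(X, Y, Z, f, g, h) \<in> tri D \<Longrightarrow>
         X \<in> obj D \<and> Y \<in> obj D \<and> Z \<in> obj D \<and>
         f \<in> hom D X Y \<and> g \<in> hom D Y Z \<and> h \<in> hom D Z (shO D 1 X)"
    and TR1_id: "\<lbrakk>X \<in> obj D; zero_obj D Z\<rbrakk> \<Longrightarrow> (X, X, Z, idn D X, 0, 0) \<in> tri D"
    and TR1_ex: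
      "\<lbrakk>X \<in> obj D; Y \<in> obj D; f \<in> hom D X Y\<rbrakk> \<Longrightarrow> \<exists>Z g h. (X, Y, Z, f, g, h) \<in> tri D"
    and TR1_iso:
      "\<lbrakk>(X, Y, Z, f, g, h) \<in> tri D;
        X' \<in> obj D; Y' \<in> obj D; Z' \<in> obj D;
        f' \<in> hom D X' Y'; g' \<in> hom D Y' Z'; h' \<in> hom D Z' (shO D 1 X');
        iso_arrow D X X' a; iso_arrow D Y Y' b; iso_arrow D Z Z' c;
        b \<cdot> f = f' \<cdot> a; c \<cdot> g = g' \<cdot> b; shM D 1 a \<cdot> h = h' \<cdot> c\<rbrakk>
        \<Longrightarrow> (X', Y', Z', f', g', h') \<in> tri D"
    and TR2:
      "\<lbrakk>X \<in> obj D; Y \<in> obj D; Z \<in> obj D;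
        f \<in> hom D X Y; g \<in> hom D Y Z; h \<in> hom D Z (shO D 1 X)\<rbrakk>
        \<Longrightarrow> (X, Y, Z, f, g, h) \<in> tri D \<longleftrightarrow> (Y, Z, shO D 1 X, g, h, - shM D 1 f) \<in> tri D"
    and TR3:
      "\<lbrakk>(X, Y, Z, f, g, h) \<in> tri D; (X', Y', Z', f', g', h') \<in> tri D;
        a \<in> hom D X X'; b \<in> hom D Y Y'; b \<cdot> f = f' \<cdot> a\<rbrakk>
        \<Longrightarrow> \<exists>c\<in>hom D Z Z'. c \<cdot> g = g' \<cdot> b \<and> shM D 1 a \<cdot> h = h' \<cdot> c"
    and TR4:
      "\<lbrakk>(X, Y, Z', f, i, i') \<in> tri D; (Y, Z, X', g, j, j') \<in> tri D; (X, Z, Y', g \<cdot> f, k, k') \<in> tri D\<rbrakk>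
        \<Longrightarrow> \<exists>u\<in>hom D Z' Y'. \<exists>v\<in>hom D Y' X'.
              (Z', Y', X', u, v, shM D 1 i \<cdot> j') \<in> tri D \<and>
              u \<cdot> i = k \<cdot> g \<and> k' \<cdot> u = i' \<and> v \<cdot> k = j \<and> j' \<cdot> v = shM D 1 f \<cdot> k'"

definition exact_functor ::
  "('k, 'o, 'm::ab_group_add, 'z) tri_cat_scheme \<Rightarrow> ('k, 'p, 'n::ab_group_add, 'y) tri_cat_scheme \<Rightarrow>
   ('o, 'm, 'p, 'n, 'x) cat_functor_scheme \<Rightarrow> bool" where
  "exact_functor D D' F \<longleftrightarrow>
     linear_functor D D' F \<and>
     (\<exists>\<xi>. (\<forall>X\<in>obj D. iso_arrow D' (fob F (shO D 1 X)) (shO D' 1 (fob F X)) (\<xi> X)) \<and>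
          (\<forall>X\<in>obj D. \<forall>Y\<in>obj D. \<forall>f\<in>hom D X Y.
             shM D' 1 (fmo F f) \<cdot>\<^bsub>D'\<^esub> \<xi> X = \<xi> Y \<cdot>\<^bsub>D'\<^esub> fmo F (shM D 1 f)) \<and>
          (\<forall>X Y Z f g h. (X, Y, Z, f, g, h) \<in> tri D \<longrightarrow>
             (fob F X, fob F Y, fob F Z, fmo F f, fmo F g, \<xi> X \<cdot>\<^bsub>D'\<^esub> fmo F h) \<in> tri D'))"

definition exact_autoequivalence ::
  "('k, 'o, 'm::ab_group_add, 'z) tri_cat_scheme \<Rightarrow> ('o, 'm, 'o, 'm, 'x) cat_functor_scheme \<Rightarrow> bool" where
  "exact_autoequivalence D F \<longleftrightarrow> exact_functor D D F \<and> equivalence_functor D D F"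

definition finite_type :: "('k::field, 'o, 'm::ab_group_add, 'z) tri_cat_scheme \<Rightarrow> bool" where
  "finite_type D \<longleftrightarrow>
     (\<forall>E\<in>obj D. \<forall>F\<in>obj D.
        (\<forall>n. fin_dim (scl D) (hom D E (shO D n F))) \<and> finite {n. hom D E (shO D n F) \<noteq> {0}})"

definition right_orthogonal :: "('k, 'o, 'm::zero, 'z) tri_cat_scheme \<Rightarrow> 'o \<Rightarrow> 'o set" where
  "right_orthogonal D E = {F \<in> obj D. \<forall>n. hom D E (shO D n F) = {0}}"

definition thick_subcategory :: "('k, 'o, 'm::ab_group_add, 'z) tri_cat_scheme \<Rightarrow> 'o set \<Rightarrow> bool" where
  "thick_subcategory D S \<longleftrightarrow>
     S \<subseteq> obj D \<and> (\<exists>Z\<in>S. zero_obj D Z) \<and>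
     (\<forall>X\<in>S. \<forall>n. shO D n X \<in> S) \<and>
     (\<forall>X Y Z f g h. (X, Y, Z, f, g, h) \<in> tri D \<and> X \<in> S \<and> Y \<in> S \<longrightarrow> Z \<in> S) \<and>
     (\<forall>X\<in>obj D. \<forall>Y\<in>obj D. \<forall>Z\<in>S. biproduct D X Y Z \<longrightarrow> X \<in> S)"

definition split_generator :: "('k, 'o, 'm::ab_group_add, 'z) tri_cat_scheme \<Rightarrow> 'o \<Rightarrow> bool" where
  "split_generator D G \<longleftrightarrow>
     G \<in> obj D \<and> \<Inter> {S. thick_subcategory D S \<and> G \<in> S} = obj D"


section \<open>Differential graded enhancements\<close>

definition ksign :: "int \<Rightarrow> 'a::ab_group_add \<Rightarrow> 'a" where
  "ksign n x = (if even n then x else - x)"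

record ('k, 'o, 'm) dg_cat = "('k, 'o, 'm) cat_ops" +
  ghom :: "'o \<Rightarrow> 'o \<Rightarrow> int \<Rightarrow> 'm set"
  dif :: "'m \<Rightarrow> 'm"

locale dg_category =
  fixes A :: "('k::field, 'b, 'a::ab_group_add, 'z) dg_cat_scheme" (structure)
  assumes vs: "vector_space (scl A)"
    and ghom_subspace: "\<lbrakk>X \<in> obj A; Y \<in> obj A\<rbrakk> \<Longrightarrow> module.subspace (scl A) (ghom A X Y n)"
    and ghom_disjoint:
      "\<lbrakk>X \<in> obj A; Y \<in> obj A; X' \<in> obj A; Y' \<in> obj A;
        f \<in> ghom A X Y n; f \<in> ghom A X' Y' n'; f \<noteq> 0\<rbrakk> \<Longrightarrow> X = X' \<and> Y = Y' \<and> n = n'"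
    and cmp_closed:
      "\<lbrakk>X \<in> obj A; Y \<in> obj A; Z \<in> obj A; f \<in> ghom A X Y m; g \<in> ghom A Y Z n\<rbrakk>
        \<Longrightarrow> g \<cdot> f \<in> ghom A X Z (n + m)"
    and cmp_lin_left:
      "\<lbrakk>X \<in> obj A; Y \<in> obj A; Z \<in> obj A; f \<in> ghom A X Y m\<rbrakk>
        \<Longrightarrow> lin_on (scl A) (scl A) (ghom A Y Z n) (\<lambda>g. g \<cdot> f)"
    and cmp_lin_right:
      "\<lbrakk>X \<in> obj A; Y \<in> obj A; Z \<in> obj A; g \<in> ghom A Y Z n\<rbrakk>
        \<Longrightarrow> lin_on (scl A) (scl A) (ghom A X Y m) (\<lambda>f. g \<cdot> f)"
    and cmp_assoc:
      "\<lbrakk>W \<in> obj A; X \<in> obj A; Y \<in> obj A; Z \<in> obj A;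
        f \<in> ghom A W X l; g \<in> ghom A X Y m; h \<in> ghom A Y Z n\<rbrakk>
        \<Longrightarrow> (h \<cdot> g) \<cdot> f = h \<cdot> (g \<cdot> f)"
    and idn_closed: "X \<in> obj A \<Longrightarrow> idn A X \<in> ghom A X X 0"
    and idn_left: "\<lbrakk>X \<in> obj A; Y \<in> obj A; f \<in> ghom A X Y n\<rbrakk> \<Longrightarrow> idn A Y \<cdot> f = f"
    and idn_right: "\<lbrakk>X \<in> obj A; Y \<in> obj A; f \<in> ghom A X Y n\<rbrakk> \<Longrightarrow> f \<cdot> idn A X = f"
    and dif_closed: "\<lbrakk>X \<in> obj A; Y \<in> obj A; f \<in> ghom A X Y n\<rbrakk> \<Longrightarrow> dif A f \<in> ghom A X Y (n + 1)"
    and dif_lin: "\<lbrakk>X \<in> obj A; Y \<in> obj A\<rbrakk> \<Longrightarrow> lin_on (scl A) (scl A) (ghom A X Y n) (dif A)"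
    and dif_dif: "\<lbrakk>X \<in> obj A; Y \<in> obj A; f \<in> ghom A X Y n\<rbrakk> \<Longrightarrow> dif A (dif A f) = 0"
    and Leibniz:
      "\<lbrakk>X \<in> obj A; Y \<in> obj A; Z \<in> obj A; f \<in> ghom A X Y m; g \<in> ghom A Y Z n\<rbrakk>
        \<Longrightarrow> dif A (g \<cdot> f) = dif A g \<cdot> f + ksign n (g \<cdot> dif A f)"

definition cocycles :: "('k, 'b, 'a::zero, 'z) dg_cat_scheme \<Rightarrow> 'b \<Rightarrow> 'b \<Rightarrow> int \<Rightarrow> 'a set" where
  "cocycles A X Y n = {f \<in> ghom A X Y n. dif A f = 0}"

definition coboundaries :: "('k, 'b, 'a, 'z) dg_cat_scheme \<Rightarrow> 'b \<Rightarrow> 'b \<Rightarrow> int \<Rightarrow> 'a set" where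
  "coboundaries A X Y n = dif A ` ghom A X Y (n - 1)"

text \<open>A cocycle of degree \<open>n\<close> invertible up to homotopy, which exhibits \<open>Y\<close> as \<open>X[-n]\<close>.\<close>

definition hinvertible ::
  "('k, 'b, 'a::ab_group_add, 'z) dg_cat_scheme \<Rightarrow> 'b \<Rightarrow> 'b \<Rightarrow> int \<Rightarrow> 'a \<Rightarrow> bool" where
  "hinvertible A X Y n s \<longleftrightarrow>
     s \<in> cocycles A X Y n \<and>
     (\<exists>r\<in>cocycles A Y X (- n).
        r \<cdot>\<^bsub>A\<^esub> s - idn A X \<in> coboundaries A X X 0 \<and> s \<cdot>\<^bsub>A\<^esub> r - idn A Y \<in> coboundaries A Y Y 0)"

text \<open>The chain map \<open>f\<close> between the complexes \<open>(X, dX)\<close> and \<open>(Y, dY)\<close> is a quasi-isomorphism.\<close>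

definition quasi_iso ::
  "(int \<Rightarrow> 'x set) \<Rightarrow> (int \<Rightarrow> 'x \<Rightarrow> 'x) \<Rightarrow> (int \<Rightarrow> 'y set) \<Rightarrow> (int \<Rightarrow> 'y \<Rightarrow> 'y) \<Rightarrow>
   (int \<Rightarrow> 'x::ab_group_add \<Rightarrow> 'y::ab_group_add) \<Rightarrow> bool" where
  "quasi_iso X dX Y dY f \<longleftrightarrow>
     (\<forall>n. \<forall>y\<in>Y n. dY n y = 0 \<longrightarrow>
        (\<exists>x\<in>X n. dX n x = 0 \<and> (\<exists>z\<in>Y (n - 1). y - f n x = dY (n - 1) z))) \<and>
     (\<forall>n. \<forall>x\<in>X n. dX n x = 0 \<and> (\<exists>z\<in>Y (n - 1). f n x = dY (n - 1) z) \<longrightarrow>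
        (\<exists>w\<in>X (n - 1). x = dX (n - 1) w))"

text \<open>
  \<open>C\<close> is a cone of the closed degree \<open>0\<close> arrow \<open>f : X \<rightarrow> Y\<close>, with structure maps
  \<open>i : Y \<rightarrow> C\<close> of degree \<open>0\<close> and \<open>j : X \<rightarrow> C\<close> of degree \<open>-1\<close>: via \<open>(x, y) \<mapsto> j x + i y\<close> it
  quasi-represents the right dg module \<open>Cone(A(-,X) \<rightarrow> A(-,Y))\<close>.
\<close>

definition dg_cone ::
  "('k, 'b, 'a::ab_group_add, 'z) dg_cat_scheme \<Rightarrow> 'b \<Rightarrow> 'b \<Rightarrow> 'a \<Rightarrow> 'b \<Rightarrow> 'a \<Rightarrow> 'a \<Rightarrow> bool" where
  "dg_cone A X Y f C i j \<longleftrightarrow>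
     C \<in> obj A \<and> i \<in> cocycles A Y C 0 \<and> j \<in> ghom A X C (- 1) \<and> dif A j = i \<cdot>\<^bsub>A\<^esub> f \<and>
     (\<forall>Z\<in>obj A.
        quasi_iso
          (\<lambda>n. ghom A Z X (n + 1) \<times> ghom A Z Y n) (\<lambda>n (x, y). (- dif A x, f \<cdot>\<^bsub>A\<^esub> x + dif A y))
          (ghom A Z C) (\<lambda>n. dif A)
          (\<lambda>n (x, y). j \<cdot>\<^bsub>A\<^esub> x + i \<cdot>\<^bsub>A\<^esub> y))"

definition pretriangulated :: "('k, 'b, 'a::ab_group_add, 'z) dg_cat_scheme \<Rightarrow> bool" where
  "pretriangulated A \<longleftrightarrow>
     (\<forall>X\<in>obj A. \<forall>n. \<exists>Y\<in>obj A. \<exists>s. hinvertible A X Y n s) \<and>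
     (\<forall>X\<in>obj A. \<forall>Y\<in>obj A. \<forall>f\<in>cocycles A X Y 0. \<exists>C i j. dg_cone A X Y f C i j)"

text \<open>
  An enhancement consists of a dg category \<open>enh_cat\<close>, a choice of shifts \<open>enh_shift X\<close> together with
  the canonical degree \<open>-1\<close> arrows \<open>enh_susp X : X \<rightarrow> enh_shift X\<close>, a functor
  (\<open>enh_ob\<close>, \<open>enh_mo\<close>) to the triangulated category, and the isomorphisms \<open>enh_xi\<close> making that
  functor commute with shifts.
  A functor on \<open>H\<^sup>0\<close> is given by its values on closed arrows of degree \<open>0\<close>; it is well-defined and
  faithful on \<open>H\<^sup>0\<close> iff exactly the coboundaries are sent to \<open>0\<close>.
\<close>

record ('k, 'o, 'm, 'b, 'a) enhancement =
  enh_cat :: "('k, 'b, 'a) dg_cat"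
  enh_shift :: "'b \<Rightarrow> 'b"
  enh_susp :: "'b \<Rightarrow> 'a"
  enh_ob :: "'b \<Rightarrow> 'o"
  enh_mo :: "'a \<Rightarrow> 'm"
  enh_xi :: "'b \<Rightarrow> 'm"

definition H0_equivalence ::
  "('k, 'o, 'm::ab_group_add, 'z) tri_cat_scheme \<Rightarrow> ('k, 'b, 'a::ab_group_add) dg_cat \<Rightarrow>
   ('b \<Rightarrow> 'o) \<Rightarrow> ('a \<Rightarrow> 'm) \<Rightarrow> bool" where
  "H0_equivalence D A P p \<longleftrightarrow>
     (\<forall>X\<in>obj A. P X \<in> obj D \<and> p (idn A X) = idn D (P X)) \<and>
     (\<forall>X\<in>obj A. \<forall>Y\<in>obj A.
        lin_on (scl A) (scl D) (cocycles A X Y 0) p \<and>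
        p ` cocycles A X Y 0 = hom D (P X) (P Y) \<and>
        (\<forall>f\<in>cocycles A X Y 0. p f = 0 \<longleftrightarrow> f \<in> coboundaries A X Y 0)) \<and>
     (\<forall>X\<in>obj A. \<forall>Y\<in>obj A. \<forall>Z\<in>obj A. \<forall>f\<in>cocycles A X Y 0. \<forall>g\<in>cocycles A Y Z 0.
        p (g \<cdot>\<^bsub>A\<^esub> f) = p g \<cdot>\<^bsub>D\<^esub> p f) \<and>
     (\<forall>Y\<in>obj D. \<exists>X\<in>obj A. \<exists>f. iso_arrow D (P X) Y f)"

text \<open>
  In the last clause \<open>w : C \<rightarrow> X[1]\<close> is, up to homotopy, the projection from the cone:
  it is characterised by \<open>w i \<sim> 0\<close> and \<open>w j \<sim> enh_susp X\<close>, compatibly with \<open>d j = i f\<close>.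
  Every distinguished triangle of \<open>H\<^sup>0\<close> is isomorphic to such an \<open>X \<rightarrow> Y \<rightarrow> C \<rightarrow> X[1]\<close>.
\<close>

definition dg_enhancement ::
  "('k::field, 'o, 'm::ab_group_add, 'z) tri_cat_scheme \<Rightarrow>
   ('k, 'o, 'm, 'b, 'a::ab_group_add) enhancement \<Rightarrow> bool" where
  "dg_enhancement D \<E> \<longleftrightarrow>
     (let A = enh_cat \<E>; S = enh_shift \<E>; \<sigma> = enh_susp \<E>; P = enh_ob \<E>; p = enh_mo \<E>; \<xi> = enh_xi \<E> in
     dg_category A \<and> pretriangulated A \<and> H0_equivalence D A P p \<and>
     (\<forall>X\<in>obj A. S X \<in> obj A \<and> hinvertible A X (S X) (- 1) (\<sigma> X)) \<and>
     (\<forall>X\<in>obj A. iso_arrow D (P (S X)) (shO D 1 (P X)) (\<xi> X)) \<and>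
     (\<forall>X\<in>obj A. \<forall>Y\<in>obj A. \<forall>f\<in>cocycles A X Y 0. \<forall>f'\<in>cocycles A (S X) (S Y) 0.
        f' \<cdot>\<^bsub>A\<^esub> \<sigma> X - \<sigma> Y \<cdot>\<^bsub>A\<^esub> f \<in> coboundaries A X (S Y) (- 1) \<longrightarrow>
        shM D 1 (p f) \<cdot>\<^bsub>D\<^esub> \<xi> X = \<xi> Y \<cdot>\<^bsub>D\<^esub> p f') \<and>
     (\<forall>X\<in>obj A. \<forall>Y\<in>obj A. \<forall>f\<in>cocycles A X Y 0. \<forall>C i j.
        dg_cone A X Y f C i j \<longrightarrow>
        (\<forall>w\<in>cocycles A C (S X) 0. \<forall>e\<in>ghom A Y (S X) (- 1).
           w \<cdot>\<^bsub>A\<^esub> i = dif A e \<and>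
           w \<cdot>\<^bsub>A\<^esub> j - e \<cdot>\<^bsub>A\<^esub> f - \<sigma> X \<in> coboundaries A X (S X) (- 1) \<longrightarrow>
           (P X, P Y, P C, p f, p i, \<xi> X \<cdot>\<^bsub>D\<^esub> p w) \<in> tri D)))"


section \<open>\<open>P\<^sup>d\<close>-objects\<close>

text \<open>
  The degree \<open>n\<close> part of \<open>K[h]/(h\<^bsup>d+1\<^esup>)\<close>, \<open>deg h = 2\<close>, each residue class being represented by
  its remainder modulo \<open>h\<^bsup>d+1\<^esup>\<close>.
\<close>

definition trunc_poly :: "nat \<Rightarrow> int \<Rightarrow> 'k::field poly set" where
  "trunc_poly d n = {p. degree p \<le> d \<and> (\<forall>j. coeff p j \<noteq> 0 \<longrightarrow> 2 * int j = n)}"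

text \<open>
  \<open>\<phi> n\<close> is the degree \<open>n\<close> component of an isomorphism of graded algebras from
  \<open>K[h]/(h\<^bsup>d+1\<^esup>)\<close> to \<open>Hom\<^sup>*(E,E)\<close>.
\<close>

definition P_algebra_iso ::
  "('k::field, 'o, 'm::ab_group_add, 'z) tri_cat_scheme \<Rightarrow> nat \<Rightarrow> 'o \<Rightarrow> (int \<Rightarrow> 'k poly \<Rightarrow> 'm) \<Rightarrow> bool" where
  "P_algebra_iso D d E \<phi> \<longleftrightarrow>
     (\<forall>n. bij_betw (\<phi> n) (trunc_poly d n) (hom D E (shO D n E)) \<and>
          lin_on smult (scl D) (trunc_poly d n) (\<phi> n)) \<and>
     \<phi> 0 1 = idn D E \<and>
     (\<forall>m n. \<forall>p\<in>trunc_poly d m. \<forall>q\<in>trunc_poly d n.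
        \<phi> (m + n) (p * q mod monom 1 (Suc d)) = shM D n (\<phi> m p) \<cdot>\<^bsub>D\<^esub> \<phi> n q)"

text \<open>
  A functorial isomorphism \<open>Hom\<^sup>*(E,-) \<cong> Hom\<^sup>*(-,E[2d])\<^sup>\<or>\<close> of functors to graded vector spaces; the
  degree \<open>i\<close> part of the graded dual of \<open>Hom\<^sup>*(F,E[2d])\<close> is the dual of \<open>Hom(F,E[2d][-i])\<close>.
\<close>

definition P_duality ::
  "('k::field, 'o, 'm::ab_group_add, 'z) tri_cat_scheme \<Rightarrow> nat \<Rightarrow> 'o \<Rightarrow>
   ('o \<Rightarrow> int \<Rightarrow> 'm \<Rightarrow> 'm \<Rightarrow> 'k) \<Rightarrow> bool" where
  "P_duality D d E \<eta> \<longleftrightarrow>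
     (\<forall>F\<in>obj D. \<forall>i.
        bij_betw (\<eta> F i) (hom D E (shO D i F))
          (dual_space (scl D) (hom D F (shO D (- i) (shO D (2 * int d) E)))) \<and>
        (\<forall>g\<in>hom D F (shO D (- i) (shO D (2 * int d) E)).
           lin_on (scl D) (*) (hom D E (shO D i F)) (\<lambda>f. \<eta> F i f g))) \<and>
     (\<forall>F\<in>obj D. \<forall>F'\<in>obj D. \<forall>a\<in>hom D F F'. \<forall>i.
        \<forall>f\<in>hom D E (shO D i F). \<forall>g\<in>hom D F' (shO D (- i) (shO D (2 * int d) E)).
          \<eta> F' i (shM D i a \<cdot>\<^bsub>D\<^esub> f) g = \<eta> F i f (g \<cdot>\<^bsub>D\<^esub> a))"

definition P_object :: "('k::field, 'o, 'm::ab_group_add, 'z) tri_cat_scheme \<Rightarrow> nat \<Rightarrow> 'o \<Rightarrow> bool" where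
  "P_object D d E \<longleftrightarrow>
     d > 0 \<and> E \<in> obj D \<and> (\<exists>\<phi>. P_algebra_iso D d E \<phi>) \<and> (\<exists>\<eta>. P_duality D d E \<eta>)"

definition P_generator :: "('k::field, 'o, 'm::ab_group_add, 'z) tri_cat_scheme \<Rightarrow> nat \<Rightarrow> 'o \<Rightarrow> 'm \<Rightarrow> bool" where
  "P_generator D d E h \<longleftrightarrow> (\<exists>\<phi>. P_algebra_iso D d E \<phi> \<and> h = \<phi> 2 (monom 1 1))"


section \<open>\<open>P\<close>-twists\<close>

text \<open>
  \<open>B\<close> is the object \<open>V \<otimes> X = \<Oplus>\<^sub>i V\<^sub>i \<otimes> X[-i]\<close> for a graded vector space \<open>V = \<Oplus>\<^sub>i V\<^sub>i[-i]\<close>,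
  where \<open>\<theta> i v : X[-i] \<rightarrow> B\<close> is the inclusion of \<open>v \<otimes> X[-i]\<close>.
\<close>

definition graded_tensor ::
  "('k, 'o, 'm::ab_group_add, 'z) tri_cat_scheme \<Rightarrow> (int \<Rightarrow> 'm set) \<Rightarrow> 'o \<Rightarrow> 'o \<Rightarrow> (int \<Rightarrow> 'm \<Rightarrow> 'm) \<Rightarrow> bool" where
  "graded_tensor D V X B \<theta> \<longleftrightarrow>
     B \<in> obj D \<and>
     (\<forall>i. \<theta> i ` V i \<subseteq> hom D (shO D (- i) X) B \<and> lin_on (scl D) (scl D) (V i) (\<theta> i)) \<and>
     (\<forall>Y\<in>obj D. \<forall>\<chi>.
        (\<forall>i. \<chi> i ` V i \<subseteq> hom D (shO D (- i) X) Y \<and> lin_on (scl D) (scl D) (V i) (\<chi> i)) \<longrightarrow>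
        (\<exists>!b. b \<in> hom D B Y \<and> (\<forall>i. \<forall>v\<in>V i. b \<cdot>\<^bsub>D\<^esub> \<theta> i v = \<chi> i v)))"

text \<open>
  \<open>T \<cong> Cone(Cone(Hom\<^sup>*(E,F) \<otimes> E[-2] \<rightarrow> Hom\<^sup>*(E,F) \<otimes> E) \<rightarrow> F)\<close>.  Here \<open>B'\<close> and \<open>B\<close> are the two
  tensor products, \<open>\<mu> = h\<^sup>* \<otimes> id - id \<otimes> h\<close>, \<open>C\<close> is the inner cone, and \<open>ev : C \<rightarrow> F\<close> restricts on
  \<open>B\<close> to the evaluation, that is to \<open>v[-i] : E[-i] \<rightarrow> F\<close> on \<open>v \<otimes> E[-i]\<close>, \<open>v : E \<rightarrow> F[i]\<close>.
\<close>

definition P_twist_value ::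
  "('k, 'o, 'm::ab_group_add, 'z) tri_cat_scheme \<Rightarrow> 'o \<Rightarrow> 'm \<Rightarrow> 'o \<Rightarrow> 'o \<Rightarrow> bool" where
  "P_twist_value D E h F T \<longleftrightarrow>
     (\<exists>B' B \<theta>' \<theta> \<mu> C a b ev e e'.
        graded_tensor D (\<lambda>i. hom D E (shO D i F)) (shO D (- 2) E) B' \<theta>' \<and>
        graded_tensor D (\<lambda>i. hom D E (shO D i F)) E B \<theta> \<and>
        \<mu> \<in> hom D B' B \<and>
        (\<forall>i. \<forall>v\<in>hom D E (shO D i F).
           \<mu> \<cdot>\<^bsub>D\<^esub> \<theta>' i v = \<theta> (i + 2) (shM D 2 v \<cdot>\<^bsub>D\<^esub> h) - \<theta> i v \<cdot>\<^bsub>D\<^esub> shM D (- i - 2) h) \<and>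
        (B', B, C, \<mu>, a, b) \<in> tri D \<and>
        ev \<in> hom D C F \<and>
        (\<forall>i. \<forall>v\<in>hom D E (shO D i F). ev \<cdot>\<^bsub>D\<^esub> (a \<cdot>\<^bsub>D\<^esub> \<theta> i v) = shM D (- i) v) \<and>
        (C, F, T, ev, e, e') \<in> tri D)"

text \<open>
  The functor underlying the twist.  Let \<open>E\<close>, \<open>F\<close>, \<open>Y\<close> be objects of the dg category \<open>A\<close> and let \<open>h\<close>
  be a closed endomorphism of \<open>E\<close> of degree \<open>2\<close>.
  As \<open>A(V \<otimes> E, Y) = Hom\<^sub>K(V, A(E,Y))\<close>, the double cone
  \<open>A(E,F) \<otimes> E[-2] \<rightarrow> A(E,F) \<otimes> E \<rightarrow> F\<close> corepresents the total complex \<open>tw_cpx\<close> of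
  \<open>A(F,Y) \<rightarrow> Hom\<^sub>K(A(E,F), A(E,Y)) \<rightarrow> Hom\<^sub>K(A(E,F), A(E,Y))[2]\<close>,
  whose maps are \<open>g \<mapsto> (u \<mapsto> g u)\<close> and \<open>x \<mapsto> (u \<mapsto> x (u h) - (x u) h)\<close>; these compose to \<open>0\<close>.
  Elements of \<open>Hom\<^sub>K(A(E,F), A(E,Y))\<close> are functions extended by \<open>0\<close> (\<open>ext0\<close>) to non-homogeneous
  arguments.
\<close>

definition ext0 :: "('k, 'b, 'a::zero, 'z) dg_cat_scheme \<Rightarrow> 'b \<Rightarrow> 'b \<Rightarrow> ('a \<Rightarrow> 'a) \<Rightarrow> 'a \<Rightarrow> 'a" where
  "ext0 A E F x = (\<lambda>u. if u \<in> (\<Union>i. ghom A E F i) then x u else 0)"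

definition lin_cpx ::
  "('k, 'b, 'a::ab_group_add, 'z) dg_cat_scheme \<Rightarrow> 'b \<Rightarrow> 'b \<Rightarrow> 'b \<Rightarrow> int \<Rightarrow> ('a \<Rightarrow> 'a) set" where
  "lin_cpx A E F Y n =
     {x. ext0 A E F x = x \<and>
         (\<forall>i. x ` ghom A E F i \<subseteq> ghom A E Y (i + n) \<and> lin_on (scl A) (scl A) (ghom A E F i) x)}"

definition lin_dif ::
  "('k, 'b, 'a::ab_group_add, 'z) dg_cat_scheme \<Rightarrow> 'b \<Rightarrow> 'b \<Rightarrow> int \<Rightarrow> ('a \<Rightarrow> 'a) \<Rightarrow> 'a \<Rightarrow> 'a" where
  "lin_dif A E F n x = ext0 A E F (\<lambda>u. dif A (x u) - ksign n (x (dif A u)))"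

definition tw_cpx ::
  "('k, 'b, 'a::ab_group_add, 'z) dg_cat_scheme \<Rightarrow> 'b \<Rightarrow> 'b \<Rightarrow> 'b \<Rightarrow> int \<Rightarrow> ('a \<times> ('a \<Rightarrow> 'a) \<times> ('a \<Rightarrow> 'a)) set" where
  "tw_cpx A E F Y n = ghom A F Y n \<times> lin_cpx A E F Y (n - 1) \<times> lin_cpx A E F Y n"

definition tw_dif ::
  "('k, 'b, 'a::ab_group_add, 'z) dg_cat_scheme \<Rightarrow> 'b \<Rightarrow> 'a \<Rightarrow> 'b \<Rightarrow> int \<Rightarrow>
   'a \<times> ('a \<Rightarrow> 'a) \<times> ('a \<Rightarrow> 'a) \<Rightarrow> 'a \<times> ('a \<Rightarrow> 'a) \<times> ('a \<Rightarrow> 'a)" where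
  "tw_dif A E h F n = (\<lambda>(g, x, y).
     (dif A g,
      ext0 A E F (\<lambda>u. g \<cdot>\<^bsub>A\<^esub> u) - lin_dif A E F (n - 1) x,
      ext0 A E F (\<lambda>u. x (u \<cdot>\<^bsub>A\<^esub> h) - x u \<cdot>\<^bsub>A\<^esub> h) + lin_dif A E F n y))"

text \<open>
  The action of an arrow \<open>c : Y \<rightarrow> Y'\<close> of degree \<open>m\<close>, with the Koszul sign on the component shifted
  by \<open>-1\<close>, and the pull-back along a closed arrow \<open>a : F \<rightarrow> F'\<close> of degree \<open>0\<close>.
\<close>

definition tw_act ::
  "('k, 'b, 'a::ab_group_add, 'z) dg_cat_scheme \<Rightarrow> int \<Rightarrow> 'a \<Rightarrow>
   'a \<times> ('a \<Rightarrow> 'a) \<times> ('a \<Rightarrow> 'a) \<Rightarrow> 'a \<times> ('a \<Rightarrow> 'a) \<times> ('a \<Rightarrow> 'a)" where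
  "tw_act A m c = (\<lambda>(g, x, y). (c \<cdot>\<^bsub>A\<^esub> g, \<lambda>u. ksign m (c \<cdot>\<^bsub>A\<^esub> x u), \<lambda>u. c \<cdot>\<^bsub>A\<^esub> y u))"

definition tw_pull ::
  "('k, 'b, 'a::ab_group_add, 'z) dg_cat_scheme \<Rightarrow> 'b \<Rightarrow> 'b \<Rightarrow> 'a \<Rightarrow>
   'a \<times> ('a \<Rightarrow> 'a) \<times> ('a \<Rightarrow> 'a) \<Rightarrow> 'a \<times> ('a \<Rightarrow> 'a) \<times> ('a \<Rightarrow> 'a)" where
  "tw_pull A E F a = (\<lambda>(g, x, y).
     (g \<cdot>\<^bsub>A\<^esub> a, ext0 A E F (\<lambda>u. x (a \<cdot>\<^bsub>A\<^esub> u)), ext0 A E F (\<lambda>u. y (a \<cdot>\<^bsub>A\<^esub> u))))"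

definition tw_corepresents ::
  "('k, 'b, 'a::ab_group_add, 'z) dg_cat_scheme \<Rightarrow> 'b \<Rightarrow> 'a \<Rightarrow> 'b \<Rightarrow> 'b \<Rightarrow>
   'a \<times> ('a \<Rightarrow> 'a) \<times> ('a \<Rightarrow> 'a) \<Rightarrow> bool" where
  "tw_corepresents A E h F T \<tau> \<longleftrightarrow>
     T \<in> obj A \<and> \<tau> \<in> tw_cpx A E F T 0 \<and> tw_dif A E h F 0 \<tau> = 0 \<and>
     (\<forall>Y\<in>obj A.
        quasi_iso (ghom A T Y) (\<lambda>n. dif A) (tw_cpx A E F Y) (tw_dif A E h F) (\<lambda>n c. tw_act A n c \<tau>))"

text \<open>
  \<open>T\<close> lifts to the dg level: with \<open>E' \<in> A\<close> corresponding to \<open>E\<close> via \<open>\<epsilon>\<close> and a closed arrow \<open>h'\<close> of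
  degree \<open>2\<close> corresponding to \<open>h : E \<rightarrow> E[2]\<close>, the functor \<open>T\<close> is identified by \<open>\<rho>\<close> with the functor
  on \<open>H\<^sup>0\<close> sending \<open>F\<close> to the object \<open>TF\<close> corepresenting \<open>tw_cpx\<close> and a closed arrow \<open>a : F \<rightarrow> F'\<close> to
  the unique class of \<open>b : TF \<rightarrow> TF'\<close> compatible with the universal elements.
\<close>

definition P_twist_dg_lift ::
  "('k::field, 'o, 'm::ab_group_add, 'z) tri_cat_scheme \<Rightarrow>
   ('k, 'o, 'm, 'b, 'a::ab_group_add) enhancement \<Rightarrow> 'o \<Rightarrow> 'm \<Rightarrow> ('o, 'm, 'o, 'm, 'x) cat_functor_scheme \<Rightarrow> bool" where
  "P_twist_dg_lift D \<E> E h T \<longleftrightarrow>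
     (let A = enh_cat \<E>; S = enh_shift \<E>; \<sigma> = enh_susp \<E>; P = enh_ob \<E>; p = enh_mo \<E>; \<xi> = enh_xi \<E> in
     \<exists>E'\<in>obj A. \<exists>\<epsilon>. \<exists>h'\<in>cocycles A E' E' 2. \<exists>tw \<tau> \<rho>.
        iso_arrow D (P E') E \<epsilon> \<and>
        h \<cdot>\<^bsub>D\<^esub> \<epsilon> =
          shM D 2 \<epsilon> \<cdot>\<^bsub>D\<^esub> shM D 1 (\<xi> E') \<cdot>\<^bsub>D\<^esub> \<xi> (S E') \<cdot>\<^bsub>D\<^esub> p (\<sigma> (S E') \<cdot>\<^bsub>A\<^esub> \<sigma> E' \<cdot>\<^bsub>A\<^esub> h') \<and>
        (\<forall>F\<in>obj A. tw_corepresents A E' h' F (tw F) (\<tau> F) \<and>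
           iso_arrow D (P (tw F)) (fob T (P F)) (\<rho> F)) \<and>
        (\<forall>F\<in>obj A. \<forall>F'\<in>obj A. \<forall>a\<in>cocycles A F F' 0. \<forall>b\<in>cocycles A (tw F) (tw F') 0.
           (\<exists>z\<in>tw_cpx A E' F (tw F') (- 1).
              tw_act A 0 b (\<tau> F) - tw_pull A E' F a (\<tau> F') = tw_dif A E' h' F (- 1) z) \<longrightarrow>
           fmo T (p a) \<cdot>\<^bsub>D\<^esub> \<rho> F = \<rho> F' \<cdot>\<^bsub>D\<^esub> p b))"

definition P_twist ::
  "('k::field, 'o, 'm::ab_group_add, 'z) tri_cat_scheme \<Rightarrow>
   ('k, 'o, 'm, 'b, 'a::ab_group_add) enhancement \<Rightarrow> nat \<Rightarrow> 'o \<Rightarrow> ('o, 'm, 'o, 'm, 'x) cat_functor_scheme \<Rightarrow> bool" where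
  "P_twist D \<E> d E T \<longleftrightarrow>
     exact_autoequivalence D T \<and>
     (\<exists>h. P_generator D d E h \<and>
          (\<forall>F\<in>obj D. P_twist_value D E h F (fob T F)) \<and>
          P_twist_dg_lift D \<E> E h T)"


section \<open>Categorical complexity and entropy\<close>

definition complexity ::
  "('k, 'o, 'm::ab_group_add, 'z) tri_cat_scheme \<Rightarrow> real \<Rightarrow> 'o \<Rightarrow> 'o \<Rightarrow> ereal" where
  "complexity D t E F =
     (if zero_obj D F then 0
      else INF ns\<in>{ns :: int list. \<exists>F' As. F' \<in> obj D \<and> zero_obj D (As 0) \<and>
               (\<forall>i<length ns. \<exists>f g h. (As i, As (Suc i), shO D (ns ! i) E, f, g, h) \<in> tri D) \<and>
               biproduct D F F' (As (length ns))}.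
             ereal (\<Sum>n\<leftarrow>ns. exp (of_int n * t)))"

definition ext_ln :: "ereal \<Rightarrow> ereal" where
  "ext_ln x = (if x \<le> 0 then - \<infinity> else if x = \<infinity> then \<infinity> else ereal (ln (real_of_ereal x)))"

definition entropy ::
  "('k, 'o, 'm::ab_group_add, 'z) tri_cat_scheme \<Rightarrow> real \<Rightarrow> ('o, 'm, 'o, 'm, 'x) cat_functor_scheme \<Rightarrow> ereal" where
  "entropy D t \<Phi> =
     (THE l. \<forall>G. split_generator D G \<longrightarrow>
        (\<lambda>n. ext_ln (complexity D t G ((fob \<Phi> ^^ n) G)) / ereal (real n)) \<longlonglongrightarrow> l)"

end

theory Submission
  imports Defs
begin

text \<open>
  The value of the twist at \<open>E\<close> can be computed: \<open>h\<^sup>* - h\<close> on \<open>Hom\<^sup>*(E,E) \<otimes> E\<close> contracts onto its kernel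
  and cokernel, so \<open>T E \<cong> E[-2d]\<close>, the cone of the evaluation being unambiguous because
  \<open>Hom\<^sup>*(E,E)\<close> vanishes in odd degrees.  On \<open>E\<^sup>\<bottom>\<close> the twist is the identity on objects.
  Hence \<open>\<delta>\<^sub>t(G, T\<^sup>n E) = e\<^bsup>-2dnt\<^esup> \<delta>\<^sub>t(G, E)\<close>, and comparison with
  \<open>\<delta>\<^sub>t(G, T\<^sup>n F) \<le> \<delta>\<^sub>t(G, T\<^sup>n G) \<delta>\<^sub>t(G, F)\<close> for \<open>F = E\<close> and for \<open>F \<in> E\<^sup>\<bottom>\<close> gives the lower bounds.
  For the upper bound, \<open>T G\<close> is an extension of \<open>C[1]\<close> by \<open>G\<close> with \<open>C\<close> built from finitely many
  shifts of \<open>E\<close>, whence \<open>\<delta>\<^sub>t(G, T\<^bsup>n+1\<^esup> G) \<le> \<delta>\<^sub>t(G, T\<^sup>n G) + K e\<^bsup>-2dnt\<^esup>\<close>.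
  The limit defining the entropy exists by
  Fekete's lemma; its logarithms are finite because, \<open>D\<close> being of finite type, every sequence
  of shifts building a nonzero object from a generator meets a fixed finite set of integers.
\<close>


section \<open>Arrows, retracts and triangles\<close>

text \<open>Complexity allows \<open>F\<close> to be only a direct summand of an iterated extension,
  while TR3 provides fill-ins without uniqueness. So summands are handled as retracts, and the key
  fact is that an extension of retracts is a retract of an extension: two non-canonical fill-ins
  compose to an automorphism of the middle term. This makes complexity subadditive on triangles and
  submultiplicative under composition. The exponent \<open>- 2d\<close> is
  \<open>2 - 2(d + 1)\<close>: the kernel of the inner map is \<open>E[-2d-2]\<close>, and each of
  the two cones shifts it by one. The bound \<open>- 2dtn\<close> on the logarithms serves twice: it
  is the lower estimate, and it keeps the infimum in Fekete's lemma finite. For the upper estimate,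
  summing \<open>n\<close> increments \<open>K e^(-2dtk)\<close> costs at most a factor linear in
  \<open>n\<close> besides \<open>e^(n max(0, -2dt))\<close>. That factor disappears in the limit,
  which explains the two cases in the sign of \<open>t\<close>.\<close>

context linear_category
begin

sublocale vs: vector_space "scl D" by (rule vs)

text \<open>The zero vector lies in every hom-space, so an arrow does not determine its ends. The
  predicate carries them, so that typing facts can be chained as rules.\<close>

definition arr :: "'o \<Rightarrow> 'o \<Rightarrow> 'm \<Rightarrow> bool" where
  "arr X Y f \<longleftrightarrow> X \<in> obj D \<and> Y \<in> obj D \<and> f \<in> hom D X Y"

lemma arrI: "\<lbrakk>X \<in> obj D; Y \<in> obj D; f \<in> hom D X Y\<rbrakk> \<Longrightarrow> arr X Y f"
  by (simp add: arr_def)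

lemma arr_dom: "arr X Y f \<Longrightarrow> X \<in> obj D"
  and arr_cod: "arr X Y f \<Longrightarrow> Y \<in> obj D"
  and arr_hom: "arr X Y f \<Longrightarrow> f \<in> hom D X Y"
  by (simp_all add: arr_def)

lemma arr_idn: "X \<in> obj D \<Longrightarrow> arr X X (idn D X)"
  by (simp add: arr_def idn_closed)

lemma arr_cmp: "\<lbrakk>arr Y Z g; arr X Y f\<rbrakk> \<Longrightarrow> arr X Z (g \<cdot> f)"
  unfolding arr_def using cmp_closed by blast

lemma arr_zero: "\<lbrakk>X \<in> obj D; Y \<in> obj D\<rbrakk> \<Longrightarrow> arr X Y 0"
  by (simp add: arr_def hom_subspace vs.subspace_0)

lemma arr_add: "\<lbrakk>arr X Y f; arr X Y g\<rbrakk> \<Longrightarrow> arr X Y (f + g)"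
  by (simp add: arr_def hom_subspace vs.subspace_add)

lemma arr_diff: "\<lbrakk>arr X Y f; arr X Y g\<rbrakk> \<Longrightarrow> arr X Y (f - g)"
  by (simp add: arr_def hom_subspace vs.subspace_diff)

lemma arr_uminus: "arr X Y f \<Longrightarrow> arr X Y (- f)"
  by (simp add: arr_def hom_subspace vs.subspace_neg)

lemma arr_scl: "arr X Y f \<Longrightarrow> arr X Y (scl D c f)"
  by (simp add: arr_def hom_subspace vs.subspace_scale)

lemma arr_sum:
  "\<lbrakk>X \<in> obj D; Y \<in> obj D; \<And>k. k \<in> I \<Longrightarrow> arr X Y (f k)\<rbrakk> \<Longrightarrow> arr X Y (\<Sum>k\<in>I. f k)"
  by (simp add: arr_def hom_subspace vs.subspace_sum)

lemma assoc: "\<lbrakk>arr Y Z h; arr X Y g; arr W X f\<rbrakk> \<Longrightarrow> (h \<cdot> g) \<cdot> f = h \<cdot> (g \<cdot> f)"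
  unfolding arr_def using cmp_assoc by blast

lemma cmp_id_left: "arr X Y f \<Longrightarrow> idn D Y \<cdot> f = f"
  unfolding arr_def using idn_left by blast

lemma cmp_id_right: "arr X Y f \<Longrightarrow> f \<cdot> idn D X = f"
  unfolding arr_def using idn_right by blast

lemma add_cmp: "\<lbrakk>arr Y Z g; arr Y Z g'; arr X Y f\<rbrakk> \<Longrightarrow> (g + g') \<cdot> f = g \<cdot> f + g' \<cdot> f"
  unfolding arr_def using cmp_lin_left by (auto simp: lin_on_def)

lemma cmp_add: "\<lbrakk>arr Y Z g; arr X Y f; arr X Y f'\<rbrakk> \<Longrightarrow> g \<cdot> (f + f') = g \<cdot> f + g \<cdot> f'"
  unfolding arr_def using cmp_lin_right by (auto simp: lin_on_def)

lemma scl_cmp: "\<lbrakk>arr Y Z g; arr X Y f\<rbrakk> \<Longrightarrow> scl D c g \<cdot> f = scl D c (g \<cdot> f)"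
  unfolding arr_def using cmp_lin_left by (auto simp: lin_on_def)

lemma cmp_scl: "\<lbrakk>arr Y Z g; arr X Y f\<rbrakk> \<Longrightarrow> g \<cdot> scl D c f = scl D c (g \<cdot> f)"
  unfolding arr_def using cmp_lin_right by (auto simp: lin_on_def)

lemma zero_cmp: "\<lbrakk>arr X Y f; Z \<in> obj D\<rbrakk> \<Longrightarrow> 0 \<cdot> f = 0"
  using scl_cmp[of Y Z 0 X f 0] arr_zero[of Y Z] by (simp add: arr_def)

lemma cmp_zero: "\<lbrakk>arr Y Z g; X \<in> obj D\<rbrakk> \<Longrightarrow> g \<cdot> 0 = 0"
  using cmp_scl[of Y Z g X 0 0] arr_zero[of X Y] by (simp add: arr_def)

lemma uminus_cmp: "\<lbrakk>arr Y Z g; arr X Y f\<rbrakk> \<Longrightarrow> (- g) \<cdot> f = - (g \<cdot> f)"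
  using scl_cmp[of Y Z g X f "- 1"] by simp

lemma cmp_uminus: "\<lbrakk>arr Y Z g; arr X Y f\<rbrakk> \<Longrightarrow> g \<cdot> (- f) = - (g \<cdot> f)"
  using cmp_scl[of Y Z g X f "- 1"] by simp

lemma diff_cmp: "\<lbrakk>arr Y Z g; arr Y Z g'; arr X Y f\<rbrakk> \<Longrightarrow> (g - g') \<cdot> f = g \<cdot> f - g' \<cdot> f"
  using add_cmp[of Y Z g "- g'" X f] by (simp add: arr_uminus uminus_cmp)

lemma cmp_diff: "\<lbrakk>arr Y Z g; arr X Y f; arr X Y f'\<rbrakk> \<Longrightarrow> g \<cdot> (f - f') = g \<cdot> f - g \<cdot> f'"
  using cmp_add[of Y Z g X f "- f'"] by (simp add: arr_uminus cmp_uminus)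

lemma sum_cmp:
  assumes "arr X Y f" "Z \<in> obj D" "\<And>k. k \<in> I \<Longrightarrow> arr Y Z (g k)"
  shows "(\<Sum>k\<in>I. g k) \<cdot> f = (\<Sum>k\<in>I. g k \<cdot> f)"
  using assms(3)
proof (induction I rule: infinite_finite_induct)
  case (insert k I)
  then show ?case
    using assms add_cmp[of Y Z "g k" "\<Sum>k\<in>I. g k" X f] arr_sum[of Y Z I g] arr_cod[OF assms(1)]
    by auto
qed (use assms zero_cmp in auto)

lemma cmp_sum:
  assumes "arr Y Z g" "X \<in> obj D" "\<And>k. k \<in> I \<Longrightarrow> arr X Y (f k)"
  shows "g \<cdot> (\<Sum>k\<in>I. f k) = (\<Sum>k\<in>I. g \<cdot> f k)"
  using assms(3)
proof (induction I rule: infinite_finite_induct)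
  case (insert k I)
  then show ?case
    using assms cmp_add[of Y Z g X "f k" "\<Sum>k\<in>I. f k"] arr_sum[of X Y I f] arr_dom[OF assms(1)]
    by auto
qed (use assms cmp_zero in auto)

definition iso :: "'o \<Rightarrow> 'o \<Rightarrow> bool" where
  "iso X Y \<longleftrightarrow> X \<in> obj D \<and> Y \<in> obj D \<and> (\<exists>f. iso_arrow D X Y f)"

lemma iso_iff: "iso X Y \<longleftrightarrow> (\<exists>f g. arr X Y f \<and> arr Y X g \<and> g \<cdot> f = idn D X \<and> f \<cdot> g = idn D Y)"
  unfolding iso_def iso_arrow_def arr_def by blast

lemma iso_refl: "X \<in> obj D \<Longrightarrow> iso X X"
  unfolding iso_iff using arr_idn cmp_id_left by blast

lemma iso_sym: "iso X Y \<Longrightarrow> iso Y X"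
  unfolding iso_iff by blast

text \<open>Direct summand without a named complement, which makes composition easy;
  \<open>retract_biproduct\<close> recovers the complement in a triangulated category.\<close>

definition retract :: "'o \<Rightarrow> 'o \<Rightarrow> bool" where
  "retract X S \<longleftrightarrow> (\<exists>i p. arr X S i \<and> arr S X p \<and> p \<cdot> i = idn D X)"

lemma cancel_mid:
  assumes "arr X Y f" "arr Y Z g" "arr Z Y h" "arr Y W k" "h \<cdot> g = idn D Y"
  shows "(k \<cdot> h) \<cdot> (g \<cdot> f) = k \<cdot> f"
proof -
  have "(k \<cdot> h) \<cdot> (g \<cdot> f) = k \<cdot> (h \<cdot> (g \<cdot> f))"
    using assms assoc arr_cmp by blast
  also have "h \<cdot> (g \<cdot> f) = (h \<cdot> g) \<cdot> f"
    using assms assoc by metis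
  finally show ?thesis using assms cmp_id_left by simp
qed

lemma iso_trans [trans]: assumes "iso X Y" "iso Y Z" shows "iso X Z"
proof -
  obtain f f' where f: "arr X Y f" "arr Y X f'" "f' \<cdot> f = idn D X" "f \<cdot> f' = idn D Y"
    using assms(1) iso_iff by blast
  obtain g g' where g: "arr Y Z g" "arr Z Y g'" "g' \<cdot> g = idn D Y" "g \<cdot> g' = idn D Z"
    using assms(2) iso_iff by blast
  have "(f' \<cdot> g') \<cdot> (g \<cdot> f) = idn D X"
    using cancel_mid[OF f(1) g(1,2) f(2) g(3)] f(3) by simp
  moreover have "(g \<cdot> f) \<cdot> (f' \<cdot> g') = idn D Z"
    using cancel_mid[OF g(2) f(2,1) g(1) f(4)] g(4) by simp
  ultimately show ?thesis
    unfolding iso_iff using arr_cmp[OF g(1) f(1)] arr_cmp[OF f(2) g(2)] by blast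
qed

lemma retract_trans: assumes "retract X Y" "retract Y Z" shows "retract X Z"
proof -
  obtain f f' where f: "arr X Y f" "arr Y X f'" "f' \<cdot> f = idn D X"
    using assms(1) retract_def by blast
  obtain g g' where g: "arr Y Z g" "arr Z Y g'" "g' \<cdot> g = idn D Y"
    using assms(2) retract_def by blast
  have "(f' \<cdot> g') \<cdot> (g \<cdot> f) = idn D X"
    using cancel_mid[OF f(1) g(1,2) f(2) g(3)] f(3) by simp
  then show ?thesis
    unfolding retract_def using arr_cmp[OF g(1) f(1)] arr_cmp[OF f(2) g(2)] by blast
qed

lemma iso_retract: "iso X Y \<Longrightarrow> retract X Y"
  unfolding iso_iff retract_def by blast

lemma retract_refl: "X \<in> obj D \<Longrightarrow> retract X X"
  by (simp add: iso_refl iso_retract)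

lemma retract_obj: "retract X Y \<Longrightarrow> X \<in> obj D" "retract X Y \<Longrightarrow> Y \<in> obj D"
  unfolding retract_def using arr_dom arr_cod by blast+

lemma biproduct_retract: "\<lbrakk>X \<in> obj D; biproduct D X Y S\<rbrakk> \<Longrightarrow> retract X S"
  unfolding biproduct_def retract_def arr_def by blast

lemma zero_objD: assumes "zero_obj D Z"
  shows "Z \<in> obj D" "arr X Z f \<Longrightarrow> f = 0" "arr Z X f \<Longrightarrow> f = 0"
  using assms unfolding zero_obj_def arr_def by auto

lemma zero_obj_iff: assumes "Z \<in> obj D" shows "zero_obj D Z \<longleftrightarrow> idn D Z = 0"
proof
  assume "zero_obj D Z"
  then show "idn D Z = 0" using zero_objD(2) arr_idn assms by blast
next
  assume 0: "idn D Z = 0"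
  have "f = 0" if "arr X Z f" for X f
    using cmp_id_left[OF that] zero_cmp[OF that assms] 0 by simp
  moreover have "f = 0" if "arr Z X f" for X f
    using cmp_id_right[OF that] cmp_zero[OF that assms] 0 by simp
  ultimately show "zero_obj D Z"
    unfolding zero_obj_def using assms arr_zero arr_def by fastforce
qed

lemma zero_obj_retract: assumes "retract X Z" "zero_obj D Z" shows "zero_obj D X"
proof -
  obtain i p where ip: "arr X Z i" "arr Z X p" "p \<cdot> i = idn D X"
    using assms(1) retract_def by blast
  have "i = 0" using zero_objD(2)[OF assms(2) ip(1)] .
  then have "idn D X = 0" using ip cmp_zero arr_cod by metis
  then show ?thesis using zero_obj_iff ip arr_dom by blast
qed

lemma zero_obj_iso: "\<lbrakk>iso X Z; zero_obj D Z\<rbrakk> \<Longrightarrow> zero_obj D X"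
  by (rule zero_obj_retract[OF iso_retract])

end

section \<open>Consequences of the axioms of a triangulated category\<close>

context triangulated_category
begin

lemma triD:
  assumes "(X, Y, Z, f, g, h) \<in> tri D"
  shows "arr X Y f" "arr Y Z g" "arr Z (shO D 1 X) h"
  using tri_closed[OF assms] shO_closed by (auto simp: arr_def)

lemma arr_shM: "arr X Y f \<Longrightarrow> arr (shO D n X) (shO D n Y) (shM D n f)"
  by (simp add: arr_def shO_closed shM_closed)

lemma shO_shO: "X \<in> obj D \<Longrightarrow> shO D m (shO D n X) = shO D (m + n) X"
  by (simp add: shO_add)

lemma shO_inv: "X \<in> obj D \<Longrightarrow> shO D n (shO D (- n) X) = X"
  "X \<in> obj D \<Longrightarrow> shO D (- n) (shO D n X) = X"
  by (simp_all add: shO_shO shO_0)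

lemma shM_shM: "arr X Y f \<Longrightarrow> shM D m (shM D n f) = shM D (m + n) f"
  unfolding arr_def using shM_add by metis

lemma shM_zero_shift: "arr X Y f \<Longrightarrow> shM D 0 f = f"
  unfolding arr_def using shM_0 by metis

lemma shM_inv: "arr X Y f \<Longrightarrow> shM D n (shM D (- n) f) = f"
  "arr X Y f \<Longrightarrow> shM D (- n) (shM D n f) = f"
  by (simp_all add: shM_shM shM_zero_shift)

lemma shM_compose: "\<lbrakk>arr Y Z g; arr X Y f\<rbrakk> \<Longrightarrow> shM D n (g \<cdot> f) = shM D n g \<cdot> shM D n f"
  unfolding arr_def using shM_cmp by blast

lemma shM_plus: "\<lbrakk>arr X Y f; arr X Y g\<rbrakk> \<Longrightarrow> shM D n (f + g) = shM D n f + shM D n g"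
  using shM_lin unfolding arr_def lin_on_def by blast

lemma shM_scl: "arr X Y f \<Longrightarrow> shM D n (scl D c f) = scl D c (shM D n f)"
  using shM_lin unfolding arr_def lin_on_def by blast

lemma shM_uminus: "arr X Y f \<Longrightarrow> shM D n (- f) = - shM D n f"
  using shM_scl[of X Y f n "- 1"] by simp

lemma shM_zero: "\<lbrakk>X \<in> obj D; Y \<in> obj D\<rbrakk> \<Longrightarrow> shM D n 0 = 0"
  using shM_scl[OF arr_zero, of X Y n 0] by simp

lemma shM_diff: "\<lbrakk>arr X Y f; arr X Y g\<rbrakk> \<Longrightarrow> shM D n (f - g) = shM D n f - shM D n g"
  using shM_plus[of X Y f "- g" n] by (simp add: arr_uminus shM_uminus)

lemma zero_obj_shO: assumes "zero_obj D Z" shows "zero_obj D (shO D n Z)"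
proof -
  have Z: "Z \<in> obj D" using assms zero_objD by blast
  have "idn D (shO D n Z) = shM D n (idn D Z)" using Z shM_idn by simp
  also have "\<dots> = 0" using assms zero_obj_iff Z shM_zero by simp
  finally show ?thesis using zero_obj_iff Z shO_closed by blast
qed

lemma retract_shO: assumes "retract X Y" shows "retract (shO D n X) (shO D n Y)"
proof -
  obtain i p where ip: "arr X Y i" "arr Y X p" "p \<cdot> i = idn D X"
    using assms retract_def by blast
  have "shM D n p \<cdot> shM D n i = idn D (shO D n X)"
    using shM_compose[OF ip(2,1), of n] ip shM_idn arr_dom by metis
  then show ?thesis unfolding retract_def using arr_shM ip by blast
qed

lemma iso_shO: assumes "iso X Y" shows "iso (shO D n X) (shO D n Y)"
proof -
  obtain f g where fg: "arr X Y f" "arr Y X g" "g \<cdot> f = idn D X" "f \<cdot> g = idn D Y"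
    using assms iso_iff by blast
  have "shM D n g \<cdot> shM D n f = idn D (shO D n X)"
    using shM_compose[OF fg(2,1), of n] fg shM_idn arr_dom by metis
  moreover have "shM D n f \<cdot> shM D n g = idn D (shO D n Y)"
    using shM_compose[OF fg(1,2), of n] fg shM_idn arr_dom by metis
  ultimately show ?thesis unfolding iso_iff using arr_shM fg by blast
qed

lemma rotate:
  assumes "(X, Y, Z, f, g, h) \<in> tri D"
  shows "(Y, Z, shO D 1 X, g, h, - shM D 1 f) \<in> tri D"
  using TR2 tri_closed[OF assms] assms by blast

text \<open>TR2 read from right to left. The sign in front of \<open>h[-1]\<close> cancels the one
  that TR2 puts on the shifted map.\<close>

lemma rotate_back:
  assumes "(X, Y, Z, f, g, h) \<in> tri D"
  shows "(shO D (- 1) Z, X, Y, - shM D (- 1) h, f, g) \<in> tri D"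
proof -
  note t = triD[OF assms]
  note Z = arr_cod[OF t(2)] and X = arr_dom[OF t(1)]
  have h: "arr (shO D (- 1) Z) X (shM D (- 1) h)"
    using arr_shM[OF t(3), of "- 1"] X shO_inv by metis
  have "shM D 1 (- shM D (- 1) h) = - h"
    using shM_uminus[OF h] shM_inv(1)[OF t(3)] by simp
  moreover have "shO D 1 (shO D (- 1) Z) = Z" using Z shO_inv by metis
  moreover have "(X, Y, Z, f, g, h) \<in> tri D \<longleftrightarrow> (X, Y, Z, f, g, - (- h)) \<in> tri D" by simp
  ultimately show ?thesis
    using assms TR2[of "shO D (- 1) Z" X Y "- shM D (- 1) h" f g] h t arr_uminus[OF h]
    by (simp add: arr_def)
qed

lemma tri_zero_right:
  assumes "X \<in> obj D" "zero_obj D Z" shows "(X, X, Z, idn D X, 0, 0) \<in> tri D"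
  using assms TR1_id by blast

lemma tri_zero_left:
  assumes "X \<in> obj D" "zero_obj D Z" shows "(Z, X, X, 0, idn D X, 0) \<in> tri D"
proof -
  have Z: "Z \<in> obj D" using assms zero_objD by blast
  have "(shO D (- 1) (shO D 1 Z), X, X, - shM D (- 1) 0, idn D X, 0) \<in> tri D"
    using rotate_back[OF tri_zero_right[OF assms(1) zero_obj_shO[OF assms(2)]]] .
  then show ?thesis using shO_inv(2)[OF Z, of 1] shM_zero[OF assms(1) assms(1)] by simp
qed

lemma tri_zero_mid:
  assumes "X \<in> obj D" "zero_obj D Z"
  shows "(X, Z, shO D 1 X, 0, 0, - idn D (shO D 1 X)) \<in> tri D"
  using rotate[OF tri_zero_right[OF assms]] shM_idn[OF assms(1)] by simp

text \<open>The identity and \<open>f\<close> form a map from the triangle \<open>X, X, 0\<close>.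
  Its third component starts at a zero object, and \<open>g \<cdot> f\<close> factors through
  it.\<close>

lemma tri_cmp_zero:
  assumes "(X, Y, Z, f, g, h) \<in> tri D" shows "g \<cdot> f = 0"
proof -
  obtain O' where O: "zero_obj D O'" using zero_ex by blast
  note t = triD[OF assms]
  have X: "X \<in> obj D" using arr_dom t by blast
  obtain c where c: "c \<in> hom D O' Z" "c \<cdot> 0 = g \<cdot> f"
    using TR3[OF tri_zero_right[OF X O] assms arr_hom[OF arr_idn[OF X]] arr_hom[OF t(1)]]
    by auto
  have "arr O' Z c" using c O zero_objD(1) t arr_cod arrI by metis
  then show ?thesis using c cmp_zero X by simp
qed

text \<open>The factorisation is the third component of a map to the triangle \<open>0, W, W\<close>
  whose second component is \<open>u\<close>.\<close>

lemma exact_contra: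
  assumes "(X, Y, Z, f, g, h) \<in> tri D" "arr Y W u" "u \<cdot> f = 0"
  shows "\<exists>v. arr Z W v \<and> v \<cdot> g = u"
proof -
  obtain O' where O: "zero_obj D O'" using zero_ex by blast
  note t = triD[OF assms(1)]
  have X: "X \<in> obj D" and W: "W \<in> obj D" using arr_dom arr_cod t assms by blast+
  have O'': "O' \<in> obj D" using O zero_objD by blast
  have "u \<cdot> f = 0 \<cdot> 0" using assms(3) cmp_zero[OF arr_zero[OF O'' W] X] by simp
  then obtain c where c: "c \<in> hom D Z W" "c \<cdot> g = idn D W \<cdot> u"
    using TR3[OF assms(1) tri_zero_left[OF W O] arr_hom[OF arr_zero[OF X O'']] arr_hom[OF assms(2)]]
    by auto
  then show ?thesis using W t arr_cod arrI cmp_id_left[OF assms(2)] by metis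
qed

text \<open>TR3 only produces third components, so \<open>W, 0, W[1]\<close> is mapped to the
  rotated triangle. This gives an arrow \<open>W[1] \<rightarrow> X[1]\<close>, which is shifted
  back; the two rotation signs cancel.\<close>

lemma exact_cov:
  assumes "(X, Y, Z, f, g, h) \<in> tri D" "arr W Y u" "g \<cdot> u = 0"
  shows "\<exists>v. arr W X v \<and> f \<cdot> v = u"
proof -
  obtain O' where O: "zero_obj D O'" using zero_ex by blast
  note t = triD[OF assms(1)]
  have X: "X \<in> obj D" and W: "W \<in> obj D" and Z: "Z \<in> obj D"
    using arr_dom arr_cod t assms by blast+
  have O'': "O' \<in> obj D" using O zero_objD by blast
  have "0 \<cdot> 0 = g \<cdot> u" using assms(3) cmp_zero[OF arr_zero[OF O'' Z] W] by simp
  then obtain c where c: "c \<in> hom D (shO D 1 W) (shO D 1 X)"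
      "shM D 1 u \<cdot> (- idn D (shO D 1 W)) = (- shM D 1 f) \<cdot> c"
    using TR3[OF tri_zero_mid[OF W O] rotate[OF assms(1)] arr_hom[OF assms(2)]
        arr_hom[OF arr_zero[OF O'' Z]]] by auto
  have c': "arr (shO D 1 W) (shO D 1 X) c" using c X W shO_closed arrI by blast
  note su = arr_shM[OF assms(2), of 1] and sf = arr_shM[OF t(1), of 1]
  have "shM D 1 u = shM D 1 f \<cdot> c"
    using c(2) cmp_uminus[OF su arr_idn[OF arr_dom[OF su]]] cmp_id_right[OF su]
      uminus_cmp[OF sf c'] by simp
  then have "u = shM D (- 1) (shM D 1 f \<cdot> c)" using shM_inv(2)[OF assms(2), of 1] by simp
  also have "\<dots> = f \<cdot> shM D (- 1) c"
    using shM_compose[OF sf c'] shM_inv(2)[OF t(1), of 1] by simp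
  finally show ?thesis
    using arr_shM[OF c', of "- 1"] shO_inv(2)[OF W, of 1] shO_inv(2)[OF X, of 1] by auto
qed

text \<open>After rotating both triangles back, \<open>c[-1]\<close> and \<open>a\<close> are the
  first two components of a map of triangles, and TR3 supplies the third.\<close>

lemma TR3_mid:
  assumes t: "(X, Y, Z, f, g, h) \<in> tri D" and t': "(X', Y', Z', f', g', h') \<in> tri D"
    and a: "arr X X' a" and c: "arr Z Z' c" and eq: "h' \<cdot> c = shM D 1 a \<cdot> h"
  shows "\<exists>b. arr Y Y' b \<and> b \<cdot> f = f' \<cdot> a \<and> g' \<cdot> b = c \<cdot> g"
proof -
  note T = triD[OF t] and T' = triD[OF t']
  note X = arr_dom[OF T(1)] and X' = arr_dom[OF T'(1)]
  note sh = arr_shM[OF T(3), of "- 1", unfolded shO_inv(2)[OF X, of 1]]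
  note sh' = arr_shM[OF T'(3), of "- 1", unfolded shO_inv(2)[OF X', of 1]]
  note sc = arr_shM[OF c, of "- 1"]
  have "shM D (- 1) h' \<cdot> shM D (- 1) c = a \<cdot> shM D (- 1) h"
    using arg_cong[OF eq, of "shM D (- 1)"] shM_compose[OF T'(3) c, of "- 1"]
      shM_compose[OF arr_shM[OF a, of 1] T(3), of "- 1"] shM_inv(2)[OF a, of 1] by simp
  then have "a \<cdot> (- shM D (- 1) h) = (- shM D (- 1) h') \<cdot> shM D (- 1) c"
    using cmp_uminus[OF a sh] uminus_cmp[OF sh' sc] by simp
  then obtain b where "b \<in> hom D Y Y'" "b \<cdot> f = f' \<cdot> a" "shM D 1 (shM D (- 1) c) \<cdot> g = g' \<cdot> b"
    using TR3[OF rotate_back[OF t] rotate_back[OF t'] arr_hom[OF sc] arr_hom[OF a]] by blast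
  then show ?thesis using shM_inv(1)[OF c, of 1] arrI T T' arr_dom arr_cod by metis
qed

text \<open>\<open>u = 1 + n\<close>, where \<open>n\<close> factors both through \<open>g\<close> and through \<open>f\<close>, whence \<open>n\<^sup>2 = 0\<close>.\<close>

lemma tri_endo_iso:
  assumes t: "(X, Y, Z, f, g, h) \<in> tri D" and u: "arr Y Y u" "u \<cdot> f = f" "g \<cdot> u = g"
  shows "\<exists>v. arr Y Y v \<and> v \<cdot> u = idn D Y \<and> u \<cdot> v = idn D Y"
proof -
  note T = triD[OF t]
  note i = arr_idn[OF arr_cod[OF T(1)]]
  define n where "n = u - idn D Y"
  have n: "arr Y Y n" unfolding n_def using arr_diff[OF u(1) i] .
  have nf: "n \<cdot> f = 0"
    unfolding n_def using diff_cmp[OF u(1) i T(1)] u cmp_id_left[OF T(1)] by simp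
  have gn: "g \<cdot> n = 0"
    unfolding n_def using cmp_diff[OF T(2) u(1) i] u cmp_id_right[OF T(2)] by simp
  obtain m where m: "arr Z Y m" "m \<cdot> g = n" using exact_contra[OF t n nf] by blast
  have nn: "n \<cdot> n = 0"
    using assoc[OF m(1) T(2) n] m gn cmp_zero[OF m(1) arr_dom[OF n]] by simp
  have u': "u = idn D Y + n" by (simp add: n_def)
  define v where "v = idn D Y - n"
  have v: "arr Y Y v" unfolding v_def using arr_diff[OF i n] .
  have "v \<cdot> u = idn D Y"
    unfolding u' using cmp_add[OF v i n] cmp_id_right[OF v]
      diff_cmp[OF i n n] cmp_id_left[OF n] nn by (simp add: v_def)
  moreover have "u \<cdot> v = idn D Y"
    using cmp_diff[OF u(1) i n] cmp_id_right[OF u(1)] add_cmp[OF i n n] cmp_id_left[OF n] nn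
    by (simp add: v_def u')
  ultimately show ?thesis using v by blast
qed

definition triangle where
  "triangle X Y Z \<longleftrightarrow> (\<exists>f g h. (X, Y, Z, f, g, h) \<in> tri D)"

lemma triangle_obj: assumes "triangle X Y Z" shows "X \<in> obj D" "Y \<in> obj D" "Z \<in> obj D"
  using assms tri_closed unfolding triangle_def by blast+

lemma triangle_rotate: "triangle X Y Z \<Longrightarrow> triangle Y Z (shO D 1 X)"
  unfolding triangle_def using rotate by blast

lemma triangle_rotate_back: "triangle X Y Z \<Longrightarrow> triangle (shO D (- 1) Z) X Y"
  unfolding triangle_def using rotate_back by blast

lemma triangle_shO: assumes "triangle X Y Z" shows "triangle (shO D n X) (shO D n Y) (shO D n Z)"
proof (induction n rule: int_induct[where k = 0])
  case base
  then show ?case using assms triangle_obj[OF assms] shO_0 by simp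
next
  case (step1 i)
  from triangle_rotate[OF triangle_rotate[OF triangle_rotate[OF step1(2)]]]
  show ?case using triangle_obj[OF assms] by (simp add: shO_shO add.commute)
next
  case (step2 i)
  from triangle_rotate_back[OF triangle_rotate_back[OF triangle_rotate_back[OF step2(2)]]]
  show ?case using triangle_obj[OF assms] by (simp add: shO_shO)
qed

lemma iso_conj:
  assumes a: "arr X X' a" and b: "arr Y Y' b" "arr Y' Y b'" "b' \<cdot> b = idn D Y" and f: "arr X' X a'"
    "a' \<cdot> a = idn D X" and u: "arr X Y f"
  shows "(b \<cdot> f \<cdot> a') \<cdot> a = b \<cdot> f"
proof -
  have "(b \<cdot> f \<cdot> a') \<cdot> a = b \<cdot> ((f \<cdot> a') \<cdot> a)"
    using assoc[OF b(1) arr_cmp[OF u f(1)] a] by simp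
  also have "(f \<cdot> a') \<cdot> a = f" using assoc[OF u f(1) a] f(2) cmp_id_right[OF u] by simp
  finally show ?thesis .
qed

lemma triangle_iso: assumes "triangle X Y Z" "iso X X'" "iso Y Y'" "iso Z Z'" shows "triangle X' Y' Z'"
proof -
  obtain f g h where t: "(X, Y, Z, f, g, h) \<in> tri D" using assms(1) triangle_def by blast
  note T = triD[OF t]
  obtain a a' where a: "arr X X' a" "arr X' X a'" "a' \<cdot> a = idn D X" "a \<cdot> a' = idn D X'"
    using assms(2) iso_iff by blast
  obtain b b' where b: "arr Y Y' b" "arr Y' Y b'" "b' \<cdot> b = idn D Y" "b \<cdot> b' = idn D Y'"
    using assms(3) iso_iff by blast
  obtain c c' where c: "arr Z Z' c" "arr Z' Z c'" "c' \<cdot> c = idn D Z" "c \<cdot> c' = idn D Z'"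
    using assms(4) iso_iff by blast
  note sa = arr_shM[OF a(1), of 1]
  have "shM D 1 a' \<cdot> shM D 1 a = idn D (shO D 1 X)"
    using shM_compose[OF a(2,1), of 1] a shM_idn[OF arr_dom[OF a(1)]] by simp
  note sa' = arr_shM[OF a(2), of 1] this
  have ia: "iso_arrow D X X' a" "iso_arrow D Y Y' b" "iso_arrow D Z Z' c"
    using a b c unfolding iso_arrow_def arr_def by blast+
  note fn = arr_cmp[OF b(1) arr_cmp[OF T(1) a(2)]]
    and gn = arr_cmp[OF c(1) arr_cmp[OF T(2) b(2)]]
    and hn = arr_cmp[OF sa arr_cmp[OF T(3) c(2)]]
  have "(X', Y', Z', b \<cdot> f \<cdot> a', c \<cdot> g \<cdot> b', shM D 1 a \<cdot> h \<cdot> c') \<in> tri D"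
    using TR1_iso[OF t arr_dom[OF fn] arr_cod[OF fn] arr_cod[OF gn] arr_hom[OF fn] arr_hom[OF gn]
        arr_hom[OF hn] ia]
      iso_conj[OF a(1) b(1-3) a(2,3) T(1)] iso_conj[OF b(1) c(1-3) b(2,3) T(2)]
      iso_conj[OF c(1) sa sa' c(2,3) T(3)] by simp
  then show ?thesis using triangle_def by blast
qed

text \<open>Rebracketing of extensions: \<open>Y'\<close> is the fibre of
  \<open>Y \<rightarrow> Z \<rightarrow> Q\<close>, the analogue of the preimage of
  \<open>Z'\<close> in \<open>Y\<close>. It arises as \<open>V[-1]\<close>, where \<open>V\<close>
  is the cone of the composite to which TR4 is applied.\<close>

lemma octahedron:
  assumes "triangle X Y Z" "triangle Z' Z Q"
  shows "\<exists>Y'. triangle X Y' Z' \<and> triangle Y' Y Q"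
proof -
  obtain f g h where t: "(X, Y, Z, f, g, h) \<in> tri D" using assms(1) triangle_def by blast
  obtain i k l where s: "(Z', Z, Q, i, k, l) \<in> tri D" using assms(2) triangle_def by blast
  note kg = arr_cmp[OF triD(2)[OF s] triD(2)[OF t]]
  obtain V m n where v: "(Y, Q, V, k \<cdot> g, m, n) \<in> tri D"
    using TR1_ex kg unfolding arr_def by blast
  have "triangle (shO D 1 X) V (shO D 1 Z')"
    using TR4[OF rotate[OF t] rotate[OF s] v] triangle_def by blast
  then have "triangle (shO D (- 1) (shO D 1 X)) (shO D (- 1) V) (shO D (- 1) (shO D 1 Z'))"
    by (rule triangle_shO)
  then have "triangle X (shO D (- 1) V) Z'"
    using triangle_obj[OF assms(1)] triangle_obj[OF assms(2)] by (simp add: shO_inv(2)[of _ 1])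
  moreover have "triangle (shO D (- 1) V) Y Q" using triangle_rotate_back v triangle_def by blast
  ultimately show ?thesis by blast
qed

text \<open>\<open>b' \<cdot> b\<close> need not be the identity, only an automorphism; its inverse
  corrects \<open>b'\<close> to a retraction of \<open>b\<close>.\<close>

lemma tri_endo_mono:
  assumes t: "(X, Y, Z, f, g, h) \<in> tri D" and b: "arr Y W b" "arr W Y b'"
    and eq: "(b' \<cdot> b) \<cdot> f = f" "g \<cdot> (b' \<cdot> b) = g"
  shows "retract Y W"
proof -
  obtain v where v: "arr Y Y v" "v \<cdot> (b' \<cdot> b) = idn D Y"
    using tri_endo_iso[OF t arr_cmp[OF b(2,1)] eq] by blast
  then have "(v \<cdot> b') \<cdot> b = idn D Y" using assoc[OF v(1) b(2,1)] by simp
  then show ?thesis unfolding retract_def using b arr_cmp[OF v(1) b(2)] by blast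
qed

text \<open>Lets summands be postponed to the end: from retracts of the outer terms one obtains an
  extension of the larger objects that contains \<open>Y\<close> as a retract. Subadditivity of
  complexity rests on this.\<close>

lemma triangle_retract:
  assumes "triangle X Y Z" "retract X S" "retract Z S'"
  shows "\<exists>W. triangle S W S' \<and> retract Y W"
proof -
  obtain f g h where t: "(X, Y, Z, f, g, h) \<in> tri D" using assms(1) triangle_def by blast
  note T = triD[OF t]
  obtain i p where ip: "arr X S i" "arr S X p" "p \<cdot> i = idn D X"
    using assms(2) retract_def by blast
  obtain j q where jq: "arr Z S' j" "arr S' Z q" "q \<cdot> j = idn D Z"
    using assms(3) retract_def by blast
  note si = arr_shM[OF ip(1), of 1] and sp = arr_shM[OF ip(2), of 1]
  have spi: "shM D 1 p \<cdot> shM D 1 i = idn D (shO D 1 X)"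
    using shM_compose[OF ip(2,1), of 1] ip shM_idn[OF arr_dom[OF ip(1)]] by simp
  \<comment> \<open>The extension class of \<open>S'\<close> by \<open>S\<close> induced by that of
    the given triangle: project to \<open>Z\<close>, connect, include into \<open>S[1]\<close>. Then
    \<open>(i, j)\<close> and \<open>(p, q)\<close> are compatible with the connecting maps, and
    \<open>TR3_mid\<close> applies in both directions.\<close>
  define h' where "h' = shM D 1 i \<cdot> h \<cdot> q"
  have h': "arr S' (shO D 1 S) h'" unfolding h'_def using arr_cmp[OF si arr_cmp[OF T(3) jq(2)]] .
  obtain V m n where "(S', shO D 1 S, V, h', m, n) \<in> tri D"
    using TR1_ex h' unfolding arr_def by blast
  from rotate_back[OF rotate_back[OF this]]
  have "(shO D (- 1) (shO D 1 S), shO D (- 1) V, S', - shM D (- 1) m, - shM D (- 1) n, h') \<in> tri D" .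
  moreover have "shO D (- 1) (shO D 1 S) = S" using shO_inv(2)[OF arr_cod[OF ip(1)], of 1] by simp
  ultimately obtain W f' g' where w: "(S, W, S', f', g', h') \<in> tri D" by auto
  note W = triD[OF w]
  have "h' \<cdot> j = shM D 1 i \<cdot> h"
    unfolding h'_def using iso_conj[OF jq(1) si sp spi jq(2,3) T(3)] .
  then obtain b where b: "arr Y W b" "b \<cdot> f = f' \<cdot> i" "g' \<cdot> b = j \<cdot> g"
    using TR3_mid[OF t w ip(1) jq(1)] by auto
  have "shM D 1 p \<cdot> h' = (shM D 1 p \<cdot> shM D 1 i) \<cdot> (h \<cdot> q)"
    unfolding h'_def using assoc[OF sp si arr_cmp[OF T(3) jq(2)]] by simp
  also have "\<dots> = h \<cdot> q" using spi cmp_id_left[OF arr_cmp[OF T(3) jq(2)]] by simp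
  finally obtain b' where b': "arr W Y b'" "b' \<cdot> f' = f \<cdot> p" "g \<cdot> b' = q \<cdot> g'"
    using TR3_mid[OF w t ip(2) jq(2)] by auto
  have "(b' \<cdot> b) \<cdot> f = b' \<cdot> (f' \<cdot> i)" using assoc[OF b'(1) b(1) T(1)] b by simp
  also have "\<dots> = (f \<cdot> p) \<cdot> i" using assoc[OF b'(1) W(1) ip(1)] b' by simp
  also have "\<dots> = f" using assoc[OF T(1) ip(2,1)] ip(3) cmp_id_right[OF T(1)] by simp
  finally have 1: "(b' \<cdot> b) \<cdot> f = f" .
  have "g \<cdot> (b' \<cdot> b) = (q \<cdot> g') \<cdot> b" using assoc[OF T(2) b'(1) b(1)] b' by simp
  also have "\<dots> = q \<cdot> (j \<cdot> g)" using assoc[OF jq(2) W(2) b(1)] b by simp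
  also have "\<dots> = g" using assoc[OF jq(2,1) T(2)] jq(3) cmp_id_left[OF T(2)] by simp
  finally have "g \<cdot> (b' \<cdot> b) = g" .
  then show ?thesis using tri_endo_mono[OF t b(1) b'(1) 1] w triangle_def by blast
qed

text \<open>Fill-ins exist in both directions. Both composites fix the neighbouring maps, so by
  \<open>tri_endo_iso\<close>, used on the rotated triangles, they are automorphisms. Thus
  \<open>c\<close> has a left and a right inverse, which coincide.\<close>

lemma cone_unique:
  assumes t: "(X, Y, Z, f, g, h) \<in> tri D" and t': "(X, Y, Z', f, g', h') \<in> tri D"
  shows "iso Z Z'"
proof -
  have *: "\<exists>c v. arr Z Z' c \<and> arr Z' Z v \<and> v \<cdot> c = idn D Z \<and>
      (\<exists>u. arr Z' Z u \<and> arr Z' Z' (c \<cdot> u) \<and> (c \<cdot> u) \<cdot> g' = g' \<and> h' \<cdot> (c \<cdot> u) = h')"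
    if t: "(X, Y, Z, f, g, h) \<in> tri D" and t': "(X, Y, Z', f, g', h') \<in> tri D"
    for Z Z' g h g' h'
  proof -
    note T = triD[OF t] and T' = triD[OF t']
    note iX = arr_idn[OF arr_dom[OF T(1)]] and iY = arr_idn[OF arr_cod[OF T(1)]]
    have eq: "idn D Y \<cdot> f = f \<cdot> idn D X"
      using cmp_id_left[OF T(1)] cmp_id_right[OF T(1)] by simp
    have sX: "shM D 1 (idn D X) = idn D (shO D 1 X)" using shM_idn arr_dom[OF T(1)] by simp
    obtain c where c: "c \<in> hom D Z Z'" "c \<cdot> g = g'" "h' \<cdot> c = h"
      using TR3[OF t t' arr_hom[OF iX] arr_hom[OF iY] eq] cmp_id_right[OF T'(2)]
        cmp_id_left[OF T(3)] sX by auto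
    obtain u where u: "u \<in> hom D Z' Z" "u \<cdot> g' = g" "h \<cdot> u = h'"
      using TR3[OF t' t arr_hom[OF iX] arr_hom[OF iY] eq] cmp_id_right[OF T(2)]
        cmp_id_left[OF T'(3)] sX by auto
    have cu: "arr Z Z' c" "arr Z' Z u" using c u arrI arr_cod T T' by blast+
    have 1: "(u \<cdot> c) \<cdot> g = g" "h \<cdot> (u \<cdot> c) = h"
      using assoc[OF cu(2,1) T(2)] assoc[OF T(3) cu(2,1)] c u by simp_all
    have 2: "(c \<cdot> u) \<cdot> g' = g'" "h' \<cdot> (c \<cdot> u) = h'"
      using assoc[OF cu T'(2)] assoc[OF T'(3) cu] c u by simp_all
    obtain v where v: "arr Z Z v" "v \<cdot> (u \<cdot> c) = idn D Z"
      using tri_endo_iso[OF rotate[OF t] arr_cmp[OF cu(2,1)] 1] by blast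
    have "(v \<cdot> u) \<cdot> c = idn D Z" using assoc[OF v(1) cu(2,1)] v(2) by simp
    then show ?thesis using cu arr_cmp[OF v(1) cu(2)] arr_cmp[OF cu] 2 by blast
  qed
  obtain c v u where c: "arr Z Z' c" "arr Z' Z v" "v \<cdot> c = idn D Z" "arr Z' Z u"
      and cu: "arr Z' Z' (c \<cdot> u)" "(c \<cdot> u) \<cdot> g' = g'" "h' \<cdot> (c \<cdot> u) = h'"
    using *[OF t t'] by blast
  obtain w where w: "arr Z' Z' w" "(c \<cdot> u) \<cdot> w = idn D Z'"
    using tri_endo_iso[OF rotate[OF t'] cu] by blast
  have cuw: "c \<cdot> (u \<cdot> w) = idn D Z'" using w assoc[OF c(1,4) w(1)] by simp
  note uw = arr_cmp[OF c(4) w(1)]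
  have "v = (v \<cdot> c) \<cdot> (u \<cdot> w)"
    using assoc[OF c(2,1) uw] cuw cmp_id_right[OF c(2)] by simp
  also have "\<dots> = u \<cdot> w" using c(3) cmp_id_left[OF uw] by simp
  finally show ?thesis unfolding iso_iff using c cuw by blast
qed

text \<open>As \<open>i[1] \<cdot> h = 0\<close> and \<open>i[1]\<close> is a split monomorphism,
  the connecting map vanishes; hence \<open>q\<close> has a section. Once that section is corrected,
  \<open>e = 1 - i p - j q\<close> is killed by \<open>q\<close>, so it factors as
  \<open>i \<cdot> y\<close>, and \<open>p \<cdot> e = 0\<close> forces
  \<open>y = 0\<close>.\<close>

lemma split_mono_triangle:
  assumes i: "arr X S i" and p: "arr S X p" and pi: "p \<cdot> i = idn D X"
  shows "\<exists>Q q j. (X, S, Q, i, q, 0) \<in> tri D \<and> arr S Q q \<and> arr Q S j \<and> p \<cdot> j = 0 \<and>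
      q \<cdot> j = idn D Q \<and> q \<cdot> i = 0 \<and> i \<cdot> p + j \<cdot> q = idn D S"
proof -
  obtain Q q h where t: "(X, S, Q, i, q, h) \<in> tri D"
    using TR1_ex i unfolding arr_def by blast
  note T = triD[OF t]
  note si = arr_shM[OF i, of 1] and sp = arr_shM[OF p, of 1]
  have "(- shM D 1 i) \<cdot> h = 0" using tri_cmp_zero[OF rotate[OF rotate[OF t]]] .
  then have ih: "shM D 1 i \<cdot> h = 0" using uminus_cmp[OF si T(3)] by simp
  have "(shM D 1 p \<cdot> shM D 1 i) \<cdot> h = 0"
    using assoc[OF sp si T(3)] ih cmp_zero[OF sp arr_dom[OF T(3)]] by simp
  moreover have "shM D 1 p \<cdot> shM D 1 i = idn D (shO D 1 X)"
    using shM_compose[OF p i, of 1] pi shM_idn[OF arr_dom[OF i]] by simp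
  ultimately have h0: "h = 0" using cmp_id_left[OF T(3)] by simp
  note iQ = arr_idn[OF arr_cod[OF T(2)]] and iS = arr_idn[OF arr_cod[OF T(1)]]
  have "h \<cdot> idn D Q = 0" using h0 cmp_id_right[OF T(3)] by simp
  then obtain j0 where j0: "arr Q S j0" "q \<cdot> j0 = idn D Q"
    using exact_cov[OF rotate[OF t] iQ] by blast
  note pj0 = arr_cmp[OF p j0(1)]
  note ipj0 = arr_cmp[OF i pj0]
  have qi: "q \<cdot> i = 0" using tri_cmp_zero[OF t] .
  \<comment> \<open>Removing the component of \<open>j0\<close> along \<open>i\<close> gives
    \<open>p \<cdot> j = 0\<close>; it stays a section of \<open>q\<close> because
    \<open>q \<cdot> i = 0\<close>.\<close>
  define j where "j = j0 - i \<cdot> p \<cdot> j0"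
  have j: "arr Q S j" unfolding j_def using arr_diff[OF j0(1) ipj0] .
  have pj: "p \<cdot> j = 0"
    unfolding j_def using cmp_diff[OF p j0(1) ipj0] assoc[OF p i pj0] pi cmp_id_left[OF pj0] by simp
  have qj: "q \<cdot> j = idn D Q"
    unfolding j_def using cmp_diff[OF T(2) j0(1) ipj0] assoc[OF T(2) i pj0] qi j0(2)
      zero_cmp[OF pj0 arr_cod[OF T(2)]] by simp
  note ip = arr_cmp[OF i p] and jq = arr_cmp[OF j T(2)]
  define e where "e = idn D S - i \<cdot> p - j \<cdot> q"
  have e: "arr S S e" unfolding e_def using arr_diff[OF arr_diff[OF iS ip] jq] .
  have "q \<cdot> e = q - (q \<cdot> i) \<cdot> p - (q \<cdot> j) \<cdot> q"
    unfolding e_def using cmp_diff[OF T(2) arr_diff[OF iS ip] jq] cmp_diff[OF T(2) iS ip]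
      assoc[OF T(2) i p] assoc[OF T(2) j T(2)] cmp_id_right[OF T(2)] by simp
  also have "\<dots> = 0"
    using qi qj cmp_id_left[OF T(2)] zero_cmp[OF p arr_cod[OF T(2)]] by simp
  finally obtain y where y: "arr S X y" "i \<cdot> y = e" using exact_cov[OF t e] by blast
  have "p \<cdot> e = p - (p \<cdot> i) \<cdot> p - (p \<cdot> j) \<cdot> q"
    unfolding e_def using cmp_diff[OF p arr_diff[OF iS ip] jq] cmp_diff[OF p iS ip]
      assoc[OF p i p] assoc[OF p j T(2)] cmp_id_right[OF p] by simp
  also have "\<dots> = 0"
    using pi pj cmp_id_left[OF p] zero_cmp[OF T(2) arr_cod[OF p]] by simp
  finally have "p \<cdot> (i \<cdot> y) = 0" using y by simp
  then have "y = 0" using assoc[OF p i y(1)] pi cmp_id_left[OF y(1)] by simp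
  then have "e = 0" using y cmp_zero[OF i arr_dom[OF y(1)]] by simp
  then have "i \<cdot> p + j \<cdot> q = idn D S" unfolding e_def by (simp add: algebra_simps)
  then show ?thesis using t T(2) j pj qj qi h0 by blast
qed

lemma retract_biproduct:
  assumes "retract X S" shows "\<exists>Q\<in>obj D. biproduct D X Q S"
proof -
  obtain i p where ip: "arr X S i" "arr S X p" "p \<cdot> i = idn D X"
    using assms retract_def by blast
  obtain Q q j where "arr S Q q" "arr Q S j" "p \<cdot> j = 0" "q \<cdot> j = idn D Q" "q \<cdot> i = 0"
      "i \<cdot> p + j \<cdot> q = idn D S"
    using split_mono_triangle[OF ip] by blast
  then show ?thesis using ip unfolding biproduct_def arr_def by blast
qed

text \<open>The prescribed complement \<open>Y\<close> is identified with the cone \<open>Q\<close>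
  of \<open>i\<close> by \<open>c\<close> and \<open>q' \<cdot> j\<close>, and TR1 transports the
  split triangle along \<open>c\<close>.\<close>

lemma biproduct_triangle:
  assumes i: "arr X S i" and p: "arr S X p" and j: "arr Y S j" and q: "arr S Y q"
    and pi: "p \<cdot> i = idn D X" and qj: "q \<cdot> j = idn D Y" and qi: "q \<cdot> i = 0"
    and sum: "i \<cdot> p + j \<cdot> q = idn D S"
  shows "(X, S, Y, i, q, 0) \<in> tri D"
proof -
  obtain Q q' j' where t: "(X, S, Q, i, q', 0) \<in> tri D" and q': "arr S Q q'" and j': "arr Q S j'"
      and qj': "q' \<cdot> j' = idn D Q" and qi': "q' \<cdot> i = 0"
    using split_mono_triangle[OF i p pi] by blast
  obtain c where c: "arr Q Y c" "c \<cdot> q' = q" using exact_contra[OF t q qi] by blast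
  define u where "u = q' \<cdot> j"
  have u: "arr Y Q u" unfolding u_def using arr_cmp[OF q' j] .
  have cu: "c \<cdot> u = idn D Y"
    unfolding u_def using assoc[OF c(1) q' j] c(2) qj by simp
  have "q' = q' \<cdot> (i \<cdot> p + j \<cdot> q)" using sum cmp_id_right[OF q'] by simp
  also have "\<dots> = (q' \<cdot> i) \<cdot> p + (q' \<cdot> j) \<cdot> q"
    using cmp_add[OF q' arr_cmp[OF i p] arr_cmp[OF j q]] assoc[OF q' i p] assoc[OF q' j q] by simp
  also have "\<dots> = u \<cdot> q" using qi' zero_cmp[OF p arr_cod[OF q']] by (simp add: u_def)
  also have "\<dots> = (u \<cdot> c) \<cdot> q'" using assoc[OF u c(1) q'] c(2) by simp
  finally have ucq: "(u \<cdot> c) \<cdot> q' = q'" by simp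
  note uc = arr_cmp[OF u c(1)]
  have "u \<cdot> c = ((u \<cdot> c) \<cdot> q') \<cdot> j'"
    using assoc[OF uc q' j'] qj' cmp_id_right[OF uc] by simp
  then have ucid: "u \<cdot> c = idn D Q" using ucq qj' by simp
  have iX: "iso_arrow D X X (idn D X)" and iS: "iso_arrow D S S (idn D S)"
    unfolding iso_arrow_def
    using idn_closed[OF arr_dom[OF i]] idn_closed[OF arr_cod[OF i]]
      cmp_id_left[OF arr_idn[OF arr_dom[OF i]]] cmp_id_left[OF arr_idn[OF arr_cod[OF i]]] by blast+
  have ic: "iso_arrow D Q Y c"
    unfolding iso_arrow_def using c u ucid cu arr_hom by blast
  have X1: "shO D 1 X \<in> obj D" using shO_closed arr_dom[OF i] by blast
  have "shM D 1 (idn D X) \<cdot> 0 = 0 \<cdot> c"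
    using shM_idn[OF arr_dom[OF i]] cmp_zero[OF arr_idn[OF X1] arr_dom[OF c(1)]]
      zero_cmp[OF c(1) X1] by simp
  then show ?thesis
    using TR1_iso[OF t arr_dom[OF i] arr_cod[OF i] arr_cod[OF q] arr_hom[OF i] arr_hom[OF q]
        arr_hom[OF arr_zero[OF arr_cod[OF q] X1]] iX iS ic]
      c(2) cmp_id_left[OF i] cmp_id_right[OF i] cmp_id_right[OF q] by simp
qed

section \<open>Complexity\<close>

text \<open>The towers of the definition of complexity, as \<open>built_iff\<close> confirms, in a
  form suited to induction on the last layer. Starting from any zero object makes the notion
  invariant under isomorphism.\<close>

inductive built for G where
  built_Nil: "zero_obj D Z \<Longrightarrow> built G [] Z"
| built_snoc: "\<lbrakk>built G ns X; triangle X Y (shO D n G)\<rbrakk> \<Longrightarrow> built G (ns @ [n]) Y"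

lemma triangle_zero_iso: assumes "triangle X Y Z" "zero_obj D Z" shows "iso X Y"
proof -
  obtain f g h where t: "(X, Y, Z, f, g, h) \<in> tri D" using assms(1) triangle_def by blast
  note r = rotate_back[OF t] and z = zero_obj_shO[OF assms(2), of "- 1"]
  have "- shM D (- 1) h = 0" using zero_objD(3)[OF z triD(1)[OF r]] .
  then show ?thesis
    using cone_unique[OF tri_zero_left[OF triangle_obj(1)[OF assms(1)] z]] r by simp
qed

lemma built_iso: assumes "built G ns X" "iso X Y" shows "built G ns Y"
  using assms(1)
proof cases
  case built_Nil
  then show ?thesis using assms zero_obj_iso iso_sym built.built_Nil by blast
next
  case (built_snoc ns X' n)
  then show ?thesis
    using triangle_iso[OF _ iso_refl assms(2) iso_refl] triangle_obj built.built_snoc by metis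
qed

text \<open>The tower of \<open>Z\<close> is pulled back to \<open>Y\<close>: the octahedron turns
  each stage of \<open>Z\<close> into a stage of \<open>Y\<close> with the same top layer, and the
  lowest stage is \<open>X\<close> up to isomorphism.\<close>

lemma built_concat:
  assumes "built G ns Z" "triangle X Y Z" "built G ms X" shows "built G (ms @ ns) Y"
  using assms
proof (induction arbitrary: Y rule: built.induct)
  case (built_Nil Z)
  then show ?case using triangle_zero_iso built_iso by simp
next
  case (built_snoc ns Z' Z n)
  obtain Y' where Y': "triangle X Y' Z'" "triangle Y' Y (shO D n G)"
    using octahedron built_snoc by blast
  then have "built G ((ms @ ns) @ [n]) Y"
    using built_snoc.IH[OF Y'(1)] built_snoc.prems built.built_snoc by blast
  then show ?case by simp
qed

lemma built_shO:
  assumes "built G ns X" "G \<in> obj D" shows "built G (map ((+) m) ns) (shO D m X)"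
  using assms
proof (induction rule: built.induct)
  case (built_snoc ns X Y n)
  then show ?case using triangle_shO[OF built_snoc.hyps(2), of m] built.built_snoc by (simp add: shO_shO)
qed (simp add: built.built_Nil zero_obj_shO)

lemma built_self: assumes "G \<in> obj D" shows "built G [0] G"
proof -
  obtain Z where Z: "zero_obj D Z" using zero_ex by blast
  have "triangle Z G (shO D 0 G)"
    using tri_zero_left[OF assms Z] shO_0[OF assms] unfolding triangle_def by metis
  then show ?thesis using built_snoc[OF built_Nil[OF Z]] by simp
qed

lemma built_iff:
  "built G ns S \<longleftrightarrow> (\<exists>As. zero_obj D (As 0) \<and>
     (\<forall>i<length ns. triangle (As i) (As (Suc i)) (shO D (ns ! i) G)) \<and> As (length ns) = S)"
  (is "_ \<longleftrightarrow> ?R ns S")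
proof
  assume "built G ns S"
  then show "?R ns S"
  proof (induction rule: built.induct)
    case (built_snoc ns X Y n)
    then obtain As where As: "zero_obj D (As 0)"
        "\<forall>i<length ns. triangle (As i) (As (Suc i)) (shO D (ns ! i) G)" "As (length ns) = X" by blast
    then show ?case
      using built_snoc.hyps(2)
      by (intro exI[of _ "As(Suc (length ns) := Y)"]) (auto simp: nth_append less_Suc_eq)
  qed auto
next
  assume "?R ns S"
  then show "built G ns S"
  proof (induction ns arbitrary: S rule: rev_induct)
    case (snoc n ns)
    then obtain As where As: "zero_obj D (As 0)"
        "\<forall>i<Suc (length ns). triangle (As i) (As (Suc i)) (shO D ((ns @ [n]) ! i) G)"
        "As (Suc (length ns)) = S" by auto
    then have "\<forall>i<length ns. triangle (As i) (As (Suc i)) (shO D (ns ! i) G)"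
      by (metis less_Suc_eq nth_append)
    then have "built G ns (As (length ns))" using snoc.IH As(1) by blast
    moreover have "triangle (As (length ns)) S (shO D n G)" using As by auto
    ultimately show ?case using built_snoc by blast
  qed (auto intro: built_Nil)
qed

text \<open>The index set of the infimum in \<open>complexity\<close>. For a zero object it contains
  \<open>[]\<close>, so no separate case is needed.\<close>

definition adm where
  "adm G F = {ns. \<exists>S. built G ns S \<and> retract F S}"

lemma adm_obj: "ns \<in> adm G F \<Longrightarrow> F \<in> obj D"
  unfolding adm_def using retract_obj by blast

lemma adm_retract: "\<lbrakk>ns \<in> adm G F; retract F' F\<rbrakk> \<Longrightarrow> ns \<in> adm G F'"
  unfolding adm_def using retract_trans by blast

lemma adm_zero: "zero_obj D F \<Longrightarrow> [] \<in> adm G F"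
  unfolding adm_def using built_Nil retract_refl zero_objD(1) by blast

lemma adm_self: "G \<in> obj D \<Longrightarrow> [0] \<in> adm G G"
  unfolding adm_def using built_self retract_refl by blast

lemma adm_shO: "\<lbrakk>ns \<in> adm G F; G \<in> obj D\<rbrakk> \<Longrightarrow> map ((+) m) ns \<in> adm G (shO D m F)"
  unfolding adm_def using built_shO retract_shO by blast

lemma adm_ext: assumes "ms \<in> adm G X" "ns \<in> adm G Z" "triangle X Y Z" shows "ms @ ns \<in> adm G Y"
proof -
  obtain S S' where S: "built G ms S" "retract X S" "built G ns S'" "retract Z S'"
    using assms unfolding adm_def by blast
  obtain W where "triangle S W S'" "retract Y W" using triangle_retract[OF assms(3) S(2,4)] by blast
  then show ?thesis unfolding adm_def using built_concat S by blast
qed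

lemma adm_cone:
  "\<lbrakk>ms \<in> adm G X; ns \<in> adm G Y; triangle X Y Z; G \<in> obj D\<rbrakk> \<Longrightarrow> ns @ map ((+) 1) ms \<in> adm G Z"
  using adm_ext adm_shO triangle_rotate by blast

text \<open>Each layer \<open>F[n]\<close> of a tower of \<open>H\<close> is resolved in turn by the
  list \<open>ms\<close> shifted by \<open>n\<close>. Weights multiply under this substitution by
  \<open>wt_compose\<close>, whence the submultiplicativity of complexity.\<close>

lemma adm_compose:
  assumes "ms \<in> adm G F" "ns \<in> adm F H" "G \<in> obj D"
  shows "concat (map (\<lambda>n. map ((+) n) ms) ns) \<in> adm G H"
proof -
  obtain S where S: "built F ns S" "retract H S" using assms unfolding adm_def by blast
  from S(1) have "concat (map (\<lambda>n. map ((+) n) ms) ns) \<in> adm G S"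
  proof (induction rule: built.induct)
    case (built_Nil Z)
    then show ?case by (simp add: adm_zero)
  next
    case (built_snoc ns X Y n)
    then show ?case using adm_ext[OF built_snoc.IH adm_shO[OF assms(1,3)]] by simp
  qed
  then show ?thesis using adm_retract S by blast
qed

definition wt :: "real \<Rightarrow> int list \<Rightarrow> real" where
  "wt t ns = (\<Sum>n\<leftarrow>ns. exp (of_int n * t))"

lemma wt_nonneg: "0 \<le> wt t ns"
  unfolding wt_def by (rule sum_list_nonneg) auto

lemma wt_ge: "n \<in> set ns \<Longrightarrow> exp (of_int n * t) \<le> wt t ns"
  unfolding wt_def by (rule member_le_sum_list) auto

lemma wt_append: "wt t (ms @ ns) = wt t ms + wt t ns"
  by (simp add: wt_def)

lemma wt_shift: "wt t (map ((+) m) ns) = exp (of_int m * t) * wt t ns"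
  by (induction ns) (simp_all add: wt_def exp_add algebra_simps)

lemma wt_compose: "wt t (concat (map (\<lambda>n. map ((+) n) ms) ns)) = wt t ms * wt t ns"
proof (induction ns)
  case (Cons n ns)
  then show ?case
    by (simp add: wt_append wt_shift) (simp add: wt_def algebra_simps)
qed (simp add: wt_def)

text \<open>A real infimum, meaningful only if \<open>adm G F\<close> is nonempty; hence the
  nonemptiness premises below. For a zero object the empty list makes it \<open>0\<close>, in
  accordance with \<open>complexity\<close>.\<close>

definition cx where
  "cx t G F = (INF ns\<in>adm G F. wt t ns)"

lemma cx_le: "ns \<in> adm G F \<Longrightarrow> cx t G F \<le> wt t ns"
  unfolding cx_def by (rule cINF_lower) (auto intro!: bdd_belowI2 wt_nonneg)

lemma cx_greatest: "\<lbrakk>adm G F \<noteq> {}; \<And>ns. ns \<in> adm G F \<Longrightarrow> r \<le> wt t ns\<rbrakk> \<Longrightarrow> r \<le> cx t G F"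
  unfolding cx_def by (rule cINF_greatest)

lemma cx_nonneg: "adm G F \<noteq> {} \<Longrightarrow> 0 \<le> cx t G F"
  by (rule cx_greatest) (auto simp: wt_nonneg)

lemma complexity_eq_cx:
  assumes "F \<in> obj D" "adm G F \<noteq> {}" shows "complexity D t G F = ereal (cx t G F)"
proof (cases "zero_obj D F")
  case True
  have "cx t G F \<le> 0" using cx_le[OF adm_zero[OF True], of t] by (simp add: wt_def)
  then show ?thesis using True cx_nonneg[OF assms(2), of t] by (simp add: complexity_def)
next
  case False
  have "(\<exists>F' As. F' \<in> obj D \<and> zero_obj D (As 0) \<and>
         (\<forall>i<length ns. \<exists>f g h. (As i, As (Suc i), shO D (ns ! i) G, f, g, h) \<in> tri D) \<and>
         biproduct D F F' (As (length ns))) \<longleftrightarrow> ns \<in> adm G F" for ns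
    unfolding adm_def built_iff triangle_def[symmetric] mem_Collect_eq
    using retract_biproduct biproduct_retract[OF assms(1)] by metis
  then have "complexity D t G F = (INF ns\<in>adm G F. ereal (wt t ns))"
    using False by (simp add: complexity_def wt_def)
  also have "\<dots> = ereal (cx t G F)"
  proof (rule antisym)
    show "ereal (cx t G F) \<le> (INF ns\<in>adm G F. ereal (wt t ns))"
      by (rule INF_greatest) (simp add: cx_le)
    obtain ns0 where ns0: "ns0 \<in> adm G F" using assms(2) by blast
    define I where "I = (INF ns\<in>adm G F. ereal (wt t ns))"
    have "I \<le> ereal (wt t ns0)" "0 \<le> I"
      unfolding I_def using ns0 by (auto intro!: INF_lower INF_greatest simp: wt_nonneg)
    then obtain r where r: "I = ereal r" by (cases I) auto
    have "r \<le> wt t ns" if "ns \<in> adm G F" for ns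
      using INF_lower[OF that, of "\<lambda>ns. ereal (wt t ns)"] r unfolding I_def by simp
    then have "r \<le> cx t G F" using cx_greatest[OF assms(2)] by blast
    then show "(INF ns\<in>adm G F. ereal (wt t ns)) \<le> ereal (cx t G F)"
      using r unfolding I_def by simp
  qed
  finally show ?thesis .
qed

lemma cx_triangle:
  assumes "triangle X Y Z" "adm G X \<noteq> {}" "adm G Z \<noteq> {}"
  shows "cx t G Y \<le> cx t G X + cx t G Z"
proof -
  have "cx t G Y - wt t ns \<le> cx t G X" if "ns \<in> adm G Z" for ns
  proof (rule cx_greatest[OF assms(2)])
    fix ms assume "ms \<in> adm G X"
    then show "cx t G Y - wt t ns \<le> wt t ms"
      using cx_le[OF adm_ext[OF _ that assms(1)], of ms t] by (simp add: wt_append)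
  qed
  then have "cx t G Y - cx t G X \<le> wt t ns" if "ns \<in> adm G Z" for ns
    using that by (simp add: algebra_simps)
  then have "cx t G Y - cx t G X \<le> cx t G Z" using cx_greatest[OF assms(3)] by blast
  then show ?thesis by simp
qed

lemma cx_compose:
  assumes "G \<in> obj D" "adm G F \<noteq> {}" "adm F H \<noteq> {}"
  shows "cx t G H \<le> cx t G F * cx t F H"
proof -
  have le: "cx t G H \<le> wt t ms * wt t ns" if "ms \<in> adm G F" "ns \<in> adm F H" for ms ns
    using cx_le[OF adm_compose[OF that assms(1)], of t] by (simp add: wt_compose)
  have "cx t G H \<le> cx t G F * wt t ns" if ns: "ns \<in> adm F H" for ns
  \<comment> \<open>To pass to the infimum over \<open>ms\<close> the other factor is divided out,
    so the vanishing factor is treated apart. The infimum over \<open>ns\<close> below follows the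
    same pattern.\<close>
  proof (cases "wt t ns = 0")
    case True
    then show ?thesis using le[OF _ ns] assms(2) by force
  next
    case False
    then have pos: "0 < wt t ns" using wt_nonneg[of t ns] by simp
    have "cx t G H / wt t ns \<le> cx t G F"
      by (rule cx_greatest[OF assms(2)]) (use le[OF _ ns] pos in \<open>simp add: pos_divide_le_eq\<close>)
    then show ?thesis using pos by (simp add: pos_divide_le_eq)
  qed
  note le' = this
  show ?thesis
  proof (cases "cx t G F = 0")
    case True
    then show ?thesis using le' assms(3) by force
  next
    case False
    then have pos: "0 < cx t G F" using cx_nonneg[OF assms(2), of t] by simp
    have "cx t G H / cx t G F \<le> cx t F H"
      by (rule cx_greatest[OF assms(3)]) (use le' pos in \<open>simp add: pos_divide_le_eq mult.commute\<close>)
    then show ?thesis using pos by (simp add: pos_divide_le_eq mult.commute)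
  qed
qed

lemma cx_shO_le:
  assumes "G \<in> obj D" "adm G F \<noteq> {}"
  shows "cx t G (shO D m F) \<le> exp (of_int m * t) * cx t G F"
proof -
  have "cx t G (shO D m F) / exp (of_int m * t) \<le> cx t G F"
  proof (rule cx_greatest[OF assms(2)])
    fix ns assume "ns \<in> adm G F"
    then show "cx t G (shO D m F) / exp (of_int m * t) \<le> wt t ns"
      using cx_le[OF adm_shO[OF _ assms(1)], of ns F t m]
      by (simp add: wt_shift pos_divide_le_eq mult.commute)
  qed
  then show ?thesis by (simp add: pos_divide_le_eq mult.commute)
qed

lemma cx_shO:
  assumes "G \<in> obj D" "adm G F \<noteq> {}"
  shows "cx t G (shO D m F) = exp (of_int m * t) * cx t G F"
proof (rule antisym[OF cx_shO_le[OF assms]])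
  have F: "F \<in> obj D" using assms(2) adm_obj by blast
  have "adm G (shO D m F) \<noteq> {}" using adm_shO[OF _ assms(1)] assms(2) by blast
  from cx_shO_le[OF assms(1) this, of t "- m"]
  have "cx t G F \<le> exp (- (of_int m * t)) * cx t G (shO D m F)"
    using F by (simp add: shO_inv(2))
  then show "exp (of_int m * t) * cx t G F \<le> cx t G (shO D m F)"
    by (simp add: exp_minus field_simps)
qed

lemma adm_iso_eq: "iso F F' \<Longrightarrow> adm G F = adm G F'"
  using adm_retract iso_retract iso_sym by blast

lemma cx_iso: "iso F F' \<Longrightarrow> cx t G F = cx t G F'"
  unfolding cx_def using adm_iso_eq by simp

text \<open>By minimality this class contains everything as soon as it contains a split-generator,
  so complexities relative to a split-generator are finite.\<close>

lemma thick_adm: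
  assumes "G \<in> obj D" shows "thick_subcategory D {F. adm G F \<noteq> {}}"
  unfolding thick_subcategory_def mem_Collect_eq
proof (intro conjI allI impI ballI)
  show "{F. adm G F \<noteq> {}} \<subseteq> obj D" using adm_obj by blast
  show "\<exists>Z\<in>{F. adm G F \<noteq> {}}. zero_obj D Z" using zero_ex adm_zero by blast
  show "adm G (shO D n X) \<noteq> {}" if "X \<in> {F. adm G F \<noteq> {}}" for X n
    using that adm_shO assms by blast
  show "adm G Z \<noteq> {}" if "(X, Y, Z, f, g, h) \<in> tri D \<and> adm G X \<noteq> {} \<and> adm G Y \<noteq> {}"
    for X Y Z f g h
    using that adm_cone assms unfolding triangle_def by blast
  show "adm G X \<noteq> {}" if "X \<in> obj D" "Z \<in> {F. adm G F \<noteq> {}}" "biproduct D X Y Z" for X Y Z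
    using that adm_retract biproduct_retract by blast
qed

lemma split_generator_adm:
  assumes "split_generator D G" "F \<in> obj D" shows "adm G F \<noteq> {}"
  using assms thick_adm adm_self unfolding split_generator_def by blast

text \<open>If a split-generator had no nonzero map from any of its shifts to \<open>F\<close>, this
  class would contain \<open>F\<close> itself, whose identity would then vanish.\<close>

lemma thick_orthogonal:
  assumes F: "F \<in> obj D"
  shows "thick_subcategory D {X \<in> obj D. \<forall>m u. arr (shO D m X) F u \<longrightarrow> u = 0}"
  unfolding thick_subcategory_def mem_Collect_eq
proof (intro conjI allI impI ballI)
  let ?S = "{X \<in> obj D. \<forall>m u. arr (shO D m X) F u \<longrightarrow> u = 0}"
  show "?S \<subseteq> obj D" by blast
  show "\<exists>Z\<in>?S. zero_obj D Z" using zero_ex zero_objD zero_obj_shO by blast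
  show "shO D n X \<in> obj D" if "X \<in> ?S" for X n using that shO_closed by blast
  show "u = 0" if "X \<in> ?S" "arr (shO D m (shO D n X)) F u" for X n m u
    using that shO_shO by auto
  fix X Y Z f g h
  assume a: "(X, Y, Z, f, g, h) \<in> tri D \<and> (X \<in> obj D \<and> (\<forall>m u. arr (shO D m X) F u \<longrightarrow> u = 0)) \<and>
    Y \<in> obj D \<and> (\<forall>m u. arr (shO D m Y) F u \<longrightarrow> u = 0)"
  show "Z \<in> obj D" using a tri_closed by blast
  fix m u assume u: "arr (shO D m Z) F u"
  have "triangle (shO D m Y) (shO D m Z) (shO D m (shO D 1 X))"
    using triangle_shO[OF triangle_rotate] a unfolding triangle_def by blast
  then obtain f' g' h' where
    t: "(shO D m Y, shO D m Z, shO D m (shO D 1 X), f', g', h') \<in> tri D" unfolding triangle_def by blast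
  have "u \<cdot> f' = 0" using arr_cmp[OF u triD(1)[OF t]] a by blast
  then obtain v where v: "arr (shO D m (shO D 1 X)) F v" "v \<cdot> g' = u"
    using exact_contra[OF t u] by blast
  then have "v = 0" using a shO_shO by auto
  then show "u = 0" using v zero_cmp[OF triD(2)[OF t] F] by simp
next
  fix X Y Z m u
  assume a: "X \<in> obj D" "Z \<in> {X \<in> obj D. \<forall>m u. arr (shO D m X) F u \<longrightarrow> u = 0}"
    "biproduct D X Y Z" "arr (shO D m X) F u"
  obtain i p where ip: "arr (shO D m X) (shO D m Z) i" "arr (shO D m Z) (shO D m X) p"
      "p \<cdot> i = idn D (shO D m X)"
    using retract_shO[OF biproduct_retract[OF a(1,3)]] retract_def by blast
  have "u \<cdot> p = 0" using arr_cmp[OF a(4) ip(2)] a(2) by blast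
  then have "u \<cdot> (p \<cdot> i) = 0" using assoc[OF a(4) ip(2,1)] zero_cmp[OF ip(1) F] by simp
  then show "u = 0" using ip(3) cmp_id_right[OF a(4)] by simp
qed

lemma split_generator_hom:
  assumes "split_generator D G" "F \<in> obj D" "\<not> zero_obj D F"
  shows "\<exists>m u. arr (shO D m G) F u \<and> u \<noteq> 0"
proof (rule ccontr)
  assume "\<not> ?thesis"
  moreover have "G \<in> obj D" using assms unfolding split_generator_def by blast
  ultimately have "F \<in> {X \<in> obj D. \<forall>m u. arr (shO D m X) F u \<longrightarrow> u = 0}"
    using assms thick_orthogonal[OF assms(2)] unfolding split_generator_def by blast
  then have "arr (shO D 0 F) F u \<Longrightarrow> u = 0" for u by blast
  then have "arr F F u \<Longrightarrow> u = 0" for u using shO_0[OF assms(2)] by simp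
  then show False using arr_idn[OF assms(2)] zero_obj_iff assms by blast
qed

text \<open>A nonzero arrow into a tower is seen by some layer: either its image in the top layer is
  nonzero, or it lifts to the stage below.\<close>

lemma built_hom:
  assumes "built G ns S" "arr H S u" "u \<noteq> 0"
  shows "\<exists>n\<in>set ns. \<exists>v. arr H (shO D n G) v \<and> v \<noteq> 0"
  using assms
proof (induction arbitrary: u rule: built.induct)
  case (built_Nil Z)
  then show ?case using zero_objD by blast
next
  case (built_snoc ns X Y n)
  obtain f g h where t: "(X, Y, shO D n G, f, g, h) \<in> tri D" using built_snoc triangle_def by blast
  show ?case
  proof (cases "g \<cdot> u = 0")
    case True
    then obtain v where v: "arr H X v" "f \<cdot> v = u"
      using exact_cov[OF t built_snoc.prems(1)] by blast
    then have "v \<noteq> 0" using cmp_zero[OF triD(1)[OF t]] arr_dom built_snoc.prems by metis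
    then show ?thesis using built_snoc.IH v by fastforce
  next
    case False
    then show ?thesis using arr_cmp[OF triD(2)[OF t] built_snoc.prems(1)] by auto
  qed
qed

lemma cx_pos:
  assumes "finite_type D" "split_generator D G" "F \<in> obj D" "\<not> zero_obj D F"
  shows "0 < cx t G F"
proof -
  have G: "G \<in> obj D" using assms unfolding split_generator_def by blast
  obtain m u where u: "arr (shO D m G) F u" "u \<noteq> 0"
    using split_generator_hom assms by blast
  \<comment> \<open>The shifts that can occur as a layer detecting \<open>u\<close>. This set lies
    in a translate by \<open>m\<close> of the degrees in which \<open>G\<close> has nonzero
    endomorphisms, hence is finite by finite type.\<close>
  define N where "N = {n. \<exists>v. arr (shO D m G) (shO D n G) v \<and> v \<noteq> 0}"
  have "N \<subseteq> (+) m ` {n. hom D G (shO D n G) \<noteq> {0}}"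
  proof
    fix n assume "n \<in> N"
    then obtain v where v: "arr (shO D m G) (shO D n G) v" "v \<noteq> 0" unfolding N_def by blast
    define w where "w = shM D (- m) v"
    have w: "arr G (shO D (n - m) G) w"
      using arr_shM[OF v(1), of "- m"] G unfolding w_def by (simp add: shO_shO shO_0)
    have "v = shM D m w" unfolding w_def using shM_inv(1)[OF v(1), of m] by simp
    then have "w \<noteq> 0" using v(2) shM_zero[OF arr_dom[OF w] arr_cod[OF w]] by auto
    then have "n - m \<in> {n. hom D G (shO D n G) \<noteq> {0}}" using w arr_hom by blast
    then show "n \<in> (+) m ` {n. hom D G (shO D n G) \<noteq> {0}}" by force
  qed
  then have fin: "finite N"
    using assms(1) G finite_surj unfolding finite_type_def by blast
  have meets: "\<exists>n\<in>set ns. n \<in> N" if "ns \<in> adm G F" for ns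
  proof -
    obtain S where S: "built G ns S" "retract F S" using \<open>ns \<in> adm G F\<close> unfolding adm_def by blast
    then obtain i p where ip: "arr F S i" "arr S F p" "p \<cdot> i = idn D F"
      using retract_def by blast
    have "p \<cdot> (i \<cdot> u) = u" using assoc[OF ip(2,1) u(1)] ip(3) cmp_id_left[OF u(1)] by simp
    then have "i \<cdot> u \<noteq> 0" using u(2) cmp_zero[OF ip(2) arr_dom[OF u(1)]] by auto
    then show ?thesis
      using built_hom[OF S(1) arr_cmp[OF ip(1) u(1)]] unfolding N_def by blast
  qed
  obtain ns0 where "ns0 \<in> adm G F" using split_generator_adm assms by blast
  then have "N \<noteq> {}" using meets by blast
  \<comment> \<open>Every admissible list has a member in \<open>N\<close>, and that single term
    already bounds its weight below by this minimum.\<close>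
  define r where "r = Min ((\<lambda>n. exp (of_int n * t)) ` N)"
  have "0 < r" unfolding r_def using fin \<open>N \<noteq> {}\<close> by simp
  moreover have "r \<le> cx t G F"
  proof (rule cx_greatest)
    show "adm G F \<noteq> {}" using split_generator_adm assms by blast
    fix ns assume "ns \<in> adm G F"
    then obtain n where n: "n \<in> set ns" "n \<in> N" using meets by blast
    then have "r \<le> exp (of_int n * t)" unfolding r_def using fin by (intro Min_le) auto
    then show "r \<le> wt t ns" using wt_ge[OF n(1), of t] by linarith
  qed
  ultimately show ?thesis by linarith
qed

end

section \<open>Exact functors carry towers to towers with the same shifts\<close>

locale exact_endofunctor = triangulated_category +
  fixes T
  assumes exact: "exact_functor D D T"
begin

lemma linear: "linear_functor D D T"
  using exact exact_functor_def by blast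

lemma fob_obj: "X \<in> obj D \<Longrightarrow> fob T X \<in> obj D"
  using linear unfolding linear_functor_def by blast

lemma fmo_arr: "arr X Y f \<Longrightarrow> arr (fob T X) (fob T Y) (fmo T f)"
  using linear unfolding linear_functor_def arr_def by blast

lemma fmo_idn: "X \<in> obj D \<Longrightarrow> fmo T (idn D X) = idn D (fob T X)"
  using linear unfolding linear_functor_def by blast

lemma fmo_cmp: "\<lbrakk>arr Y Z g; arr X Y f\<rbrakk> \<Longrightarrow> fmo T (g \<cdot> f) = fmo T g \<cdot> fmo T f"
  using linear unfolding linear_functor_def arr_def by blast

lemma fmo_zero: assumes "X \<in> obj D" "Y \<in> obj D" shows "fmo T 0 = 0"
proof -
  have "lin_on (scl D) (scl D) (hom D X Y) (fmo T)"
    using linear assms unfolding linear_functor_def by blast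
  then have "fmo T (scl D 0 0) = scl D 0 (fmo T 0)"
    using arr_hom[OF arr_zero[OF assms]] unfolding lin_on_def by blast
  then show ?thesis by simp
qed

lemma fob_iso: assumes "iso X Y" shows "iso (fob T X) (fob T Y)"
proof -
  obtain f g where fg: "arr X Y f" "arr Y X g" "g \<cdot> f = idn D X" "f \<cdot> g = idn D Y"
    using assms iso_iff by blast
  then have "fmo T g \<cdot> fmo T f = idn D (fob T X)" "fmo T f \<cdot> fmo T g = idn D (fob T Y)"
    using fmo_cmp[OF fg(1,2)] fmo_cmp[OF fg(2,1)] fmo_idn arr_dom by metis+
  then show ?thesis unfolding iso_iff using fmo_arr fg by blast
qed

lemma fob_retract: assumes "retract X Y" shows "retract (fob T X) (fob T Y)"
proof -
  obtain f g where fg: "arr X Y f" "arr Y X g" "g \<cdot> f = idn D X"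
    using assms retract_def by blast
  then have "fmo T g \<cdot> fmo T f = idn D (fob T X)"
    using fmo_cmp[OF fg(2,1)] fmo_idn arr_dom by metis
  then show ?thesis unfolding retract_def using fmo_arr fg by blast
qed

lemma fob_zero: assumes "zero_obj D Z" shows "zero_obj D (fob T Z)"
  using assms zero_obj_iff fmo_idn fmo_zero fob_obj zero_objD(1) by metis

lemma fob_triangle: assumes "triangle X Y Z" shows "triangle (fob T X) (fob T Y) (fob T Z)"
  using exact assms unfolding exact_functor_def triangle_def by metis

lemma fob_shO_1: "X \<in> obj D \<Longrightarrow> iso (fob T (shO D 1 X)) (shO D 1 (fob T X))"
  using exact shO_closed fob_obj unfolding exact_functor_def iso_def by metis

lemma fob_shO: assumes X: "X \<in> obj D" shows "iso (fob T (shO D n X)) (shO D n (fob T X))"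
proof (induction n rule: int_induct[where k = 0])
  case base
  then show ?case using X by (simp add: shO_0 fob_obj iso_refl)
next
  case (step1 i)
  have "iso (fob T (shO D 1 (shO D i X))) (shO D 1 (shO D i (fob T X)))"
    using iso_trans[OF fob_shO_1 iso_shO[OF step1(2)]] X shO_closed by blast
  then show ?case using X fob_obj by (simp add: shO_shO add.commute)
next
  case (step2 i)
  have "iso (fob T (shO D 1 (shO D (i - 1) X))) (shO D 1 (fob T (shO D (i - 1) X)))"
    using fob_shO_1 X shO_closed by blast
  then have "iso (fob T (shO D i X)) (shO D 1 (fob T (shO D (i - 1) X)))"
    using X by (simp add: shO_shO)
  then have "iso (shO D 1 (fob T (shO D (i - 1) X))) (shO D i (fob T X))"
    using iso_trans[OF iso_sym] step2(2) by blast
  from iso_shO[OF this, of "- 1"] show ?case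
    using X fob_obj shO_closed by (simp add: shO_shO shO_0)
qed

lemma built_fob: "built G ns X \<Longrightarrow> G \<in> obj D \<Longrightarrow> built (fob T G) ns (fob T X)"
proof (induction rule: built.induct)
  case (built_snoc ns X Y n)
  have "triangle (fob T X) (fob T Y) (shO D n (fob T G))"
    using triangle_iso[OF fob_triangle[OF built_snoc.hyps(2)] iso_refl iso_refl fob_shO] built_snoc
      triangle_obj fob_obj by metis
  then show ?case using built_snoc built.built_snoc by blast
qed (simp add: built_Nil fob_zero)

lemma adm_fob: "\<lbrakk>G \<in> obj D; ns \<in> adm G F\<rbrakk> \<Longrightarrow> ns \<in> adm (fob T G) (fob T F)"
  unfolding adm_def using built_fob fob_retract by blast

lemma iter_obj: "X \<in> obj D \<Longrightarrow> (fob T ^^ n) X \<in> obj D"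
  by (induction n) (auto simp: fob_obj)

lemma iter_triangle: "triangle X Y Z \<Longrightarrow> triangle ((fob T ^^ n) X) ((fob T ^^ n) Y) ((fob T ^^ n) Z)"
  by (induction n) (auto simp: fob_triangle)

lemma iter_adm: "\<lbrakk>G \<in> obj D; ns \<in> adm G F\<rbrakk> \<Longrightarrow> ns \<in> adm ((fob T ^^ n) G) ((fob T ^^ n) F)"
  by (induction n) (auto simp: adm_fob iter_obj)

lemma cx_iter_le:
  assumes "G \<in> obj D" "adm G F \<noteq> {}"
  shows "cx t ((fob T ^^ n) G) ((fob T ^^ n) F) \<le> cx t G F"
  using assms by (intro cx_greatest) (auto intro!: cx_le iter_adm)

end

section \<open>Graded tensor products and \<open>P\<close>-twists\<close>

context triangulated_category
begin

text \<open>The hypotheses make \<open>Q\<close> the kernel and \<open>P\<close> the cokernel of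
  \<open>\<mu>\<close>, with a contraction of the rest. Hence \<open>C\<close> is the direct sum of
  \<open>Q[1]\<close> and \<open>P\<close>, with \<open>ev\<close> as projection to
  \<open>P\<close>, and the cone of a split projection is the other summand shifted once
  more.\<close>

lemma contracted_cone:
  assumes t: "(B', B, C, \<mu>, a, b) \<in> tri D" and t': "(C, P, T, ev, e, e') \<in> tri D"
    and \<rho>: "arr B B' \<rho>" and s0: "arr P B s0" and \<kappa>: "arr Q B' \<kappa>" and \<pi>: "arr B' Q \<pi>"
    and eq: "(ev \<cdot> a) \<cdot> s0 = idn D P" "\<pi> \<cdot> \<kappa> = idn D Q" "\<mu> \<cdot> \<kappa> = 0"
      "\<mu> \<cdot> \<rho> + s0 \<cdot> (ev \<cdot> a) = idn D B" "\<rho> \<cdot> \<mu> + \<kappa> \<cdot> \<pi> = idn D B'"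
    and noHom: "\<And>u. arr (shO D 1 Q) P u \<Longrightarrow> u = 0"
  shows "iso T (shO D 2 Q)"
proof -
  note T = triD[OF t] and ev = triD(1)[OF t']
  note a = T(2) and b = T(3) and \<mu> = T(1)
  note s\<kappa> = arr_shM[OF \<kappa>, of 1] and s\<pi> = arr_shM[OF \<pi>, of 1] and s\<mu> = arr_shM[OF \<mu>, of 1]
    and s\<rho> = arr_shM[OF \<rho>, of 1]
  have Q: "Q \<in> obj D" using arr_dom \<kappa> by blast
  note iC = arr_idn[OF arr_cod[OF a]]
  have ba: "b \<cdot> a = 0" using tri_cmp_zero[OF rotate[OF t]] .
  have "shM D 1 \<mu> \<cdot> shM D 1 \<kappa> = 0"
    using shM_compose[OF \<mu> \<kappa>, of 1] eq(3) shM_zero Q arr_cod[OF \<mu>] by simp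
  then have "(- shM D 1 \<mu>) \<cdot> shM D 1 \<kappa> = 0" using uminus_cmp[OF s\<mu> s\<kappa>] by simp
  then obtain w where w: "arr (shO D 1 Q) C w" "b \<cdot> w = shM D 1 \<kappa>"
    using exact_cov[OF rotate[OF rotate[OF t]] s\<kappa>] by blast
  define s where "s = a \<cdot> s0"
  define r where "r = shM D 1 \<pi> \<cdot> b"
  have s: "arr P C s" unfolding s_def using arr_cmp[OF a s0] .
  have r: "arr C (shO D 1 Q) r" unfolding r_def using arr_cmp[OF s\<pi> b] .
  have evs: "ev \<cdot> s = idn D P" unfolding s_def using eq(1) assoc[OF ev a s0] by simp
  \<comment> \<open>The lift \<open>w\<close> of \<open>\<kappa>[1]\<close> along \<open>b\<close>
    is not unique and might have a component seen by \<open>ev\<close>. Vanishing of the arrows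
    \<open>Q[1] \<rightarrow> P\<close> rules this out for any choice.\<close>
  have evw: "ev \<cdot> w = 0" using noHom arr_cmp[OF ev w(1)] by blast
  have rw: "r \<cdot> w = idn D (shO D 1 Q)"
    unfolding r_def using assoc[OF s\<pi> b w(1)] w(2) shM_compose[OF \<pi> \<kappa>, of 1] eq(2)
      shM_idn[OF Q] by simp
  have ra: "r \<cdot> a = 0" unfolding r_def using assoc[OF s\<pi> b a] ba cmp_zero[OF s\<pi> arr_dom[OF a]] by simp
  have rs: "r \<cdot> s = 0"
    unfolding s_def using assoc[OF r a s0] ra zero_cmp[OF s0 arr_cod[OF r]] by simp
  note wr = arr_cmp[OF w(1) r] and sev = arr_cmp[OF s ev]
  \<comment> \<open>The failure of \<open>C\<close> to be the direct sum. Since \<open>n\<close>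
    kills \<open>w\<close> and \<open>s\<close>, it is idempotent; since it factors through
    \<open>b\<close> and \<open>b \<cdot> n = 0\<close>, its square is zero. So it vanishes.\<close>
  define n where "n = idn D C - w \<cdot> r - s \<cdot> ev"
  note nn = arr_diff[OF arr_diff[OF iC wr] sev]
  have n: "arr C C n" unfolding n_def using nn .
  have n_cmp: "n \<cdot> u = u - w \<cdot> (r \<cdot> u) - s \<cdot> (ev \<cdot> u)" if u: "arr U C u" for U u
    unfolding n_def using diff_cmp[OF arr_diff[OF iC wr] sev u] diff_cmp[OF iC wr u]
      cmp_id_left[OF u] assoc[OF w(1) r u] assoc[OF s ev u] by simp
  have nw: "n \<cdot> w = 0"
    using n_cmp[OF w(1)] rw evw cmp_id_right[OF w(1)] cmp_zero[OF s arr_dom[OF w(1)]] by simp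
  have ns: "n \<cdot> s = 0"
    using n_cmp[OF s] rs evs cmp_id_right[OF s] cmp_zero[OF w(1) arr_dom[OF s]] by simp
  note eva = arr_cmp[OF ev a]
  have "n \<cdot> a = a - a \<cdot> (s0 \<cdot> (ev \<cdot> a))"
    using n_cmp[OF a] ra cmp_zero[OF w(1) arr_dom[OF a]] assoc[OF a s0 eva] by (simp add: s_def)
  also have "\<dots> = a \<cdot> (idn D B - s0 \<cdot> (ev \<cdot> a))"
    using cmp_diff[OF a arr_idn[OF arr_dom[OF a]] arr_cmp[OF s0 eva]] cmp_id_right[OF a] by simp
  also have "idn D B - s0 \<cdot> (ev \<cdot> a) = \<mu> \<cdot> \<rho>" using eq(4) by (simp add: algebra_simps)
  also have "a \<cdot> (\<mu> \<cdot> \<rho>) = 0"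
    using assoc[OF a \<mu> \<rho>] tri_cmp_zero[OF t] zero_cmp[OF \<rho> arr_cod[OF a]] by simp
  finally have "n \<cdot> a = 0" .
  then obtain m where m: "arr (shO D 1 B') C m" "m \<cdot> b = n"
    using exact_contra[OF rotate[OF t] n] by blast
  have bs: "b \<cdot> s = 0"
    unfolding s_def using assoc[OF b a s0] ba zero_cmp[OF s0 arr_cod[OF b]] by simp
  have "b \<cdot> n = b - (b \<cdot> w) \<cdot> r - (b \<cdot> s) \<cdot> ev"
    unfolding n_def using cmp_diff[OF b arr_diff[OF iC wr] sev] cmp_diff[OF b iC wr]
      cmp_id_right[OF b] assoc[OF b w(1) r] assoc[OF b s ev] by simp
  also have "\<dots> = b - shM D 1 (\<kappa> \<cdot> \<pi>) \<cdot> b"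
    using bs zero_cmp[OF ev arr_cod[OF b]] w(2) assoc[OF s\<kappa> s\<pi> b] shM_compose[OF \<kappa> \<pi>, of 1]
    by (simp add: r_def)
  also have "\<kappa> \<cdot> \<pi> = idn D B' - \<rho> \<cdot> \<mu>" using eq(5) by (simp add: algebra_simps)
  also have "shM D 1 (idn D B' - \<rho> \<cdot> \<mu>) = idn D (shO D 1 B') - shM D 1 \<rho> \<cdot> shM D 1 \<mu>"
    using shM_diff[OF arr_idn[OF arr_dom[OF \<mu>]] arr_cmp[OF \<rho> \<mu>], of 1]
      shM_idn[OF arr_dom[OF \<mu>]] shM_compose[OF \<rho> \<mu>, of 1] by simp
  also have "b - (idn D (shO D 1 B') - shM D 1 \<rho> \<cdot> shM D 1 \<mu>) \<cdot> b
      = shM D 1 \<rho> \<cdot> (shM D 1 \<mu> \<cdot> b)"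
    using diff_cmp[OF arr_idn[OF arr_cod[OF b]] arr_cmp[OF s\<rho> s\<mu>] b] cmp_id_left[OF b]
      assoc[OF s\<rho> s\<mu> b] by simp
  also have "shM D 1 \<mu> \<cdot> b = 0"
    using tri_cmp_zero[OF rotate[OF rotate[OF t]]] uminus_cmp[OF s\<mu> b] by simp
  finally have bn: "b \<cdot> n = 0" using cmp_zero[OF s\<rho> arr_dom[OF b]] by simp
  have "n \<cdot> n = (m \<cdot> b) \<cdot> n" using m(2) by simp
  also have "\<dots> = 0" using assoc[OF m(1) b n] bn cmp_zero[OF m(1) arr_dom[OF n]] by simp
  finally have "n \<cdot> n = 0" .
  moreover have "n \<cdot> n = n - (n \<cdot> w) \<cdot> r - (n \<cdot> s) \<cdot> ev"
    using cmp_diff[OF n arr_diff[OF iC wr] sev] cmp_diff[OF n iC wr] cmp_id_right[OF n]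
      assoc[OF n w(1) r] assoc[OF n s ev] unfolding n_def[symmetric] by simp
  ultimately have "n = 0"
    using nw ns zero_cmp[OF r arr_cod[OF n]] zero_cmp[OF ev arr_cod[OF n]] by simp
  then have "w \<cdot> r + s \<cdot> ev = idn D C" unfolding n_def by (simp add: algebra_simps)
  then have "(shO D 1 Q, C, P, w, ev, 0) \<in> tri D"
    using biproduct_triangle[OF w(1) r s ev rw evs evw] by blast
  then have "iso T (shO D 1 (shO D 1 Q))" using cone_unique[OF t' rotate] by blast
  then show ?thesis using Q by (simp add: shO_shO)
qed

section \<open>Tensor products with graded vector spaces and the values of the twist\<close>

lemma tensor_obj: "graded_tensor D V X B \<theta> \<Longrightarrow> B \<in> obj D"
  unfolding graded_tensor_def by blast

lemma tensor_arr:
  assumes "graded_tensor D V X B \<theta>" "X \<in> obj D" "v \<in> V i" shows "arr (shO D (- i) X) B (\<theta> i v)"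
proof -
  have "\<theta> i ` V i \<subseteq> hom D (shO D (- i) X) B" "B \<in> obj D"
    using assms(1) unfolding graded_tensor_def by simp_all
  then show ?thesis using arrI[OF shO_closed] assms(2,3) by blast
qed

lemma tensor_lin: "graded_tensor D V X B \<theta> \<Longrightarrow> lin_on (scl D) (scl D) (V i) (\<theta> i)"
  unfolding graded_tensor_def by simp

lemma tensor_universal:
  assumes g: "graded_tensor D V X B \<theta>" and Y: "Y \<in> obj D"
    and "\<forall>i. \<chi> i ` V i \<subseteq> hom D (shO D (- i) X) Y \<and> lin_on (scl D) (scl D) (V i) (\<chi> i)"
  shows "\<exists>!b. b \<in> hom D B Y \<and> (\<forall>i. \<forall>v\<in>V i. b \<cdot> \<theta> i v = \<chi> i v)"
proof -
  note u = g[unfolded graded_tensor_def, THEN conjunct2, THEN conjunct2]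
  show ?thesis using bspec[OF u Y, THEN spec[of _ \<chi>], THEN mp, OF assms(3)] .
qed

lemma tensor_map:
  assumes g: "graded_tensor D V X B \<theta>" and Y: "Y \<in> obj D"
    and "\<And>i v. v \<in> V i \<Longrightarrow> arr (shO D (- i) X) Y (\<chi> i v)"
    and "\<And>i. lin_on (scl D) (scl D) (V i) (\<chi> i)"
  shows "\<exists>b. arr B Y b \<and> (\<forall>i. \<forall>v\<in>V i. b \<cdot> \<theta> i v = \<chi> i v)"
proof -
  have "\<forall>i. \<chi> i ` V i \<subseteq> hom D (shO D (- i) X) Y \<and> lin_on (scl D) (scl D) (V i) (\<chi> i)"
    using arr_hom[OF assms(3)] assms(4) by (intro allI conjI image_subsetI) auto
  from ex1_implies_ex[OF tensor_universal[OF g Y this]]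
  show ?thesis using arrI[OF tensor_obj[OF g] Y] by blast
qed

lemma tensor_eqI:
  assumes g: "graded_tensor D V X B \<theta>" and X: "X \<in> obj D" and b: "arr B Y b" and b': "arr B Y b'"
    and eq: "\<And>i v. v \<in> V i \<Longrightarrow> b \<cdot> \<theta> i v = b' \<cdot> \<theta> i v"
  shows "b = b'"
proof -
  define \<chi> where "\<chi> = (\<lambda>i v. b \<cdot> \<theta> i v)"
  note \<theta> = tensor_arr[OF g X]
  have 1: "\<chi> i ` V i \<subseteq> hom D (shO D (- i) X) Y" for i
    unfolding \<chi>_def using arr_hom[OF arr_cmp[OF b \<theta>]] by (intro image_subsetI)
  have 2: "lin_on (scl D) (scl D) (V i) (\<chi> i)" for i
  proof -
    have "\<chi> i (x + y) = \<chi> i x + \<chi> i y" if "x \<in> V i" "y \<in> V i" for x y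
      unfolding \<chi>_def using cmp_add[OF b \<theta> \<theta>, OF that] tensor_lin[OF g, of i] that
      by (simp add: lin_on_def)
    moreover have "\<chi> i (scl D k x) = scl D k (\<chi> i x)" if "x \<in> V i" for k x
      unfolding \<chi>_def using cmp_scl[OF b \<theta>, OF that] tensor_lin[OF g, of i] that
      by (simp add: lin_on_def)
    ultimately show ?thesis unfolding lin_on_def by simp
  qed
  have "\<exists>!b. b \<in> hom D B Y \<and> (\<forall>i. \<forall>v\<in>V i. b \<cdot> \<theta> i v = \<chi> i v)"
    using tensor_universal[OF g arr_cod[OF b]] 1 2 by simp
  moreover have "b \<in> hom D B Y \<and> (\<forall>i. \<forall>v\<in>V i. b \<cdot> \<theta> i v = \<chi> i v)"
    unfolding \<chi>_def using arr_hom[OF b] by simp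
  moreover have "b' \<in> hom D B Y \<and> (\<forall>i. \<forall>v\<in>V i. b' \<cdot> \<theta> i v = \<chi> i v)"
    unfolding \<chi>_def using eq arr_hom[OF b'] by simp
  ultimately show ?thesis using the1_equality by metis
qed

lemma lin_on_zero: "\<lbrakk>lin_on (scl D) (scl D) V f; 0 \<in> V\<rbrakk> \<Longrightarrow> f 0 = 0"
  unfolding lin_on_def by (metis vs.scale_zero_left)

lemma tensor_zero:
  assumes g: "graded_tensor D V X B \<theta>" and X: "X \<in> obj D" and V: "\<And>i. V i = {0}"
  shows "zero_obj D B"
proof -
  note B = tensor_obj[OF g]
  have "idn D B = 0"
  proof (rule tensor_eqI[OF g X arr_idn[OF B] arr_zero[OF B B]])
    fix i v assume v: "v \<in> V i"
    then have "\<theta> i v = 0" using V lin_on_zero[OF tensor_lin[OF g]] by auto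
    then show "idn D B \<cdot> \<theta> i v = 0 \<cdot> \<theta> i v"
      using cmp_id_left[OF tensor_arr[OF g X v]] zero_cmp[OF tensor_arr[OF g X v] B] by simp
  qed
  then show ?thesis using zero_obj_iff B by blast
qed

text \<open>The middle object is the direct sum of the shifts \<open>X[n k]\<close>, assembled one
  summand at a time. When the sum of the \<open>w k \<cdot> c k\<close> is the identity,
  \<open>B\<close> becomes a retract of an object built from \<open>X\<close>.\<close>

lemma sum_factor_built:
  assumes "finite K" "X \<in> obj D" "B \<in> obj D"
    and "\<And>k. k \<in> K \<Longrightarrow> arr B (shO D (n k) X) (c k)" "\<And>k. k \<in> K \<Longrightarrow> arr (shO D (n k) X) B (w k)"
  shows "\<exists>ns S c' w'. built X ns S \<and> arr B S c' \<and> arr S B w' \<and> w' \<cdot> c' = (\<Sum>k\<in>K. w k \<cdot> c k)"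
  using assms
proof (induction K rule: finite_induct)
  case empty
  obtain Z where Z: "zero_obj D Z" using zero_ex by blast
  have "Z \<in> obj D" using Z zero_objD by blast
  then have "0 \<cdot> 0 = (\<Sum>k\<in>{}. w k \<cdot> c k)"
    using cmp_zero[OF arr_zero] empty by auto
  then show ?case using built_Nil[OF Z] arr_zero empty \<open>Z \<in> obj D\<close> by blast
next
  case (insert k K)
  then obtain ns S c' w' where S: "built X ns S" "arr B S c'" "arr S B w'"
      "w' \<cdot> c' = (\<Sum>k\<in>K. w k \<cdot> c k)" by auto
  have ck: "arr B (shO D (n k) X) (c k)" and wk: "arr (shO D (n k) X) B (w k)"
    using insert.prems by auto
  obtain W i j p q where W: "arr S W i" "arr (shO D (n k) X) W j" "arr W S p"
      "arr W (shO D (n k) X) q" "p \<cdot> i = idn D S" "q \<cdot> j = idn D (shO D (n k) X)"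
      "p \<cdot> j = 0" "q \<cdot> i = 0" "i \<cdot> p + j \<cdot> q = idn D W"
    using biproduct_ex[OF arr_cod[OF S(2)] arr_cod[OF ck]] arr_cod[OF S(2)] arr_cod[OF ck]
    unfolding biproduct_def arr_def by blast
  have "(S, W, shO D (n k) X, i, q, 0) \<in> tri D"
    using biproduct_triangle[OF W(1,3,2,4,5,6,8,9)] .
  then have bW: "built X (ns @ [n k]) W" using built_snoc[OF S(1)] triangle_def by blast
  note ic = arr_cmp[OF W(1) S(2)] and jc = arr_cmp[OF W(2) ck]
    and wp = arr_cmp[OF S(3) W(3)] and wq = arr_cmp[OF wk W(4)]
  have 1: "(w' \<cdot> p) \<cdot> (i \<cdot> c') = w' \<cdot> c'" using cancel_mid[OF S(2) W(1,3) S(3) W(5)] .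
  have 2: "(w k \<cdot> q) \<cdot> (j \<cdot> c k) = w k \<cdot> c k" using cancel_mid[OF ck W(2,4) wk W(6)] .
  have 3: "(w' \<cdot> p) \<cdot> (j \<cdot> c k) = 0"
    using assoc[OF S(3) W(3) jc] assoc[OF W(3,2) ck] W(7) zero_cmp[OF ck arr_cod[OF W(3)]]
      cmp_zero[OF S(3) arr_dom[OF ck]] by simp
  have 4: "(w k \<cdot> q) \<cdot> (i \<cdot> c') = 0"
    using assoc[OF wk W(4) ic] assoc[OF W(4,1) S(2)] W(8) zero_cmp[OF S(2) arr_cod[OF W(4)]]
      cmp_zero[OF wk arr_dom[OF S(2)]] by simp
  have "(w' \<cdot> p + w k \<cdot> q) \<cdot> (i \<cdot> c' + j \<cdot> c k) = w' \<cdot> c' + w k \<cdot> c k"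
    using add_cmp[OF wp wq arr_add[OF ic jc]] cmp_add[OF wp ic jc] cmp_add[OF wq ic jc] 1 2 3 4
    by simp
  also have "\<dots> = (\<Sum>k\<in>insert k K. w k \<cdot> c k)" using insert.hyps S(4) by (simp add: add.commute)
  finally show ?case using bW arr_add[OF ic jc] arr_add[OF wp wq] by blast
qed

lemma lin_on_sum:
  assumes f: "lin_on (scl D) (scl D) V f" and V: "vs.subspace V" and fin: "finite B" and "B \<subseteq> V"
  shows "f (\<Sum>\<beta>\<in>B. scl D (r \<beta>) \<beta>) = (\<Sum>\<beta>\<in>B. scl D (r \<beta>) (f \<beta>))"
  using fin \<open>B \<subseteq> V\<close>
proof (induction B rule: finite_induct)
  case empty
  then show ?case using lin_on_zero[OF f] V vs.subspace_0 by simp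
next
  case (insert \<beta> B)
  have "scl D (r \<beta>) \<beta> \<in> V" "(\<Sum>\<beta>\<in>B. scl D (r \<beta>) \<beta>) \<in> V"
    using insert.prems V by (auto intro!: vs.subspace_scale vs.subspace_sum)
  then have "f (scl D (r \<beta>) \<beta> + (\<Sum>\<beta>\<in>B. scl D (r \<beta>) \<beta>))
      = scl D (r \<beta>) (f \<beta>) + f (\<Sum>\<beta>\<in>B. scl D (r \<beta>) \<beta>)"
    using f insert.prems unfolding lin_on_def by auto
  then show ?case using insert by auto
qed

text \<open>The coordinates of \<open>V\<close> give maps \<open>c\<^sub>\<beta> : V \<otimes> X \<rightarrow> X[-i]\<close>, one for each basis vector \<open>\<beta>\<close> of
  degree \<open>i\<close>, with \<open>\<Sum>\<^sub>\<beta> \<theta>\<^sub>i \<beta> c\<^sub>\<beta> = 1\<close>.\<close>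

lemma tensor_adm:
  assumes g: "graded_tensor D V X B \<theta>" and X: "X \<in> obj D"
    and sub: "\<And>i. vs.subspace (V i)" and fd: "\<And>i. fin_dim (scl D) (V i)"
    and fin: "finite {i. V i \<noteq> {0}}"
  shows "adm X B \<noteq> {}"
proof -
  define I where "I = {i. V i \<noteq> {0}}"
  note B = tensor_obj[OF g]
  have "\<exists>Bs. finite Bs \<and> Bs \<subseteq> V i \<and> vs.independent Bs \<and> V i = vs.span Bs" for i
  proof -
    obtain Bs where Bs: "Bs \<subseteq> V i" "vs.independent Bs" "V i \<subseteq> vs.span Bs"
      by (rule vs.basis_exists[of "V i"])
    have "V i = vs.span Bs" using vs.span_minimal[OF Bs(1) sub] Bs(3) by simp
    moreover obtain C where C: "finite C" "V i = vs.span C"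
      using fd[of i] unfolding fin_dim_def by (elim exE conjE)
    moreover have "finite Bs"
      using vs.independent_span_bound[OF C(1) Bs(2)] Bs(1) C(2) by simp
    ultimately show ?thesis using Bs(1,2) by (intro exI[of _ Bs]) simp
  qed
  then obtain Bs where Bs: "\<And>i. finite (Bs i)" "\<And>i. Bs i \<subseteq> V i" "\<And>i. vs.independent (Bs i)"
      "\<And>i. V i = vs.span (Bs i)" by metis
  define \<chi> where "\<chi> = (\<lambda>i \<beta> i' v. if i' = i then scl D (vs.representation (Bs i) v \<beta>)
    (idn D (shO D (- i) X)) else 0)"
  have "\<exists>c. arr B (shO D (- i) X) c \<and> (\<forall>i'. \<forall>v\<in>V i'. c \<cdot> \<theta> i' v = \<chi> i \<beta> i' v)" for i \<beta>
  proof (rule tensor_map[OF g shO_closed[OF X]])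
    show "arr (shO D (- i') X) (shO D (- i) X) (\<chi> i \<beta> i' v)" for i' v
      unfolding \<chi>_def using arr_scl[OF arr_idn] arr_zero X shO_closed by simp
    show "lin_on (scl D) (scl D) (V i') (\<chi> i \<beta> i')" for i'
      unfolding lin_on_def \<chi>_def
      by (auto simp: vs.representation_add[OF Bs(3)] vs.representation_scale[OF Bs(3)] Bs(4)
        vs.scale_left_distrib vs.scale_scale)
  qed
  then obtain c where c: "\<And>i \<beta>. arr B (shO D (- i) X) (c i \<beta>)"
      "\<And>i \<beta> i' v. v \<in> V i' \<Longrightarrow> c i \<beta> \<cdot> \<theta> i' v = \<chi> i \<beta> i' v" by metis
  define K where "K = (SIGMA i:I. Bs i)"
  have finK: "finite K" unfolding K_def I_def using fin Bs(1) by auto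
  have \<theta>: "arr (shO D (- fst k) X) B (\<theta> (fst k) (snd k))" if "k \<in> K" for k
  proof -
    have "snd k \<in> V (fst k)" using Bs(2)[of "fst k"] that unfolding K_def by auto
    then show ?thesis by (rule tensor_arr[OF g X])
  qed
  define s where "s = (\<Sum>k\<in>K. \<theta> (fst k) (snd k) \<cdot> c (fst k) (snd k))"
  have \<theta>c: "arr B B (\<theta> (fst k) (snd k) \<cdot> c (fst k) (snd k))" if "k \<in> K" for k
    using arr_cmp[OF \<theta>[OF that] c(1)] .
  have s: "arr B B s" unfolding s_def using arr_sum[OF B B \<theta>c] .
  have "s = idn D B"
  proof (rule tensor_eqI[OF g X s arr_idn[OF B]])
    fix i v assume v: "v \<in> V i"
    note \<theta>v = tensor_arr[OF g X v]
    have "s \<cdot> \<theta> i v = (\<Sum>k\<in>K. (\<theta> (fst k) (snd k) \<cdot> c (fst k) (snd k)) \<cdot> \<theta> i v)"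
      unfolding s_def using sum_cmp[OF \<theta>v B \<theta>c] .
    also have "\<dots> = (\<Sum>(i', \<beta>)\<in>K. if i' = i then scl D (vs.representation (Bs i) v \<beta>) (\<theta> i \<beta>) else 0)"
    proof (rule sum.cong[OF refl], clarify)
      fix i' \<beta> assume k: "(i', \<beta>) \<in> K"
      note \<theta>k = \<theta>[OF k, simplified]
      have "(\<theta> i' \<beta> \<cdot> c i' \<beta>) \<cdot> \<theta> i v = \<theta> i' \<beta> \<cdot> \<chi> i' \<beta> i v"
        using assoc[OF \<theta>k c(1) \<theta>v] c(2)[OF v] by simp
      also have "\<dots> = (if i' = i then scl D (vs.representation (Bs i) v \<beta>) (\<theta> i \<beta>) else 0)"
        unfolding \<chi>_def using cmp_scl[OF \<theta>k arr_idn[OF arr_dom[OF \<theta>k]]] cmp_id_right[OF \<theta>k]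
          cmp_zero[OF \<theta>k arr_dom[OF \<theta>v]] by auto
      finally show "(\<theta> (fst (i', \<beta>)) (snd (i', \<beta>)) \<cdot> c (fst (i', \<beta>)) (snd (i', \<beta>))) \<cdot> \<theta> i v =
         (if i' = i then scl D (vs.representation (Bs i) v \<beta>) (\<theta> i \<beta>) else 0)" by simp
    qed
    also have "\<dots> = (\<Sum>i'\<in>I. \<Sum>\<beta>\<in>Bs i'.
        if i' = i then scl D (vs.representation (Bs i) v \<beta>) (\<theta> i \<beta>) else 0)"
      unfolding K_def using fin Bs(1) by (subst sum.Sigma) (auto simp: I_def)
    also have "\<dots> = (\<Sum>i'\<in>I. if i' = i then
        (\<Sum>\<beta>\<in>Bs i. scl D (vs.representation (Bs i) v \<beta>) (\<theta> i \<beta>)) else 0)"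
      by (rule sum.cong) auto
    also have "\<dots> = (if i \<in> I then \<Sum>\<beta>\<in>Bs i. scl D (vs.representation (Bs i) v \<beta>) (\<theta> i \<beta>) else 0)"
      using fin by (simp add: I_def)
    also have "\<dots> = \<theta> i v"
    proof (cases "i \<in> I")
      case True
      have "v = (\<Sum>\<beta>\<in>Bs i. scl D (vs.representation (Bs i) v \<beta>) \<beta>)"
        using vs.sum_representation_eq[OF Bs(3) _ Bs(1) subset_refl] v Bs(4) by metis
      then have "\<theta> i v = (\<Sum>\<beta>\<in>Bs i. scl D (vs.representation (Bs i) v \<beta>) (\<theta> i \<beta>))"
        using lin_on_sum[OF tensor_lin[OF g] sub Bs(1,2)] by metis
      then show ?thesis using True by simp
    next
      case False
      then have "v = 0" "V i = {0}" using v unfolding I_def by auto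
      then show ?thesis using False lin_on_zero[OF tensor_lin[OF g, of i]] by simp
    qed
    finally show "s \<cdot> \<theta> i v = idn D B \<cdot> \<theta> i v" using cmp_id_left[OF \<theta>v] by simp
  qed
  moreover obtain ns S c' w' where "built X ns S" "arr B S c'" "arr S B w'" "w' \<cdot> c' = s"
    using sum_factor_built[OF finK X B, of "\<lambda>k. - fst k" "\<lambda>k. c (fst k) (snd k)"
        "\<lambda>k. \<theta> (fst k) (snd k)"] c(1) \<theta> unfolding s_def by auto
  ultimately show ?thesis unfolding adm_def retract_def by blast
qed

text \<open>By finite type both tensor products have finitely many layers that are shifts of
  \<open>E\<close>, and so does the inner cone \<open>C\<close>. This gives the extension of
  \<open>C[1]\<close> by \<open>F\<close> behind the upper bound.\<close>

lemma P_twist_value_adm: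
  assumes ft: "finite_type D" and E: "E \<in> obj D" and F: "F \<in> obj D" and tw: "P_twist_value D E h F T"
  shows "\<exists>C. triangle C F T \<and> adm E C \<noteq> {}"
proof -
  let ?V = "\<lambda>i. hom D E (shO D i F)"
  obtain B' B \<theta>' \<theta> \<mu> C a b ev e e' where tw:
      "graded_tensor D ?V (shO D (- 2) E) B' \<theta>'" "graded_tensor D ?V E B \<theta>"
      "(B', B, C, \<mu>, a, b) \<in> tri D" "(C, F, T, ev, e, e') \<in> tri D"
    using tw unfolding P_twist_value_def by blast
  have V: "vs.subspace (?V i)" "fin_dim (scl D) (?V i)" "finite {i. ?V i \<noteq> {0}}" for i
    using ft E F hom_subspace shO_closed unfolding finite_type_def by auto
  have E2: "shO D (- 2) E \<in> obj D" using E shO_closed by blast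
  obtain ms where "ms \<in> adm (shO D (- 2) E) B'" using tensor_adm[OF tw(1) E2 V] by blast
  then have "adm E B' \<noteq> {}"
    using adm_compose[OF adm_shO[OF adm_self[OF E] E] _ E] by blast
  moreover have "adm E B \<noteq> {}" using tensor_adm[OF tw(2) E V] .
  ultimately have "adm E C \<noteq> {}" using adm_cone[OF _ _ _ E] tw(3) triangle_def by blast
  then show ?thesis using tw(4) triangle_def by blast
qed

lemma P_twist_value_orthogonal:
  assumes E: "E \<in> obj D" and F: "F \<in> right_orthogonal D E" and tw: "P_twist_value D E h F T"
  shows "iso F T"
proof -
  let ?V = "\<lambda>i. hom D E (shO D i F)"
  obtain B' B \<theta>' \<theta> \<mu> C a b ev e e' where tw:
      "graded_tensor D ?V (shO D (- 2) E) B' \<theta>'" "graded_tensor D ?V E B \<theta>"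
      "(B', B, C, \<mu>, a, b) \<in> tri D" "(C, F, T, ev, e, e') \<in> tri D"
    using tw unfolding P_twist_value_def by blast
  have V: "?V i = {0}" for i using F unfolding right_orthogonal_def by blast
  have "zero_obj D B'" "zero_obj D B"
    using tensor_zero[OF tw(1) _ V] tensor_zero[OF tw(2) E V] E shO_closed by blast+
  moreover have "triangle B C (shO D 1 B')" using tw(3) triangle_rotate triangle_def by blast
  ultimately have "zero_obj D C" using triangle_zero_iso zero_obj_shO zero_obj_iso iso_sym by blast
  moreover have "triangle F T (shO D 1 C)" using tw(4) triangle_rotate triangle_def by blast
  ultimately show ?thesis using triangle_zero_iso zero_obj_shO by blast
qed

end

section \<open>The truncated polynomial algebra and the value of the twist at
  \<open>E\<close>\<close>

lemma trunc_poly_even: "j \<le> d \<Longrightarrow> trunc_poly d (2 * int j) = range (\<lambda>c::'k::field. monom c j)"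
proof (intro set_eqI iffI)
  fix p :: "'k poly" assume p: "p \<in> trunc_poly d (2 * int j)"
  have "p = monom (coeff p j) j"
    using p by (intro poly_eqI) (auto simp: trunc_poly_def)
  then show "p \<in> range (\<lambda>c. monom c j)" by blast
next
  fix p :: "'k poly" assume "j \<le> d" "p \<in> range (\<lambda>c. monom c j)"
  then show "p \<in> trunc_poly d (2 * int j)"
    by (auto simp: trunc_poly_def split: if_splits intro: le_trans[OF degree_monom_le])
qed

lemma trunc_poly_other:
  assumes "\<And>j. j \<le> d \<Longrightarrow> n \<noteq> 2 * int j" shows "trunc_poly d n = {0 :: 'k::field poly}"
proof (intro set_eqI iffI)
  fix p :: "'k poly" assume p: "p \<in> trunc_poly d n"
  have "coeff p j = 0" for j
  proof (rule ccontr)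
    assume "coeff p j \<noteq> 0"
    then have "2 * int j = n" "j \<le> d"
      using p le_degree[of p j] by (auto simp: trunc_poly_def)
    then show False using assms by metis
  qed
  then show "p \<in> {0}" by (simp add: poly_eq_iff)
qed (simp add: trunc_poly_def)

lemma monom_mod_monom:
  "monom (1::'k::field) i mod monom 1 (Suc d) = (if i \<le> d then monom 1 i else 0)"
proof (cases "i \<le> d")
  case True
  then show ?thesis by (simp add: mod_poly_less degree_monom_eq)
next
  case False
  then have "monom (1::'k) i = monom 1 (Suc d) * monom 1 (i - Suc d)"
    by (simp add: mult_monom)
  then show ?thesis using False by simp
qed

locale P_algebra = triangulated_category +
  fixes d E \<phi>
  assumes E_obj: "E \<in> obj D" and P_iso: "P_algebra_iso D d E \<phi>" and d_pos: "0 < d"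
begin

text \<open>The \<open>j\<close>-th power of \<open>h\<close> in the endomorphism algebra of
  \<open>E\<close>. The value \<open>0\<close> beyond \<open>d\<close> reflects
  \<open>h^(d+1) = 0\<close> and makes the recursions below valid for every
  \<open>j\<close>.\<close>

definition h_pow where
  "h_pow j = (if j \<le> d then \<phi> (2 * int j) (monom 1 j) else 0)"

lemma phi_bij: "bij_betw (\<phi> n) (trunc_poly d n) (hom D E (shO D n E))"
  and phi_lin: "lin_on smult (scl D) (trunc_poly d n) (\<phi> n)"
  and phi_one: "\<phi> 0 1 = idn D E"
  and phi_mult: "\<lbrakk>p \<in> trunc_poly d m; q \<in> trunc_poly d n\<rbrakk>
    \<Longrightarrow> \<phi> (m + n) (p * q mod monom 1 (Suc d)) = shM D n (\<phi> m p) \<cdot> \<phi> n q"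
  using P_iso unfolding P_algebra_iso_def by blast+

lemma phi_smult: "p \<in> trunc_poly d n \<Longrightarrow> \<phi> n (smult c p) = scl D c (\<phi> n p)"
  using phi_lin unfolding lin_on_def by blast

lemma phi_zero: "\<phi> n 0 = 0"
  using phi_smult[of 0 n 0] by (simp add: trunc_poly_def)

lemma monom_trunc: "j \<le> d \<Longrightarrow> monom c j \<in> trunc_poly d (2 * int j)"
  by (simp add: trunc_poly_even)

lemma h_pow_arr: "arr E (shO D (2 * int j) E) (h_pow j)"
proof (cases "j \<le> d")
  case True
  then show ?thesis
    using bspec[OF bij_betwE[OF phi_bij] monom_trunc[OF True]] E_obj shO_closed
    by (simp add: h_pow_def arr_def)
qed (simp add: h_pow_def arr_zero E_obj shO_closed)

lemma h_pow_0: "h_pow 0 = idn D E"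
  using phi_one by (simp add: h_pow_def monom_0 one_pCons[symmetric])

lemma h_pow_beyond: "d < j \<Longrightarrow> h_pow j = 0"
  by (simp add: h_pow_def)

lemma h_pow_nonzero: assumes "j \<le> d" shows "h_pow j \<noteq> 0"
proof
  assume "h_pow j = 0"
  then have "\<phi> (2 * int j) (monom 1 j) = \<phi> (2 * int j) 0" using assms by (simp add: h_pow_def phi_zero)
  moreover have "inj_on (\<phi> (2 * int j)) (trunc_poly d (2 * int j))"
    using phi_bij bij_betw_imp_inj_on by blast
  moreover have "(0 :: 'a poly) \<in> trunc_poly d (2 * int j)" by (simp add: trunc_poly_def)
  ultimately have "monom (1 :: 'a) j = 0" using monom_trunc[OF assms] inj_onD by metis
  then show False by simp
qed

lemma h_pow_span: assumes "j \<le> d" "v \<in> hom D E (shO D (2 * int j) E)" shows "\<exists>c. v = scl D c (h_pow j)"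
proof -
  have "v \<in> \<phi> (2 * int j) ` trunc_poly d (2 * int j)"
    using bij_betw_imp_surj_on[OF phi_bij] assms(2) by simp
  then obtain c where "v = \<phi> (2 * int j) (monom c j)"
    by (auto simp: trunc_poly_even[OF assms(1)])
  also have "monom c j = smult c (monom 1 j)" by (simp add: smult_monom)
  finally show ?thesis using phi_smult[OF monom_trunc[OF assms(1)]] assms(1) by (auto simp: h_pow_def)
qed

lemma hom_other: assumes "\<And>j. j \<le> d \<Longrightarrow> n \<noteq> 2 * int j" shows "hom D E (shO D n E) = {0}"
proof -
  have "hom D E (shO D n E) = \<phi> n ` {0}"
    using bij_betw_imp_surj_on[OF phi_bij, of n] by (simp add: trunc_poly_other[OF assms])
  then show ?thesis by (simp add: phi_zero)
qed

lemma h_pow_Suc_right: "h_pow (Suc j) = shM D 2 (h_pow j) \<cdot> h_pow 1"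
proof (cases "j \<le> d")
  case True
  have 1: "monom 1 1 \<in> trunc_poly d 2" using monom_trunc[of 1] d_pos by simp
  have "shM D 2 (h_pow j) \<cdot> h_pow 1 = \<phi> (2 * int j + 2) (monom 1 j * monom 1 1 mod monom 1 (Suc d))"
    using phi_mult[OF monom_trunc[OF True] 1] True d_pos by (simp add: h_pow_def)
  also have "\<dots> = h_pow (Suc j)"
    by (simp add: mult_monom monom_mod_monom h_pow_def phi_zero add.commute)
  finally show ?thesis by simp
next
  case False
  then show ?thesis
    using zero_cmp[OF h_pow_arr[of 1]] shM_zero E_obj shO_closed by (simp add: h_pow_def)
qed

text \<open>Precomposing and postcomposing with \<open>h\<close> give the same power because the
  polynomial algebra is commutative. Having both forms is what makes the sums for
  \<open>h\<^sup>* - h\<close> telescope.\<close>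

lemma h_pow_Suc_left: "h_pow (Suc j) = shM D (2 * int j) (h_pow 1) \<cdot> h_pow j"
proof (cases "j \<le> d")
  case True
  have 1: "monom 1 1 \<in> trunc_poly d 2" using monom_trunc[of 1] d_pos by simp
  have "shM D (2 * int j) (h_pow 1) \<cdot> h_pow j = \<phi> (2 + 2 * int j) (monom 1 1 * monom 1 j mod monom 1 (Suc d))"
    using phi_mult[OF 1 monom_trunc[OF True]] True d_pos by (simp add: h_pow_def)
  also have "\<dots> = h_pow (Suc j)"
    by (simp add: mult_monom monom_mod_monom h_pow_def phi_zero)
  finally show ?thesis by simp
next
  case False
  then show ?thesis
    using cmp_zero[OF arr_shM[OF h_pow_arr[of 1]]] E_obj by (simp add: h_pow_def)
qed

text \<open>The power \<open>h^m\<close> as an arrow \<open>E[l] \<rightarrow> E[l + 2m]\<close>,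
  needed in all shifts because the summands of the tensor products are shifts of
  \<open>E\<close>.\<close>

definition h_arrow :: "int \<Rightarrow> nat \<Rightarrow> 'c" where
  "h_arrow l m = shM D l (h_pow m)"

lemma h_arrow_arr: "k = l + 2 * int m \<Longrightarrow> arr (shO D l E) (shO D k E) (h_arrow l m)"
  using arr_shM[OF h_pow_arr, of l m] E_obj by (simp add: h_arrow_def shO_shO)

lemma h_arrow_0: "h_arrow l 0 = idn D (shO D l E)"
  by (simp add: h_arrow_def h_pow_0 shM_idn E_obj)

lemma h_arrow_beyond: "d < m \<Longrightarrow> h_arrow l m = 0"
  by (simp add: h_arrow_def h_pow_beyond shM_zero[OF E_obj E_obj])

lemma h_arrow_Suc_right: "h_arrow (l + 2) m \<cdot> h_arrow l 1 = h_arrow l (Suc m)"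
proof -
  note 2 = arr_shM[OF h_pow_arr[of m], of 2]
  have "h_arrow l (Suc m) = shM D l (shM D 2 (h_pow m)) \<cdot> shM D l (h_pow 1)"
    unfolding h_arrow_def h_pow_Suc_right using shM_compose[OF 2, of E "h_pow 1" l] h_pow_arr[of 1] by simp
  then show ?thesis using shM_shM[OF h_pow_arr] by (simp add: h_arrow_def)
qed

lemma h_arrow_Suc_left: "k = l + 2 * int m \<Longrightarrow> h_arrow k 1 \<cdot> h_arrow l m = h_arrow l (Suc m)"
proof -
  assume k: "k = l + 2 * int m"
  have 1: "arr (shO D (2 * int m) E) (shO D (2 * int m) (shO D 2 E)) (shM D (2 * int m) (h_pow 1))"
    using arr_shM[OF h_pow_arr[of 1]] by simp
  have "h_arrow l (Suc m) = shM D l (shM D (2 * int m) (h_pow 1)) \<cdot> shM D l (h_pow m)"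
    unfolding h_arrow_def h_pow_Suc_left using shM_compose[OF 1 h_pow_arr] .
  then show ?thesis using shM_shM[OF h_pow_arr] k by (simp add: h_arrow_def)
qed

text \<open>The part of degree \<open>2j\<close> is spanned by \<open>h^j\<close> for
  \<open>j \<le> d\<close> and all other parts vanish, so the tensor product is a direct sum of
  copies \<open>X[-2j]\<close> and the values on the \<open>h^j\<close> are free.\<close>

lemma tensor_map_E:
  assumes g: "graded_tensor D (\<lambda>i. hom D E (shO D i E)) X B \<theta>" and X: "X \<in> obj D"
    and Y: "Y \<in> obj D" and y: "\<And>j. j \<le> d \<Longrightarrow> arr (shO D (- 2 * int j) X) Y (y j)"
  shows "\<exists>b. arr B Y b \<and> (\<forall>j\<le>d. b \<cdot> \<theta> (2 * int j) (h_pow j) = y j)"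
proof -
  let ?V = "\<lambda>i. hom D E (shO D i E)"
  \<comment> \<open>The coordinate of \<open>v\<close> with respect to \<open>h^j\<close>, unique
    because \<open>h^j\<close> is nonzero for \<open>j \<le> d\<close>.\<close>
  define cf where "cf j v = (THE c. v = scl D c (h_pow j))" for j v
  have cf: "cf j (scl D c (h_pow j)) = c" if "j \<le> d" for j c
    unfolding cf_def using h_pow_nonzero[OF that] by (intro the_equality) (auto simp: vs.scale_cancel_right)
  define \<chi> where "\<chi> i v = (if \<exists>j\<le>d. i = 2 * int j
    then scl D (cf (nat (i div 2)) v) (y (nat (i div 2))) else 0)" for i v
  have \<chi>: "\<chi> (2 * int j) v = scl D (cf j v) (y j)" if "j \<le> d" for j v
    unfolding \<chi>_def using that by auto
  have \<chi>0: "\<chi> i = (\<lambda>v. 0)" if "\<not> (\<exists>j\<le>d. i = 2 * int j)" for i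
    unfolding \<chi>_def if_not_P[OF that] ..
  have "\<exists>b. arr B Y b \<and> (\<forall>i. \<forall>v\<in>?V i. b \<cdot> \<theta> i v = \<chi> i v)"
  proof (rule tensor_map[OF g Y])
    fix i
    show "arr (shO D (- i) X) Y (\<chi> i v)" for v
    proof (cases "\<exists>j\<le>d. i = 2 * int j")
      case True
      then obtain j where j: "j \<le> d" "i = 2 * int j" by blast
      then show ?thesis using \<chi> arr_scl[OF y[OF j(1)]] by simp
    next
      case False
      then show ?thesis using arr_zero X Y shO_closed by (simp add: \<chi>0)
    qed
    show "lin_on (scl D) (scl D) (?V i) (\<chi> i)"
    proof (cases "\<exists>j\<le>d. i = 2 * int j")
      case True
      then obtain j where j: "j \<le> d" "i = 2 * int j" by blast
      have "\<chi> i (v + w) = \<chi> i v + \<chi> i w" if vw: "v \<in> ?V i" "w \<in> ?V i" for v w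
      proof -
        obtain c e where "v = scl D c (h_pow j)" "w = scl D e (h_pow j)"
          using h_pow_span[OF j(1)] vw j(2) by metis
        then show ?thesis using j \<chi>[OF j(1)] cf[OF j(1)]
          by (simp add: vs.scale_left_distrib[symmetric])
      qed
      moreover have "\<chi> i (scl D c v) = scl D c (\<chi> i v)" if v: "v \<in> ?V i" for c v
      proof -
        obtain e where "v = scl D e (h_pow j)"
          using h_pow_span[OF j(1)] v j(2) by metis
        then show ?thesis using j \<chi>[OF j(1)] cf[OF j(1)] by simp
      qed
      ultimately show ?thesis unfolding lin_on_def by blast
    next
      case False
      then show ?thesis by (simp add: \<chi>0 lin_on_def)
    qed
  qed
  then obtain b where b: "arr B Y b" "\<And>i v. v \<in> ?V i \<Longrightarrow> b \<cdot> \<theta> i v = \<chi> i v" by blast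
  have "b \<cdot> \<theta> (2 * int j) (h_pow j) = y j" if "j \<le> d" for j
    using b(2)[OF arr_hom[OF h_pow_arr]] \<chi>[OF that] cf[OF that, of 1] by simp
  then show ?thesis using b(1) by blast
qed

lemma tensor_eqI_E:
  assumes g: "graded_tensor D (\<lambda>i. hom D E (shO D i E)) X B \<theta>" and X: "X \<in> obj D"
    and b: "arr B Y b" and b': "arr B Y b'"
    and eq: "\<And>j. j \<le> d \<Longrightarrow> b \<cdot> \<theta> (2 * int j) (h_pow j) = b' \<cdot> \<theta> (2 * int j) (h_pow j)"
  shows "b = b'"
proof (rule tensor_eqI[OF g X b b'])
  fix i v assume v: "v \<in> hom D E (shO D i E)"
  have lin: "\<theta> i (scl D c w) = scl D c (\<theta> i w)" if "w \<in> hom D E (shO D i E)" for c w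
    using tensor_lin[OF g, of i] that unfolding lin_on_def by simp
  obtain c w where w: "v = scl D c w" "w \<in> hom D E (shO D i E)" "b \<cdot> \<theta> i w = b' \<cdot> \<theta> i w"
  proof (cases "\<exists>j\<le>d. i = 2 * int j")
    case True
    then obtain j where j: "j \<le> d" "i = 2 * int j" by blast
    then show ?thesis using h_pow_span[OF j(1)] v arr_hom[OF h_pow_arr] eq that by blast
  next
    case False
    then have V: "hom D E (shO D i E) = {0}" using hom_other by blast
    then have "\<theta> i 0 = 0" using lin[of 0 0] by simp
    then have "b \<cdot> \<theta> i 0 = b' \<cdot> \<theta> i 0"
      using cmp_zero[OF b, of X] cmp_zero[OF b', of X] X by simp
    then show ?thesis using that[of 1 v] V v by simp
  qed
  note \<theta>w = tensor_arr[OF g X w(2)]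
  show "b \<cdot> \<theta> i v = b' \<cdot> \<theta> i v"
    using w lin[OF w(2)] cmp_scl[OF b \<theta>w] cmp_scl[OF b' \<theta>w] by simp
qed

text \<open>The maps \<open>\<rho>\<close>, \<open>\<kappa>\<close> and \<open>\<pi>\<close> below contract
  \<open>\<mu> : Hom\<^sup>*(E,E) \<otimes> E[-2] \<rightarrow> Hom\<^sup>*(E,E) \<otimes> E\<close> onto its kernel \<open>E[-2d-2]\<close> and its cokernel \<open>E\<close>:
  as \<open>h\<^sup>* - h\<close> divides \<open>(h\<^sup>*)\<^sup>j - h\<^sup>j\<close>, the sums \<open>R j = \<Sum>\<^sub>k (h\<^sup>*)\<^sup>k h\<^bsup>j-1-k\<^esup>\<close> invert \<open>\<mu>\<close> up to
  \<open>h\<^sup>j\<close>.\<close>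

lemma P_twist_value_E:
  assumes tw: "P_twist_value D E (h_pow 1) E T"
  shows "iso T (shO D (- 2 * int d) E)"
proof -
  let ?V = "\<lambda>i. hom D E (shO D i E)"
  obtain B' B \<theta>' \<theta> \<mu> C a b ev e e' where g': "graded_tensor D ?V (shO D (- 2) E) B' \<theta>'"
      and g: "graded_tensor D ?V E B \<theta>"
      and \<mu>\<theta>: "\<And>i v. v \<in> ?V i \<Longrightarrow>
         \<mu> \<cdot> \<theta>' i v = \<theta> (i + 2) (shM D 2 v \<cdot> h_pow 1) - \<theta> i v \<cdot> shM D (- i - 2) (h_pow 1)"
      and t: "(B', B, C, \<mu>, a, b) \<in> tri D"
      and ev\<theta>: "\<And>i v. v \<in> ?V i \<Longrightarrow> ev \<cdot> (a \<cdot> \<theta> i v) = shM D (- i) v"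
      and t': "(C, E, T, ev, e, e') \<in> tri D"
    using tw unfolding P_twist_value_def by blast
  note a = triD(2)[OF t] and \<mu> = triD(1)[OF t] and ev = triD(1)[OF t']
  have E2: "shO D (- 2) E \<in> obj D" using shO_closed E_obj by blast
  have neg_Suc: "- 2 * int (Suc k) = - 2 * int k - 2" for k by simp
  have B: "B \<in> obj D" and B': "B' \<in> obj D" using tensor_obj g g' by blast+
  \<comment> \<open>The inclusions of the summands belonging to \<open>h^j\<close>:
    \<open>E[-2j]\<close> in \<open>B\<close>, and in the next line \<open>E[-2j-2]\<close> in
    \<open>B'\<close>, for \<open>j \<le> d\<close>.\<close>
  define \<Theta> where "\<Theta> j = \<theta> (2 * int j) (h_pow j)" for j
  define \<Theta>' where "\<Theta>' j = \<theta>' (2 * int j) (h_pow j)" for j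
  have \<Theta>: "arr (shO D (- 2 * int j) E) B (\<Theta> j)" for j
    unfolding \<Theta>_def using tensor_arr[OF g E_obj arr_hom[OF h_pow_arr]] by simp
  have \<Theta>': "arr (shO D (- 2 * int j - 2) E) B' (\<Theta>' j)" for j
    unfolding \<Theta>'_def using tensor_arr[OF g' E2 arr_hom[OF h_pow_arr], of j] E_obj by (simp add: shO_shO)
  have \<Theta>_top: "\<Theta> (Suc d) = 0"
    unfolding \<Theta>_def using lin_on_zero[OF tensor_lin[OF g]] arr_hom[OF h_pow_arr] h_pow_beyond
    by (metis lessI)
  \<comment> \<open>In these coordinates \<open>\<mu>\<close> is bidiagonal: one entry raises
    \<open>j\<close> by one, the other is \<open>- h\<close>. At \<open>j = d\<close> the first
    entry is zero by \<open>\<Theta>_top\<close>.\<close>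
  have \<mu>\<Theta>: "\<mu> \<cdot> \<Theta>' j = \<Theta> (Suc j) - \<Theta> j \<cdot> h_arrow (- 2 * int j - 2) 1" for j
    unfolding \<Theta>'_def \<Theta>_def h_arrow_def using \<mu>\<theta>[OF arr_hom[OF h_pow_arr], of j] h_pow_Suc_right[of j]
    by (simp add: algebra_simps)
  have ev\<Theta>: "(ev \<cdot> a) \<cdot> \<Theta> j = h_arrow (- 2 * int j) j" for j
    using assoc[OF ev a \<Theta>, of j] ev\<theta>[OF arr_hom[OF h_pow_arr], of j] by (simp add: \<Theta>_def h_arrow_def)
  have \<Theta>0: "arr E B (\<Theta> 0)" using \<Theta>[of 0] shO_0 E_obj by simp
  note eva = arr_cmp[OF ev a]
  define R where "R j = (\<Sum>k<j. \<Theta>' k \<cdot> h_arrow (- 2 * int j) (j - 1 - k))" for j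
  have HR: "arr (shO D (- 2 * int j) E) (shO D (- 2 * int k - 2) E) (h_arrow (- 2 * int j) (j - 1 - k))"
    if "k < j" for k j using that by (intro h_arrow_arr) (simp add: of_nat_diff)
  have RT: "arr (shO D (- 2 * int j) E) B' (\<Theta>' k \<cdot> h_arrow (- 2 * int j) (j - 1 - k))" if "k < j" for k j
    using arr_cmp[OF \<Theta>' HR[OF that]] .
  have R: "arr (shO D (- 2 * int j) E) B' (R j)" for j
    unfolding R_def using RT by (intro arr_sum shO_closed E_obj B') simp
  \<comment> \<open>A telescoping sum, the analogue of
    \<open>(x - y) (\<Sum> x^k y^(j-1-k)) = x^j - y^j\<close>, where \<open>x\<close> raises the
    index of \<open>\<Theta>\<close> and \<open>y\<close> is composition with
    \<open>h\<close>.\<close>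
  have \<mu>R: "\<mu> \<cdot> R j = \<Theta> j - \<Theta> 0 \<cdot> h_arrow (- 2 * int j) j" for j
  proof -
    define f where "f k = \<Theta> k \<cdot> h_arrow (- 2 * int j) (j - k)" for k
    have "\<mu> \<cdot> R j = (\<Sum>k<j. \<mu> \<cdot> (\<Theta>' k \<cdot> h_arrow (- 2 * int j) (j - 1 - k)))"
      unfolding R_def by (intro cmp_sum[OF \<mu> shO_closed[OF E_obj, of "- 2 * int j"]] RT) simp
    also have "\<dots> = (\<Sum>k<j. f (Suc k) - f k)"
    proof (rule sum.cong[OF refl])
      fix k assume "k \<in> {..<j}"
      then have k: "k < j" by simp
      then obtain l where l: "j - 1 - k = l" "j - k = Suc l" "j - Suc k = l" "j = Suc (k + l)"
        using less_iff_Suc_add by auto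
      note h = HR[OF k]
      have H1: "arr (shO D (- 2 * int k - 2) E) (shO D (- 2 * int k) E) (h_arrow (- 2 * int k - 2) 1)"
        by (intro h_arrow_arr) simp
      have \<Theta>S: "arr (shO D (- 2 * int k - 2) E) B (\<Theta> (Suc k))"
        using \<Theta>[of "Suc k"] unfolding neg_Suc .
      have "\<mu> \<cdot> (\<Theta>' k \<cdot> h_arrow (- 2 * int j) (j - 1 - k)) = (\<mu> \<cdot> \<Theta>' k) \<cdot> h_arrow (- 2 * int j) (j - 1 - k)"
        using assoc[OF \<mu> \<Theta>' h] by simp
      also have "\<dots> = \<Theta> (Suc k) \<cdot> h_arrow (- 2 * int j) (j - 1 - k)
          - \<Theta> k \<cdot> (h_arrow (- 2 * int k - 2) 1 \<cdot> h_arrow (- 2 * int j) (j - 1 - k))"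
        unfolding \<mu>\<Theta> using diff_cmp[OF \<Theta>S arr_cmp[OF \<Theta> H1] h] assoc[OF \<Theta> H1 h] by simp
      also have "h_arrow (- 2 * int k - 2) 1 \<cdot> h_arrow (- 2 * int j) (j - 1 - k) = h_arrow (- 2 * int j) (j - k)"
        unfolding l(1,2) by (rule h_arrow_Suc_left) (simp add: l(4))
      finally show "\<mu> \<cdot> (\<Theta>' k \<cdot> h_arrow (- 2 * int j) (j - 1 - k)) = f (Suc k) - f k"
        unfolding f_def l by simp
    qed
    also have "\<dots> = f j - f 0" by (rule sum_lessThan_telescope)
    also have "f j = \<Theta> j" unfolding f_def using h_arrow_0 cmp_id_right[OF \<Theta>] by simp
    finally show ?thesis by (simp add: f_def)
  qed
  \<comment> \<open>This recursion yields both \<open>\<pi> \<cdot> \<kappa> = 1\<close> and the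
    contraction identity on \<open>B'\<close>.\<close>
  have RS: "R (Suc j) = \<Theta>' j + R j \<cdot> h_arrow (- 2 * int j - 2) 1" for j
  proof -
    have h: "arr (shO D (- 2 * int j - 2) E) (shO D (- 2 * int j) E) (h_arrow (- 2 * int j - 2) 1)"
      by (intro h_arrow_arr) simp
    have "R j \<cdot> h_arrow (- 2 * int j - 2) 1
        = (\<Sum>k<j. (\<Theta>' k \<cdot> h_arrow (- 2 * int j) (j - 1 - k)) \<cdot> h_arrow (- 2 * int j - 2) 1)"
      unfolding R_def by (intro sum_cmp[OF h B'] RT) simp
    also have "\<dots> = (\<Sum>k<j. \<Theta>' k \<cdot> h_arrow (- 2 * int (Suc j)) (Suc j - 1 - k))"
    proof (rule sum.cong[OF refl])
      fix k assume "k \<in> {..<j}"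
      then have k: "k < j" by simp
      then obtain l where l: "j - 1 - k = l" "Suc j - 1 - k = Suc l"
        using less_iff_Suc_add by auto
      have "h_arrow (- 2 * int j) l \<cdot> h_arrow (- 2 * int j - 2) 1 = h_arrow (- 2 * int j - 2) (Suc l)"
        using h_arrow_Suc_right[of "- 2 * int j - 2" l] by simp
      then show "(\<Theta>' k \<cdot> h_arrow (- 2 * int j) (j - 1 - k)) \<cdot> h_arrow (- 2 * int j - 2) 1
          = \<Theta>' k \<cdot> h_arrow (- 2 * int (Suc j)) (Suc j - 1 - k)"
        unfolding neg_Suc using assoc[OF \<Theta>' HR[OF k] h] unfolding l by simp
    qed
    moreover have "\<Theta>' j \<cdot> h_arrow (- 2 * int (Suc j)) 0 = \<Theta>' j"
      unfolding neg_Suc h_arrow_0 by (rule cmp_id_right[OF \<Theta>'])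
    ultimately show ?thesis unfolding R_def[of "Suc j"] by (simp add: add.commute)
  qed
  obtain \<rho> where \<rho>: "arr B B' \<rho>" "\<And>j. j \<le> d \<Longrightarrow> \<rho> \<cdot> \<Theta> j = R j"
    using tensor_map_E[OF g E_obj B', of R] R unfolding \<Theta>_def by blast
  define Q where "Q = shO D (- 2 * int (Suc d)) E"
  have Q: "Q \<in> obj D" unfolding Q_def using shO_closed E_obj by blast
  \<comment> \<open>The sum one step beyond the range: \<open>\<mu> \<cdot> R (d + 1)\<close>
    vanishes because both \<open>\<Theta> (d + 1)\<close> and \<open>h^(d+1)\<close> do, so
    \<open>R (d + 1)\<close> embeds the kernel.\<close>
  define \<kappa> where "\<kappa> = R (Suc d)"
  have \<kappa>: "arr Q B' \<kappa>" unfolding \<kappa>_def Q_def by (rule R)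
  have "shO D (- 2 * int d) (shO D (- 2) E) = Q"
    unfolding Q_def neg_Suc using E_obj by (simp add: shO_shO)
  then have "arr (shO D (- 2 * int j) (shO D (- 2) E)) Q (if j = d then idn D Q else 0)" for j
    using arr_zero[OF shO_closed[OF E2] Q, of "- 2 * int j"] arr_idn[OF Q] by auto
  \<comment> \<open>Projection to the last summand of \<open>B'\<close>. It kills
    \<open>R d\<close>, in which only the indices \<open>k < d\<close> occur, and so is a retraction
    of \<open>\<kappa>\<close>.\<close>
  then obtain \<pi> where \<pi>: "arr B' Q \<pi>" "\<And>j. j \<le> d \<Longrightarrow> \<pi> \<cdot> \<Theta>' j = (if j = d then idn D Q else 0)"
    using tensor_map_E[OF g' E2 Q, of "\<lambda>j. if j = d then idn D Q else 0"] unfolding \<Theta>'_def by blast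
  have hd: "arr Q (shO D (- 2 * int d) E) (h_arrow (- 2 * int d - 2) 1)"
    unfolding Q_def neg_Suc by (intro h_arrow_arr) simp
  have "\<pi> \<cdot> R d = 0"
  proof -
    have "\<pi> \<cdot> R d = (\<Sum>k<d. \<pi> \<cdot> (\<Theta>' k \<cdot> h_arrow (- 2 * int d) (d - 1 - k)))"
      unfolding R_def by (intro cmp_sum[OF \<pi>(1) shO_closed[OF E_obj, of "- 2 * int d"]] RT) simp
    also have "\<dots> = (\<Sum>k<d. 0)"
    proof (rule sum.cong[OF refl])
      fix k assume "k \<in> {..<d}"
      then have k: "k < d" by simp
      then show "\<pi> \<cdot> (\<Theta>' k \<cdot> h_arrow (- 2 * int d) (d - 1 - k)) = 0"
        using assoc[OF \<pi>(1) \<Theta>' HR[OF k]] \<pi>(2)[of k] zero_cmp[OF HR[OF k] Q] by simp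
    qed
    finally show ?thesis by simp
  qed
  moreover have "arr Q B' (\<Theta>' d)" using \<Theta>'[of d] unfolding Q_def neg_Suc .
  ultimately have \<pi>\<kappa>: "\<pi> \<cdot> \<kappa> = idn D Q"
    unfolding \<kappa>_def RS
    using cmp_add[OF \<pi>(1) _ arr_cmp[OF R hd], of "\<Theta>' d"] \<pi>(2)[of d]
      assoc[OF \<pi>(1) R hd] zero_cmp[OF hd Q] by simp
  have \<mu>\<kappa>: "\<mu> \<cdot> \<kappa> = 0"
    unfolding \<kappa>_def \<mu>R using \<Theta>_top h_arrow_beyond[of "Suc d"] cmp_zero[OF \<Theta>0 E_obj] by simp
  have ev0: "(ev \<cdot> a) \<cdot> \<Theta> 0 = idn D E" using ev\<Theta>[of 0] h_arrow_0[of 0] shO_0[OF E_obj] by simp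
  note \<mu>\<rho> = arr_cmp[OF \<mu> \<rho>(1)] and \<Theta>ev = arr_cmp[OF \<Theta>0 eva]
  have contrB: "\<mu> \<cdot> \<rho> + \<Theta> 0 \<cdot> (ev \<cdot> a) = idn D B"
  proof (rule tensor_eqI_E[OF g E_obj arr_add[OF \<mu>\<rho> \<Theta>ev] arr_idn[OF B]])
    fix j assume j: "j \<le> d"
    have "(\<mu> \<cdot> \<rho> + \<Theta> 0 \<cdot> (ev \<cdot> a)) \<cdot> \<Theta> j = \<mu> \<cdot> R j + \<Theta> 0 \<cdot> h_arrow (- 2 * int j) j"
      using add_cmp[OF \<mu>\<rho> \<Theta>ev \<Theta>, of j] assoc[OF \<mu> \<rho>(1) \<Theta>, of j] assoc[OF \<Theta>0 eva \<Theta>, of j]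
        \<rho>(2)[OF j] ev\<Theta>[of j] by simp
    also have "\<dots> = idn D B \<cdot> \<Theta> j" using \<mu>R[of j] cmp_id_left[OF \<Theta>, of j] by simp
    finally show "(\<mu> \<cdot> \<rho> + \<Theta> 0 \<cdot> (ev \<cdot> a)) \<cdot> \<theta> (2 * int j) (h_pow j) = idn D B \<cdot> \<theta> (2 * int j) (h_pow j)"
      unfolding \<Theta>_def .
  qed
  note \<rho>\<mu> = arr_cmp[OF \<rho>(1) \<mu>] and \<kappa>\<pi> = arr_cmp[OF \<kappa> \<pi>(1)]
  have contrB': "\<rho> \<cdot> \<mu> + \<kappa> \<cdot> \<pi> = idn D B'"
  proof (rule tensor_eqI_E[OF g' E2 arr_add[OF \<rho>\<mu> \<kappa>\<pi>] arr_idn[OF B']])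
    fix j assume j: "j \<le> d"
    have h: "arr (shO D (- 2 * int j - 2) E) (shO D (- 2 * int j) E) (h_arrow (- 2 * int j - 2) 1)"
      by (intro h_arrow_arr) simp
    have \<Theta>S: "arr (shO D (- 2 * int j - 2) E) B (\<Theta> (Suc j))"
      using \<Theta>[of "Suc j"] unfolding neg_Suc .
    have "\<rho> \<cdot> (\<mu> \<cdot> \<Theta>' j) = \<rho> \<cdot> \<Theta> (Suc j) - (\<rho> \<cdot> \<Theta> j) \<cdot> h_arrow (- 2 * int j - 2) 1"
      unfolding \<mu>\<Theta> using cmp_diff[OF \<rho>(1) \<Theta>S arr_cmp[OF \<Theta> h]] assoc[OF \<rho>(1) \<Theta> h] by simp
    also have "\<dots> = \<rho> \<cdot> \<Theta> (Suc j) - R (Suc j) + \<Theta>' j"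
      unfolding \<rho>(2)[OF j] RS by simp
    finally have 1: "\<rho> \<cdot> (\<mu> \<cdot> \<Theta>' j) = \<rho> \<cdot> \<Theta> (Suc j) - R (Suc j) + \<Theta>' j" .
    have 2: "\<kappa> \<cdot> (\<pi> \<cdot> \<Theta>' j) = (if j = d then R (Suc d) else 0)"
      using \<pi>(2)[OF j] cmp_id_right[OF \<kappa>] cmp_zero[OF \<kappa> arr_dom[OF \<Theta>'[of j]]] by (simp add: \<kappa>_def)
    have 3: "\<rho> \<cdot> \<Theta> (Suc j) = (if j = d then 0 else R (Suc j))"
      using \<Theta>_top cmp_zero[OF \<rho>(1) E_obj] \<rho>(2)[of "Suc j"] j by auto
    \<comment> \<open>For \<open>j < d\<close> the two terms \<open>R (j + 1)\<close> cancel. For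
      \<open>j = d\<close> the positive one is missing, since \<open>\<Theta> (d + 1) = 0\<close>,
      and \<open>\<kappa> \<cdot> \<pi>\<close> supplies it.\<close>
    have "(\<rho> \<cdot> \<mu> + \<kappa> \<cdot> \<pi>) \<cdot> \<Theta>' j = \<Theta>' j"
      using add_cmp[OF \<rho>\<mu> \<kappa>\<pi> \<Theta>', of j] assoc[OF \<rho>(1) \<mu> \<Theta>', of j] assoc[OF \<kappa> \<pi>(1) \<Theta>', of j] 1 2 3
      by simp
    then show "(\<rho> \<cdot> \<mu> + \<kappa> \<cdot> \<pi>) \<cdot> \<theta>' (2 * int j) (h_pow j) = idn D B' \<cdot> \<theta>' (2 * int j) (h_pow j)"
      using cmp_id_left[OF \<Theta>', of j] unfolding \<Theta>'_def by simp
  qed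
  \<comment> \<open>Shifting by \<open>2d + 1\<close> turns \<open>Q[1]\<close> into
    \<open>E\<close>, so \<open>u\<close> becomes an element of odd degree of the graded
    endomorphisms of \<open>E\<close>.\<close>
  have noHom: "u = 0" if u: "arr (shO D 1 Q) E u" for u
  proof -
    let ?n = "2 * int d + 1"
    have "arr (shO D ?n (shO D 1 Q)) (shO D ?n E) (shM D ?n u)" using arr_shM[OF u] .
    then have "shM D ?n u \<in> hom D E (shO D ?n E)"
      using E_obj arr_hom unfolding Q_def by (simp add: shO_shO shO_0)
    moreover have "hom D E (shO D ?n E) = {0}" by (rule hom_other) presburger
    ultimately have "shM D ?n u = 0" by simp
    then have "u = shM D (- ?n) 0" using shM_inv(2)[OF u, of ?n] by simp
    then show "u = 0" using shM_zero[OF E_obj E_obj] by simp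
  qed
  have "iso T (shO D 2 Q)"
    using contracted_cone[OF t t' \<rho>(1) \<Theta>0 \<kappa> \<pi>(1) ev0 \<pi>\<kappa> \<mu>\<kappa> contrB contrB' noHom] by blast
  moreover have "shO D 2 Q = shO D (- 2 * int d) E" using E_obj by (simp add: Q_def shO_shO)
  ultimately show ?thesis by simp
qed

end

section \<open>Entropy\<close>

lemma bounded_over_n_tendsto_0:
  fixes f :: "nat \<Rightarrow> real"
  assumes "\<And>n. \<bar>f n\<bar> \<le> K" shows "(\<lambda>n. f n / real n) \<longlonglongrightarrow> 0"
proof (rule tendsto_0_le)
  show "(\<lambda>n. 1 / real n) \<longlonglongrightarrow> 0" by (rule lim_const_over_n)
  show "\<forall>\<^sub>F n in sequentially. norm (f n / real n) \<le> norm (1 / real n) * K"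
    using assms by (intro always_eventually allI) (simp add: divide_right_mono)
qed

text \<open>Fekete's lemma; the linear lower bound makes the infimum of \<open>u n / n\<close> a
  real number, and this infimum is the limit.\<close>

lemma subadditive_tendsto:
  fixes u :: "nat \<Rightarrow> real"
  assumes sub: "\<And>m n. u (m + n) \<le> u m + u n" and low: "\<And>n. c * real n \<le> u n"
  shows "\<exists>l. (\<lambda>n. u n / real n) \<longlonglongrightarrow> l"
proof -
  define l where "l = (INF n\<in>{1..}. u n / real n)"
  have bdd: "bdd_below ((\<lambda>n. u n / real n) ` {1..})"
    by (rule bdd_belowI2[of _ c]) (use low in \<open>simp add: pos_le_divide_eq\<close>)
  have "(\<lambda>n. u n / real n) \<longlonglongrightarrow> l"
  proof (rule order_tendstoI)
    fix a assume a: "a < l"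
    have "a < u n / real n" if "1 \<le> n" for n
      using a cINF_lower[OF bdd, of n] that unfolding l_def by simp
    then show "\<forall>\<^sub>F n in sequentially. a < u n / real n"
      using eventually_ge_at_top[of 1] by (rule eventually_mono[rotated])
  next
    fix a assume "l < a"
    then obtain m where m: "1 \<le> m" "u m / real m < a"
      unfolding l_def using cINF_less_iff[OF _ bdd, of a] by auto
    define M where "M = Max ((\<lambda>r. \<bar>u r\<bar>) ` {..<m})"
    have M: "\<bar>u r\<bar> \<le> M" if "r < m" for r unfolding M_def using that by (intro Max_ge) auto
    have mult: "u (q * m + r) \<le> real q * u m + u r" for q r
    proof (induction q)
      case (Suc q)
      have "u (Suc q * m + r) \<le> u m + u (q * m + r)"
        using sub[of m "q * m + r"] by (simp add: add.assoc)
      then show ?case using Suc by (simp add: algebra_simps)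
    qed simp
    \<comment> \<open>Division with remainder by a fixed \<open>m\<close>: the remainder and the
      rounding of \<open>n / m\<close> together contribute an error that does not depend on
      \<open>n\<close>.\<close>
    have le: "u n / real n \<le> u m / real m + (\<bar>u m\<bar> + M) / real n" if n: "1 \<le> n" for n
    proof -
      define q r where "q = n div m" and "r = n mod m"
      have nqr: "n = q * m + r" and r: "r < m" using m unfolding q_def r_def by auto
      have "real n = real q * real m + real r" using nqr by (metis of_nat_add of_nat_mult)
      then have q: "real q = (real n - real r) / real m" using m by (simp add: field_simps)
      have "real q * u m = real n * (u m / real m) - (real r / real m) * u m"
        unfolding q using m by (simp add: field_simps)
      moreover have "- ((real r / real m) * u m) \<le> \<bar>u m\<bar>"
      proof -
        have "\<bar>(real r / real m) * u m\<bar> \<le> 1 * \<bar>u m\<bar>"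
          unfolding abs_mult using r by (intro mult_right_mono) auto
        then show ?thesis by linarith
      qed
      ultimately have "u n \<le> real n * (u m / real m) + (\<bar>u m\<bar> + M)"
        using mult[of q r] M[OF r] nqr by simp
      then have "u n / real n \<le> (real n * (u m / real m) + (\<bar>u m\<bar> + M)) / real n"
        by (rule divide_right_mono) simp
      also have "\<dots> = u m / real m + (\<bar>u m\<bar> + M) / real n"
        using n by (simp add: add_divide_distrib)
      finally show ?thesis .
    qed
    have "(\<lambda>n. u m / real m + (\<bar>u m\<bar> + M) / real n) \<longlonglongrightarrow> u m / real m + 0"
      by (intro tendsto_add tendsto_const lim_const_over_n)
    then have "\<forall>\<^sub>F n in sequentially. u m / real m + (\<bar>u m\<bar> + M) / real n < a"
      using m by (intro order_tendstoD(2)) auto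
    then show "\<forall>\<^sub>F n in sequentially. u n / real n < a"
      using eventually_ge_at_top[of 1] by eventually_elim (use le in fastforce)
  qed
  then show ?thesis by blast
qed

lemma ln_le_add:
  fixes p q r :: real
  assumes "0 < p" "0 < q" "0 < r" "p \<le> q * r" shows "ln p \<le> ln q + ln r"
proof -
  have "ln p \<le> ln (q * r)" using assms by (subst ln_le_cancel_iff) auto
  also have "\<dots> = ln q + ln r" using assms by (intro ln_mult_pos)
  finally show ?thesis .
qed

lemma ext_ln_ereal: "0 < c \<Longrightarrow> ext_ln (ereal c) = ereal (ln c)"
  by (simp add: ext_ln_def)

context exact_endofunctor
begin

lemma iter_adm_gen:
  assumes "split_generator D G" "F \<in> obj D"
  shows "adm ((fob T ^^ n) G) ((fob T ^^ n) F) \<noteq> {}"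
  using iter_adm split_generator_adm[OF assms] assms(1) unfolding split_generator_def by blast

lemma generator_obj: "split_generator D G \<Longrightarrow> G \<in> obj D"
  unfolding split_generator_def by blast

lemma generator_nonzero:
  assumes "split_generator D G" "X \<in> obj D" "\<not> zero_obj D X" shows "\<not> zero_obj D G"
proof
  assume "zero_obj D G"
  then have "zero_obj D (shO D m G)" for m by (rule zero_obj_shO)
  then show False using split_generator_hom[OF assms] zero_objD(3) by blast
qed

text \<open>The object \<open>T^m G\<close> is inserted in the middle; relative to it
  \<open>T^m (T^n G)\<close> costs no more than \<open>T^n G\<close> does relative to
  \<open>G\<close>.\<close>

lemma cx_iter_submult:
  assumes "split_generator D G"
  shows "cx t G ((fob T ^^ (m + n)) G) \<le> cx t G ((fob T ^^ m) G) * cx t G ((fob T ^^ n) G)"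
proof -
  note G = generator_obj[OF assms] and a = split_generator_adm[OF assms]
  have "cx t G ((fob T ^^ m) ((fob T ^^ n) G))
      \<le> cx t G ((fob T ^^ m) G) * cx t ((fob T ^^ m) G) ((fob T ^^ m) ((fob T ^^ n) G))"
    using cx_compose[OF G a iter_adm_gen[OF assms]] iter_obj G by blast
  also have "\<dots> \<le> cx t G ((fob T ^^ m) G) * cx t G ((fob T ^^ n) G)"
    using cx_iter_le[OF G a] cx_nonneg[OF a] iter_obj G by (intro mult_left_mono) auto
  finally show ?thesis by (simp add: funpow_add)
qed

text \<open>Here \<open>T^n G\<close> and \<open>G\<close> are inserted. The first two factors do
  not depend on \<open>n\<close>, so they do not affect the exponential growth rate.\<close>

lemma cx_iter_change_generator:
  assumes "split_generator D G" "split_generator D G'"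
  shows "cx t G' ((fob T ^^ n) G') \<le> cx t G' G * cx t G G' * cx t G ((fob T ^^ n) G)"
proof -
  note G = generator_obj[OF assms(1)] and a = split_generator_adm[OF assms(1)]
  note G' = generator_obj[OF assms(2)] and a' = split_generator_adm[OF assms(2)]
  have "cx t G' ((fob T ^^ n) G')
      \<le> cx t G' ((fob T ^^ n) G) * cx t ((fob T ^^ n) G) ((fob T ^^ n) G')"
    using cx_compose[OF G' a' iter_adm_gen[OF assms(1) G']] iter_obj G by blast
  also have "\<dots> \<le> (cx t G' G * cx t G ((fob T ^^ n) G)) * cx t G G'"
    using cx_compose[OF G' a'[OF G] a] cx_iter_le[OF G a[OF G']] cx_nonneg a a' G G' iter_obj
      cx_nonneg[OF iter_adm_gen[OF assms(1) G']]
    by (intro mult_mono mult_nonneg_nonneg) auto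
  finally show ?thesis by (simp add: mult_ac)
qed

text \<open>\<open>entropy\<close> is a definite description over all split-generators, so
  convergence to one value is needed for each of them. The linear bound is required for
  \<open>G\<close> only: logarithms for another generator differ by a constant independent of
  \<open>n\<close>.\<close>

lemma entropy_limit:
  assumes ft: "finite_type D" and G: "split_generator D G"
    and nz: "\<And>n X. split_generator D X \<Longrightarrow> \<not> zero_obj D ((fob T ^^ n) X)"
    and low: "\<And>n. c * real n \<le> ln (cx t G ((fob T ^^ n) G))"
  shows "\<exists>l. entropy D t T = ereal l \<and> (\<lambda>n. ln (cx t G ((fob T ^^ n) G)) / real n) \<longlonglongrightarrow> l"
proof -
  define u where "u X n = ln (cx t X ((fob T ^^ n) X))" for X n
  have pos: "0 < cx t X ((fob T ^^ n) Y)" if "split_generator D X" "split_generator D Y" for X Y n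
    using cx_pos[OF ft that(1) iter_obj[OF generator_obj[OF that(2)]] nz[OF that(2)]] .
  have pos0: "0 < cx t X Y" if "split_generator D X" "split_generator D Y" for X Y
    using pos[OF that, of 0] by simp
  have "u G (m + n) \<le> u G m + u G n" for m n
    unfolding u_def using cx_iter_submult[OF G, of t m n] by (intro ln_le_add pos G)
  then obtain l where l: "(\<lambda>n. u G n / real n) \<longlonglongrightarrow> l"
    using subadditive_tendsto[of "u G" c] low unfolding u_def by blast
  have le: "u Y n \<le> ln (cx t Y X * cx t X Y) + u X n"
    if "split_generator D X" "split_generator D Y" for X Y n
    unfolding u_def using cx_iter_change_generator[OF that, of t n]
    by (intro ln_le_add mult_pos_pos pos pos0 that)
  have lim: "(\<lambda>n. ext_ln (complexity D t X ((fob T ^^ n) X)) / ereal (real n)) \<longlonglongrightarrow> ereal l"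
    if X: "split_generator D X" for X
  proof -
    define K where "K = \<bar>ln (cx t X G * cx t G X)\<bar>"
    have K: "\<bar>u X n - u G n\<bar> \<le> K" for n
      using le[OF G X, of n] le[OF X G, of n] unfolding K_def by (simp add: mult.commute)
    then have "(\<lambda>n. u G n / real n + (u X n - u G n) / real n) \<longlonglongrightarrow> l + 0"
      by (intro tendsto_add l bounded_over_n_tendsto_0[OF K])
    then have "(\<lambda>n. ereal (u X n / real n)) \<longlonglongrightarrow> ereal l"
      by (simp add: add_divide_distrib[symmetric])
    \<comment> \<open>The index \<open>n = 0\<close> is left out, as division by zero in
      \<open>ereal\<close> need not agree with the real convention.\<close>
    moreover have "ereal (u X n / real n) = ext_ln (complexity D t X ((fob T ^^ n) X)) / ereal (real n)"
      if "1 \<le> n" for n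
    proof -
      have "(fob T ^^ n) X \<in> obj D" using iter_obj generator_obj[OF X] by blast
      then have "ext_ln (complexity D t X ((fob T ^^ n) X)) = ereal (u X n)"
        using complexity_eq_cx split_generator_adm[OF X] ext_ln_ereal[OF pos[OF X X]]
        unfolding u_def by simp
      then show ?thesis using that by simp
    qed
    then have "\<forall>\<^sub>F n in sequentially. ereal (u X n / real n)
        = ext_ln (complexity D t X ((fob T ^^ n) X)) / ereal (real n)"
      using eventually_ge_at_top[of 1] by (rule eventually_mono[rotated])
    ultimately show ?thesis by (rule Lim_transform_eventually)
  qed
  have "entropy D t T = ereal l"
    unfolding entropy_def
  proof (rule the_equality)
    show "\<forall>G. split_generator D G \<longrightarrow>
        (\<lambda>n. ext_ln (complexity D t G ((fob T ^^ n) G)) / ereal (real n)) \<longlonglongrightarrow> ereal l"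
      using lim by blast
    show "l' = ereal l" if "\<forall>G. split_generator D G \<longrightarrow>
        (\<lambda>n. ext_ln (complexity D t G ((fob T ^^ n) G)) / ereal (real n)) \<longlonglongrightarrow> l'" for l'
      using that lim[OF G] G LIMSEQ_unique by blast
  qed
  then show ?thesis using l unfolding u_def by blast
qed

lemma iter_fixed:
  assumes "iso F (fob T F)" shows "iso F ((fob T ^^ n) F)"
proof (induction n)
  case 0
  then show ?case using assms iso_refl iso_def by auto
next
  case (Suc n)
  then show ?case using iso_trans[OF assms fob_iso] by simp
qed

lemma iter_shift:
  assumes E: "E \<in> obj D" and TE: "iso (fob T E) (shO D k E)"
  shows "iso ((fob T ^^ n) E) (shO D (int n * k) E)"
proof (induction n)
  case 0
  then show ?case using E iso_refl by (simp add: shO_0)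
next
  case (Suc n)
  have "iso ((fob T ^^ Suc n) E) (fob T (shO D (int n * k) E))" using fob_iso[OF Suc] by simp
  also have "iso \<dots> (shO D (int n * k) (fob T E))" by (rule fob_shO[OF E])
  also have "iso \<dots> (shO D (int n * k) (shO D k E))" by (rule iso_shO[OF TE])
  finally show ?case using E by (simp add: shO_shO algebra_simps)
qed

end

lemma le_limit_of_le_linear:
  fixes u :: "nat \<Rightarrow> real"
  assumes "(\<lambda>n. u n / real n) \<longlonglongrightarrow> l" "\<And>n. c * real n \<le> u n" shows "c \<le> l"
proof (rule tendsto_lowerbound[OF assms(1)])
  have "c \<le> u n / real n" if "1 \<le> n" for n using assms(2)[of n] that by (simp add: pos_le_divide_eq)
  then show "\<forall>\<^sub>F n in sequentially. c \<le> u n / real n"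
    using eventually_ge_at_top[of 1] by (rule eventually_mono[rotated])
qed simp

text \<open>The increments sum to at most \<open>(n + 1) K exp (s n)\<close>, and the logarithm of
  the linear factor is negligible after division by \<open>n\<close>. Monotonicity of
  \<open>exp (s n)\<close>, hence \<open>0 \<le> s\<close>, lets all increments be estimated by the
  last.\<close>

lemma limit_le_of_growth:
  fixes a :: "nat \<Rightarrow> real"
  assumes lim: "(\<lambda>n. ln (a n) / real n) \<longlonglongrightarrow> l" and pos: "\<And>n. 0 < a n"
    and step: "\<And>n. a (Suc n) \<le> a n + C * exp (s * real n)" and "0 \<le> C" "0 \<le> s"
  shows "l \<le> s"
proof -
  \<comment> \<open>Large enough for both the initial value and the coefficient of each
    increment.\<close>
  define K where "K = a 0 + C"
  have K: "0 < K" "C \<le> K" using pos[of 0] \<open>0 \<le> C\<close> unfolding K_def by auto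
  have bound: "a n \<le> real (Suc n) * K * exp (s * real n)" for n
  proof (induction n)
    case 0
    then show ?case using \<open>0 \<le> C\<close> by (simp add: K_def)
  next
    case (Suc n)
    have "a (Suc n) \<le> real (Suc n) * K * exp (s * real n) + K * exp (s * real n)"
      using step[of n] Suc mult_right_mono[OF K(2) exp_ge_zero, of "s * real n"]
      by linarith
    also have "\<dots> = real (Suc (Suc n)) * K * exp (s * real n)" by (simp add: algebra_simps)
    also have "\<dots> \<le> real (Suc (Suc n)) * K * exp (s * real (Suc n))"
      using K \<open>0 \<le> s\<close> by (intro mult_left_mono) (auto simp: algebra_simps)
    finally show ?case .
  qed
  have le: "ln (a n) / real n \<le> (ln K + ln 2) / real n + ln (real n) / real n + s" if n: "1 \<le> n" for n
  proof -
    \<comment> \<open>From here on \<open>n + 1 \<le> 2n\<close> turns the linear factor into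
      \<open>n\<close>, whose logarithm splits off.\<close>
    have "a n \<le> (K * 2) * (real n * exp (s * real n))"
    proof -
      have "real (Suc n) * (K * exp (s * real n)) \<le> (2 * real n) * (K * exp (s * real n))"
        using n K by (intro mult_right_mono) auto
      then show ?thesis using bound[of n] by (simp only: mult_ac)
    qed
    then have "ln (a n) \<le> ln (K * 2) + ln (real n * exp (s * real n))"
      using K n by (intro ln_le_add pos) auto
    also have "\<dots> = ln K + ln 2 + (ln (real n) + s * real n)"
      using K n by (simp add: ln_mult)
    finally have "ln (a n) / real n \<le> (ln K + ln 2 + (ln (real n) + s * real n)) / real n"
      by (rule divide_right_mono) simp
    then show ?thesis using n by (simp add: add_divide_distrib)
  qed
  have "(\<lambda>n. (ln K + ln 2) / real n + ln (real n) / real n + s) \<longlonglongrightarrow> 0 + 0 + s"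
    by (intro tendsto_add tendsto_const lim_const_over_n
        filterlim_compose[OF ln_x_over_x_tendsto_0 filterlim_real_sequentially])
  moreover have "\<forall>\<^sub>F n in sequentially.
      ln (a n) / real n \<le> (ln K + ln 2) / real n + ln (real n) / real n + s"
    using eventually_ge_at_top[of 1] by (rule eventually_mono) (use le in blast)
  ultimately show ?thesis using tendsto_le[OF _ _ lim] by fastforce
qed

section \<open>The entropy of the twist\<close>

theorem proposition5p7:
  fixes D :: "('k::field, 'o, 'm::ab_group_add) tri_cat"
    and \<E> :: "('k, 'o, 'm, 'b, 'a::ab_group_add) enhancement"
    and d :: nat
    and E :: 'o
    and T :: "('o, 'm, 'o, 'm) cat_functor"
  assumes "triangulated_category D"
    and "dg_enhancement D \<E>"
    and "finite_type D"
    and "\<exists>G. split_generator D G"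
    and "P_object D d E"
    and "P_twist D \<E> d E T"
  shows "(\<forall>t::real.
            ereal (- 2 * real d * t) \<le> entropy D t T \<and>
            entropy D t T \<le> (if t \<ge> 0 then 0 else ereal (- 2 * real d * t))) \<and>
         ((\<exists>F\<in>right_orthogonal D E. \<not> zero_obj D F) \<longrightarrow> (\<forall>t\<ge>0. entropy D t T = 0))"
proof -
  interpret triangulated_category D by (rule assms(1))
  have aut: "exact_functor D D T" "equivalence_functor D D T"
    using assms(6) unfolding P_twist_def exact_autoequivalence_def by blast+
  interpret exact_endofunctor D T by unfold_locales (rule aut(1))
  have E: "E \<in> obj D" and d: "0 < d" using assms(5) unfolding P_object_def by blast+
  obtain \<phi> h where \<phi>: "P_algebra_iso D d E \<phi>" and h: "h = \<phi> 2 (monom 1 1)"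
      and tw: "\<And>F. F \<in> obj D \<Longrightarrow> P_twist_value D E h F (fob T F)"
    using assms(6) unfolding P_twist_def P_generator_def by blast
  interpret P_algebra D d E \<phi> by unfold_locales (rule E \<phi> d)+
  have TE: "iso (fob T E) (shO D (- 2 * int d) E)"
    using P_twist_value_E tw[OF E] d h by (simp add: h_pow_def)
  have E_nonzero: "\<not> zero_obj D E" using h_pow_nonzero[of 0] h_pow_0 zero_obj_iff[OF E] by simp
  \<comment> \<open>The equivalence is faithful, so \<open>T\<close> reflects zero objects and
    iterates of a nonzero object stay nonzero; positivity of their complexities depends on
    this.\<close>
  have reflect: "zero_obj D X" if "X \<in> obj D" "zero_obj D (fob T X)" for X
  proof -
    have "fmo T (idn D X) = fmo T 0"
      using fmo_idn fmo_zero zero_obj_iff[OF fob_obj] that by simp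
    moreover have "inj_on (fmo T) (hom D X X)"
      using aut(2) that(1) unfolding equivalence_functor_def bij_betw_def by blast
    ultimately show ?thesis
      using arr_hom[OF arr_idn[OF that(1)]] arr_hom[OF arr_zero[OF that(1) that(1)]] zero_obj_iff[OF that(1)]
      by (simp add: inj_on_def)
  qed
  have iter_nonzero: "\<not> zero_obj D ((fob T ^^ n) X)" if "X \<in> obj D" "\<not> zero_obj D X" for X n
    by (induction n) (use that reflect iter_obj in auto)
  obtain G where G: "split_generator D G" using assms(4) by blast
  note G_obj = generator_obj[OF G] and adm_G = split_generator_adm[OF G]
  \<comment> \<open>A zero split-generator would generate only zero objects, contradicting that
    \<open>E\<close> is nonzero.\<close>
  have nz: "\<not> zero_obj D ((fob T ^^ n) X)" if "split_generator D X" for n X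
    using iter_nonzero generator_obj generator_nonzero[OF _ E E_nonzero] that by blast
  define a where "a t n = cx t G ((fob T ^^ n) G)" for t n
  have a_pos: "0 < a t n" for t n
    unfolding a_def using cx_pos[OF assms(3) G iter_obj[OF G_obj] nz[OF G]] .
  have cx_E_pos: "0 < cx t G F" if "F \<in> obj D" "\<not> zero_obj D F" for t F
    using cx_pos[OF assms(3) G that] .
  have cx_iter: "cx t G ((fob T ^^ n) F) \<le> a t n * cx t G F" if "F \<in> obj D" for t n F
  proof -
    have "cx t G ((fob T ^^ n) F) \<le> a t n * cx t ((fob T ^^ n) G) ((fob T ^^ n) F)"
      unfolding a_def using cx_compose[OF G_obj adm_G iter_adm_gen[OF G that]] iter_obj G_obj by blast
    also have "\<dots> \<le> a t n * cx t G F"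
      using cx_iter_le[OF G_obj adm_G[OF that]] a_pos[of t n] by (intro mult_left_mono) auto
    finally show ?thesis .
  qed
  have cx_iter_E: "cx t G ((fob T ^^ n) E) = exp (- 2 * real d * t * real n) * cx t G E" for t n
    using cx_iso[OF iter_shift[OF E TE], of t G n] cx_shO[OF G_obj adm_G[OF E], of t "int n * (- 2 * int d)"]
    by (simp add: mult_ac)
  \<comment> \<open>The exact value for \<open>T^n E\<close> is compared with
    \<open>cx_iter\<close>, and the positive number \<open>cx t G E\<close> cancels.\<close>
  have low: "- 2 * real d * t * real n \<le> ln (a t n)" for t n
  proof -
    have "exp (- 2 * real d * t * real n) \<le> a t n"
      using cx_iter[OF E, of t n] cx_iter_E[of t n] cx_E_pos[OF E E_nonzero, of t] by simp
    then show ?thesis using a_pos[of t n] ln_ge_iff by blast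
  qed
  have ent: "\<exists>l. entropy D t T = ereal l \<and> (\<lambda>n. ln (a t n) / real n) \<longlonglongrightarrow> l" for t
    using entropy_limit[OF assms(3) G nz] low unfolding a_def by blast
  obtain C where C: "triangle C G (fob T G)" "adm E C \<noteq> {}"
    using P_twist_value_adm[OF assms(3) E G_obj tw[OF G_obj]] by blast
  have adm_C1: "adm E (shO D 1 C) \<noteq> {}" using adm_shO[OF _ E] C(2) by blast
  have C1: "shO D 1 C \<in> obj D" using shO_closed triangle_obj[OF C(1)] by blast
  \<comment> \<open>Apply \<open>T^n\<close> to
    \<open>G \<rightarrow> T G \<rightarrow> C[1]\<close>. As \<open>C[1]\<close> is a summand of a
    tower over \<open>E\<close>, its image is a summand of a tower over \<open>T^n E\<close>, whose
    complexity is known exactly.\<close>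
  have step: "a t (Suc n) \<le> a t n + (cx t G E * cx t E (shO D 1 C)) * exp (- 2 * real d * t * real n)" for t n
  proof -
    have "triangle ((fob T ^^ n) G) ((fob T ^^ Suc n) G) ((fob T ^^ n) (shO D 1 C))"
      using iter_triangle[OF triangle_rotate[OF C(1)], of n] by (simp add: funpow_swap1[symmetric])
    from cx_triangle[OF this adm_G[OF iter_obj[OF G_obj]] adm_G[OF iter_obj[OF C1]]]
    have "a t (Suc n) \<le> a t n + cx t G ((fob T ^^ n) (shO D 1 C))" unfolding a_def .
    moreover have "cx t G ((fob T ^^ n) (shO D 1 C))
        \<le> cx t G ((fob T ^^ n) E) * cx t ((fob T ^^ n) E) ((fob T ^^ n) (shO D 1 C))"
      using adm_C1 iter_adm[OF E] by (intro cx_compose[OF G_obj adm_G[OF iter_obj[OF E]]]) blast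
    moreover have "\<dots> \<le> cx t G ((fob T ^^ n) E) * cx t E (shO D 1 C)"
      using cx_iter_le[OF E adm_C1] cx_nonneg[OF adm_G[OF iter_obj[OF E]]] by (intro mult_left_mono) auto
    ultimately show ?thesis using cx_iter_E[of t n] by (simp add: mult_ac)
  qed
  have bounds: "- 2 * real d * t \<le> l \<and> l \<le> max 0 (- 2 * real d * t)"
    if l: "(\<lambda>n. ln (a t n) / real n) \<longlonglongrightarrow> l" for t l
  proof
    show "- 2 * real d * t \<le> l" using le_limit_of_le_linear[OF l] low by blast
    \<comment> \<open>The growth lemma requires a nonnegative rate, so a negative exponent is
      replaced by \<open>0\<close>.\<close>
    define s where "s = max 0 (- 2 * real d * t)"
    define K where "K = cx t G E * cx t E (shO D 1 C)"
    have K: "0 \<le> K"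
      unfolding K_def using cx_nonneg[OF adm_G[OF E]] cx_nonneg[OF adm_C1] by simp
    have "a t (Suc n) \<le> a t n + K * exp (s * real n)" for n
    proof -
      have "exp (- 2 * real d * t * real n) \<le> exp (s * real n)"
        unfolding s_def exp_le_cancel_iff by (intro mult_right_mono) auto
      then have "K * exp (- 2 * real d * t * real n) \<le> K * exp (s * real n)"
        using K by (rule mult_left_mono)
      then show ?thesis using step[of t n] unfolding K_def by linarith
    qed
    then show "l \<le> max 0 (- 2 * real d * t)"
      using limit_le_of_growth[OF l a_pos _ K, of s] unfolding s_def by simp
  qed
  have part1: "ereal (- 2 * real d * t) \<le> entropy D t T \<and>
      entropy D t T \<le> (if t \<ge> 0 then 0 else ereal (- 2 * real d * t))" for t
  proof -
    obtain l where l: "entropy D t T = ereal l" "(\<lambda>n. ln (a t n) / real n) \<longlonglongrightarrow> l"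
      using ent by blast
    have "0 \<le> t \<Longrightarrow> max 0 (- 2 * real d * t) = 0"
      and "t < 0 \<Longrightarrow> max 0 (- 2 * real d * t) = - 2 * real d * t"
      by (simp_all add: max_def mult_le_0_iff)
    then show ?thesis using bounds[OF l(2)] l(1) by (cases "0 \<le> t") auto
  qed
  moreover have "entropy D t T = 0"
    if F: "F \<in> right_orthogonal D E" "\<not> zero_obj D F" and t: "0 \<le> t" for F t
  proof -
    have F_obj: "F \<in> obj D" using F(1) unfolding right_orthogonal_def by blast
    have "iso F (fob T F)" using P_twist_value_orthogonal[OF E F(1) tw[OF F_obj]] .
    then have "cx t G F = cx t G ((fob T ^^ n) F)" for n using cx_iso[OF iter_fixed] by blast
    \<comment> \<open>The complexity of \<open>F\<close> is the same for all iterates and positive,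
      so it cancels in \<open>cx_iter\<close>.\<close>
    then have "1 \<le> a t n" for n
      using cx_iter[OF F_obj, of t n] cx_E_pos[OF F_obj F(2), of t] by simp
    then have "0 * real n \<le> ln (a t n)" for n by simp
    moreover obtain l where l: "entropy D t T = ereal l" "(\<lambda>n. ln (a t n) / real n) \<longlonglongrightarrow> l"
      using ent by blast
    ultimately have "0 \<le> l" using le_limit_of_le_linear[OF l(2)] by blast
    moreover have "l \<le> 0" using part1[of t] t l(1) by simp
    ultimately show ?thesis using l(1) by simp
  qed
  ultimately show ?thesis by blast
qed

end
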